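(* Let $\delta\in(0,1)$ and $\varepsilon>0$. Suppose $\Theta\subset\mathbb{R}^p$ is compact and contained in a closed Euclidean ball of radius $r>0$, and $\boldsymbol\Psi:\Theta\to\mathbb{S}^m_{++}$ satisfies (i) $\|\boldsymbol\Psi(\boldsymbol\theta)-\boldsymbol\Psi(\boldsymbol\theta')\|_2\le L_\Psi\|\boldsymbol\theta-\boldsymbol\theta'\|_2$ for all $\boldsymbol\theta,\boldsymbol\theta'\in\Theta$, and (ii) $\alpha\mathbf{I}\preceq\boldsymbol\Psi(\boldsymbol\theta)\preceq\beta\mathbf{I}$ for all $\boldsymbol\theta\in\Theta$, with $0<\alpha\le\beta$; let $\kappa_\infty=\beta/\alpha$. Let $\widehat F_{\mathrm{SL}}$ be the SLQ estimator computed with $K$ Lanczos steps and $N$ independent Rademacher vectors (the same vectors for all $\boldsymbol\theta$). If $$K\ge \frac{\sqrt{\kappa_\infty+1}}{4}\log\Big(4\cdot\tfrac{5}{2}\varepsilon^{-1} m(\sqrt{\kappa_\infty+1}+1)\log(2\kappa_\infty)\Big),$$ $$N\ge 32\Big(\tfrac{25}{4}\varepsilon^{-2}\max_{\boldsymbol\theta\in\Theta}\|\overline{\log\boldsymbol\Psi(\boldsymbol\theta)}\|_F^2+\tfrac52\varepsilon^{-1}\max_{\boldsymbol\theta\in\Theta}\|\overline{\log\boldsymbol\Psi(\boldsymbol\theta)}\|_2\Big)\log\Big(\frac{2\gamma}{\delta}\Big),$$ where $\gamma=\max\{(3r/\eta)^p,1\}$ and $\eta=\alpha\varepsilon/(5mL_\Psi)$,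 then with probability at least $1-\delta$, $$\max_{\boldsymbol\theta\in\Theta}\big|\widehat F_{\mathrm{SL}}(\boldsymbol\theta)-\log\det(\boldsymbol\Psi(\boldsymbol\theta))\big|\le\varepsilon .$$
   Context: $\mathbb{S}^m_{++}$: symmetric positive definite $m\times m$ matrices. For a square matrix $\mathbf{B}$, $\overline{\mathbf{B}}=\mathbf{B}-\mathrm{diag}(\mathbf{B})$ denotes its off-diagonal part; $\|\cdot\|_F$ the Frobenius norm, $\|\cdot\|_2$ the spectral norm. Rademacher vectors $\mathbf{w}_i\in\{\pm1\}^m$ have i.i.d. entries uniform on $\{\pm1\}$. Stochastic Lanczos quadrature (SLQ) estimator: given independent Rademacher vectors $\mathbf{w}_1,\dots,\mathbf{w}_N$, for each $i$ run $K$ steps of the symmetric Lanczos algorithm on $\boldsymbol\Psi(\boldsymbol\theta)$ with starting vector $\mathbf{w}_i/\|\mathbf{w}_i\|_2$, producing a $K\times K$ tridiagonal matrix $\mathbf{T}_K^{(i)}$; this implicitly defines a polynomial $q_K$ (of degree at most $K-1$, depending on $i$ and $\boldsymbol\theta$) with $\mathbf{w}_i^\top q_K(\boldsymbol\Psi(\boldsymbol\theta))\mathbf{w}_i=\|\mathbf{w}_i\|_2^2\,\mathbf{e}_1^\top\log(\mathbf{T}_K^{(i)})\mathbf{e}_1$, and $\widehat F_{\mathrm{SL}}(\boldsymbol\theta)=\frac1N\sum_{i=1}^N \mathbf{w}_i^\top q_K(\boldsymbol\Psi(\boldsymbol\theta))\mathbf{w}_i$, an approximation of $\log\det\boldsymbol\Psi(\boldsymbol\theta)=\mathrm{trace}(\log\boldsymbol\Psi(\boldsymbol\theta))$.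 *)

theory Defs
  imports "HOL-Analysis.Analysis" "HOL-Probability.Probability_Mass_Function" "Jordan_Normal_Form.Determinant"
begin

definition vnorm :: "real vec \<Rightarrow> real" where
  "vnorm v = sqrt (scalar_prod v v)"

definition spec_norm :: "real mat \<Rightarrow> real" where
  "spec_norm B = Sup {vnorm (B *\<^sub>v v) | v. v \<in> carrier_vec (dim_col B) \<and> vnorm v = 1}"

definition frob_norm :: "real mat \<Rightarrow> real" where
  "frob_norm B = sqrt (\<Sum>i<dim_row B. \<Sum>j<dim_col B. (B $$ (i,j))^2)"

definition offdiag :: "real mat \<Rightarrow> real mat" where
  "offdiag B = mat (dim_row B) (dim_col B) (\<lambda>(i,j). if i = j then 0 else B $$ (i,j))"

definition sym_mat :: "real mat \<Rightarrow> bool" where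
  "sym_mat A \<longleftrightarrow> (\<exists>n. A \<in> carrier_mat n n) \<and> transpose_mat A = A"

text \<open>Primary matrix function of a symmetric (hence orthogonally diagonalisable) matrix:
  the unique n x n matrix acting as  f(lambda)  on every eigenvector of A with eigenvalue lambda.\<close>
definition mat_fun :: "(real \<Rightarrow> real) \<Rightarrow> real mat \<Rightarrow> real mat" where
  "mat_fun f A = (THE B. B \<in> carrier_mat (dim_row A) (dim_row A) \<and>
      (\<forall>v lam. v \<in> carrier_vec (dim_row A) \<longrightarrow> A *\<^sub>v v = lam \<cdot>\<^sub>v v \<longrightarrow> B *\<^sub>v v = f lam \<cdot>\<^sub>v v))"

definition mat_log :: "real mat \<Rightarrow> real mat" where
  "mat_log A = mat_fun ln A"

definition loewner_between :: "real \<Rightarrow> real mat \<Rightarrow> real \<Rightarrow> bool" where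
  "loewner_between a A b \<longleftrightarrow> (\<forall>v \<in> carrier_vec (dim_row A).
       a * scalar_prod v v \<le> scalar_prod v (A *\<^sub>v v) \<and> scalar_prod v (A *\<^sub>v v) \<le> b * scalar_prod v v)"

text \<open>Symmetric Lanczos recurrence (exact arithmetic).  Arguments: matrix A, remaining steps,
  previous Lanczos vector q_{j-1}, current vector q_j, previous beta_{j-1}.
  Returns the lists (alpha_j ...) and (beta_j ...).  On breakdown (beta_j = 0) the next vector
  is the zero vector (since 1/0 = 0), so subsequent entries vanish.\<close>
fun lanczos_aux :: "real mat \<Rightarrow> nat \<Rightarrow> real vec \<Rightarrow> real vec \<Rightarrow> real \<Rightarrow> real list \<times> real list" where
  "lanczos_aux A 0 qp q bp = ([], [])"
| "lanczos_aux A (Suc k) qp q bp =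
     (let v = A *\<^sub>v q - bp \<cdot>\<^sub>v qp;
          a = scalar_prod q v;
          v' = v - a \<cdot>\<^sub>v q;
          b = vnorm v';
          q' = (1 / b) \<cdot>\<^sub>v v';
          r = lanczos_aux A k q q' b
      in (a # fst r, b # snd r))"

definition lanczos_T :: "nat \<Rightarrow> real mat \<Rightarrow> real vec \<Rightarrow> real mat" where
  "lanczos_T K A q1 =
     (let r = lanczos_aux A K (0\<^sub>v (dim_row A)) q1 0; as = fst r; bs = snd r
      in mat K K (\<lambda>(i,j). if i = j then as ! i
                         else if j = i + 1 then bs ! i
                         else if i = j + 1 then bs ! j else 0))"

text \<open>Quadratic form  w^T q_K(A) w = ||w||^2 e_1^T log(T_K) e_1.\<close>
definition slq_quad :: "nat \<Rightarrow> real mat \<Rightarrow> real vec \<Rightarrow> real" where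
  "slq_quad K A w = (vnorm w)^2 * (mat_log (lanczos_T K A ((1 / vnorm w) \<cdot>\<^sub>v w))) $$ (0,0)"

definition slq :: "nat \<Rightarrow> real mat \<Rightarrow> real vec list \<Rightarrow> real" where
  "slq K A ws = (\<Sum>w\<leftarrow>ws. slq_quad K A w) / real (length ws)"

text \<open>All N-tuples of Rademacher vectors in {+-1}^m (uniform distribution on this finite set =
  N independent Rademacher vectors).\<close>
definition rademacher_tuples :: "nat \<Rightarrow> nat \<Rightarrow> real vec list set" where
  "rademacher_tuples N m = {ws. length ws = N \<and>
      (\<forall>w \<in> set ws. w \<in> carrier_vec m \<and> (\<forall>j<m. vec_index w j \<in> {-1, 1}))}"

end

theory Submission
  imports Defs "HOL-Probability.Distributions"
begin

text \<open>
  Write \<open>Q(\<theta>)\<close> for the mean of \<open>w\<^sup>T log \<Psi>(\<theta>) w\<close> over the sample. The Lanczos quadrature is exact for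
  polynomials of degree below \<open>2K\<close> and its nodes of positive weight lie in \<open>[\<alpha>, \<beta>]\<close>, so the estimator
  differs from \<open>Q(\<theta>)\<close> by at most \<open>2m\<close> times the uniform error of approximating \<open>ln\<close> on \<open>[\<alpha>, \<beta>]\<close>, for
  every sample and every \<open>\<theta>\<close>; the truncated Chebyshev series of \<open>ln\<close> bounds this error. Both \<open>Q\<close> and
  \<open>log det \<Psi>\<close> are Lipschitz in \<open>\<theta>\<close> with constant \<open>m L\<^sub>\<Psi> / \<alpha>\<close>, as the resolvents of two matrices bounded
  below by \<open>\<alpha>\<close> show, so it suffices to control \<open>Q - log det \<Psi>\<close> on a finite net. There it is a mean
  of Rademacher chaoses of order two with zero diagonal, whose exponential moments are bounded by decoupling
  and a Gaussian linearisation; a Chernoff bound and a union bound over the net conclude.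
\<close>

text \<open>The constants of the statement shape the proof. A net of radius \<eta> with the usual
  volume count has (1 + 2r/\<eta>)^p points, more than (3r/\<eta>)^p once \<eta> > r, so the net is
  coarsened to radius 4\<eta>/3 and the two Lipschitz moves cost 4/15 of \<epsilon> each. The sample
  size is calibrated for an error of 2/5 of \<epsilon>, yet only 19/60 remains for the chaos; the
  explicit constants 4 and 16 in its exponential moment are small enough to pay the difference. The
  Lanczos part keeps 3/20, reached through the factor 1/(2K) in the tail of the Chebyshev series and
  through ln 2 \<ge> 2/3. The second obstacle is breakdown of the Lanczos recurrence. The
  tridiagonal matrix then acquires zero rows and the eigenvalue 0, where a logarithm has no meaning;
  such nodes carry no weight, because powers of the matrix applied to the first unit vector never
  reach the zero Lanczos vectors. Expectations over samples are finite averages; integration enters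
  the moment bounds only through a one-dimensional Gaussian.\<close>

unbundle no vec_syntax
unbundle no inner_syntax

section \<open>The spectral theorem for real symmetric matrices\<close>

lemma scalar_prod_sum: "v \<in> carrier_vec n \<Longrightarrow> w \<in> carrier_vec n \<Longrightarrow>
    v \<bullet> w = (\<Sum>i<n. v $ i * w $ i)" for v w :: "real vec"
  by (auto simp: scalar_prod_def atLeast0LessThan)

lemma scalar_prod_self_nonneg: "0 \<le> v \<bullet> v" for v :: "real vec"
  by (auto simp: scalar_prod_def intro!: sum_nonneg)

lemma scalar_prod_self_eq_0: "v \<in> carrier_vec n \<Longrightarrow> v \<bullet> v = 0 \<longleftrightarrow> v = 0\<^sub>v n" for v :: "real vec"
  by (auto simp: scalar_prod_def sum_nonneg_eq_0_iff)

lemma sym_mat_scalar_prod: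
  fixes A :: "real mat"
  assumes "A \<in> carrier_mat n n" "transpose_mat A = A" "x \<in> carrier_vec n" "y \<in> carrier_vec n"
  shows "x \<bullet> (A *\<^sub>v y) = (A *\<^sub>v x) \<bullet> y"
  using transpose_vec_mult_scalar[OF assms(1) assms(4) assms(3)] assms
  by (metis comm_scalar_prod mult_mat_vec_carrier)

text \<open>Vectors of dimension n are modelled as functions whose coordinates from n on are pinned
  to 0; Tychonoff in the product topology then takes the place of Heine-Borel.\<close>

lemma compact_box_fun: "compact {x :: nat \<Rightarrow> real. \<forall>i. x i \<in> (if i < n then {-1..1} else {0})}"
proof -
  let ?S = "\<lambda>i. if i < n then {-1..1} else {0::real}"
  have "compactin (product_topology (\<lambda>i::nat. euclidean) UNIV) (PiE UNIV ?S)"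
    unfolding compactin_PiE by auto
  hence "compact (PiE UNIV ?S)"
    by (simp add: euclidean_product_topology)
  moreover have "PiE UNIV ?S = {x. \<forall>i. x i \<in> ?S i}"
    by (simp only: PiE_UNIV_domain Pi_def) auto
  ultimately show ?thesis by simp
qed

text \<open>The constraints defining \<open>C\<close> are polynomial equations in finitely many
  coordinates, hence closed, and unit length confines the coordinates to [-1, 1]; so the maximum is
  attained on a compact set of functions.\<close>

lemma rayleigh_max:
  fixes A :: "real mat" and u :: "nat \<Rightarrow> real vec"
  assumes A: "A \<in> carrier_mat n n"
    and u: "\<And>j. j < k \<Longrightarrow> u j \<in> carrier_vec n"
  defines "C \<equiv> {v \<in> carrier_vec n. v \<bullet> v = 1 \<and> (\<forall>j<k. u j \<bullet> v = 0)}"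
  assumes ne: "C \<noteq> {}"
  shows "\<exists>x\<in>C. \<forall>y\<in>C. y \<bullet> (A *\<^sub>v y) \<le> x \<bullet> (A *\<^sub>v x)"
proof -
  define B where "B = {x :: nat \<Rightarrow> real. \<forall>i. x i \<in> (if i < n then {-1..1} else {0})}"
  define F where "F = {x :: nat \<Rightarrow> real. (\<Sum>i<n. x i * x i) = 1} \<inter> (\<Inter>j\<in>{..<k}. {x. (\<Sum>i<n. u j $ i * x i) = 0})"
  define f where "f x = (\<Sum>i<n. x i * (\<Sum>j<n. A $$ (i,j) * x j))" for x :: "nat \<Rightarrow> real"
  have cf: "continuous_on S f" for S unfolding f_def
    by (intro continuous_intros continuous_on_product_coordinates[THEN continuous_on_subset]) auto
  have "closed F" unfolding F_def
    by (intro closed_Int closed_INT ballI closed_Collect_eq continuous_intros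
        continuous_on_product_coordinates[THEN continuous_on_subset]) auto
  hence cpt: "compact (B \<inter> F)" unfolding B_def
    by (intro compact_Int_closed compact_box_fun)
  have vC: "vec n x \<in> C" if "x \<in> B \<inter> F" for x
    using that by (auto simp: C_def F_def scalar_prod_def atLeast0LessThan)
  have Cv: "\<exists>x\<in>B \<inter> F. v = vec n x" if "v \<in> C" for v
  proof
    let ?x = "\<lambda>i. if i < n then v $ i else 0"
    from that have v: "v \<in> carrier_vec n" "(\<Sum>i<n. v $ i * v $ i) = 1" "\<And>j. j < k \<Longrightarrow> (\<Sum>i<n. u j $ i * v $ i) = 0"
      by (auto simp: C_def scalar_prod_def atLeast0LessThan)
    have "(v $ i)\<^sup>2 \<le> 1" if "i < n" for i
    proof -
      have "(v $ i)\<^sup>2 \<le> (\<Sum>i<n. v $ i * v $ i)" unfolding power2_eq_square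
        using that by (intro member_le_sum) auto
      thus ?thesis using v by simp
    qed
    hence "\<bar>v $ i\<bar> \<le> 1" if "i < n" for i
      using that abs_le_square_iff[of "v $ i" 1] by auto
    hence "v $ i \<le> 1" "- 1 \<le> v $ i" if "i < n" for i
      using that by (fastforce simp: abs_le_iff)+
    thus "?x \<in> B \<inter> F" using v by (auto simp: B_def F_def)
    show "v = vec n ?x" using v(1) by auto
  qed
  have ffe: "f x = vec n x \<bullet> (A *\<^sub>v vec n x)" for x
    using A by (auto simp: f_def scalar_prod_def atLeast0LessThan row_def)
  obtain x where x: "x \<in> B \<inter> F" "\<forall>y\<in>B \<inter> F. f y \<le> f x"
    using continuous_attains_sup[OF cpt _ cf] Cv ne by blast
  show ?thesis
  proof (intro bexI[of _ "vec n x"] ballI vC x)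
    fix y assume "y \<in> C"
    then obtain z where "z \<in> B \<inter> F" "y = vec n z" using Cv by blast
    thus "y \<bullet> (A *\<^sub>v y) \<le> vec n x \<bullet> (A *\<^sub>v vec n x)" using x ffe by metis
  qed
qed

text \<open>The rows \<open>u j\<close>, padded with zero rows, form a matrix whose row k vanishes
  because k < n. It is singular, and a kernel vector is orthogonal to every
  \<open>u j\<close>.\<close>

lemma exists_orthogonal_unit:
  fixes u :: "nat \<Rightarrow> real vec"
  assumes "k < n" "\<And>j. j < k \<Longrightarrow> u j \<in> carrier_vec n"
  shows "\<exists>v\<in>carrier_vec n. v \<bullet> v = 1 \<and> (\<forall>j<k. u j \<bullet> v = 0)"
proof -
  define M where "M = mat n n (\<lambda>(i,j). if i < k then u i $ j else 0)"
  have M: "M \<in> carrier_mat n n" by (simp add: M_def)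
  have "transpose_mat M *\<^sub>v unit_vec n k = 0\<^sub>v n"
    using assms(1) by (intro eq_vecI) (auto simp: M_def)
  hence "det (transpose_mat M) = 0"
    using det_0_iff_vec_prod_zero[of "transpose_mat M" n] M assms(1) unit_vec_carrier
    by (metis transpose_carrier_mat unit_vec_nonzero)
  hence "det M = 0" using det_transpose[OF M] by simp
  then obtain v where v: "v \<in> carrier_vec n" "v \<noteq> 0\<^sub>v n" "M *\<^sub>v v = 0\<^sub>v n"
    using det_0_iff_vec_prod_zero[OF M] by auto
  have o: "u j \<bullet> v = 0" if "j < k" for j
  proof -
    have "(M *\<^sub>v v) $ j = u j \<bullet> v" using that assms v(1)
      by (auto simp: M_def scalar_prod_def intro!: sum.cong)
    thus ?thesis using v that assms by auto
  qed
  have p: "v \<bullet> v > 0" using v scalar_prod_self_nonneg[of v] scalar_prod_self_eq_0[OF v(1)] by force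
  let ?v = "(1 / sqrt (v \<bullet> v)) \<cdot>\<^sub>v v"
  have "?v \<bullet> ?v = 1" using v(1) p by (simp add: field_simps)
  moreover have "u j \<bullet> ?v = 0" if "j < k" for j using o[OF that] v(1) assms that by simp
  ultimately show ?thesis using v(1) by (intro bexI[of _ ?v]) auto
qed

definition eigenbasis :: "nat \<Rightarrow> real mat \<Rightarrow> (nat \<Rightarrow> real vec) \<Rightarrow> (nat \<Rightarrow> real) \<Rightarrow> bool" where
  "eigenbasis n A u l \<longleftrightarrow> A \<in> carrier_mat n n \<and> transpose_mat A = A \<and>
     (\<forall>i<n. u i \<in> carrier_vec n \<and> A *\<^sub>v u i = l i \<cdot>\<^sub>v u i) \<and>
     (\<forall>i<n. \<forall>j<n. u i \<bullet> u j = (if i = j then 1 else 0))"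

text \<open>Near t = 0 the linear term beats the quadratic one. The witness divides by
  \<open>\<bar>b\<bar> + 1\<close> so that b = 0 needs no separate case.\<close>

lemma quadratic_dominated_imp_zero:
  fixes a b :: real
  assumes "\<And>t. 2 * t * a \<le> t\<^sup>2 * b"
  shows "a = 0"
proof (rule ccontr)
  assume "a \<noteq> 0"
  define t where "t = a / (\<bar>b\<bar> + 1)"
  have "2 * t * a \<le> t\<^sup>2 * (\<bar>b\<bar> + 1)" using assms[of t] 
    by (smt (verit) mult_left_mono zero_le_power2)
  also have "\<dots> = t * (t * (\<bar>b\<bar> + 1))" by (simp add: power2_eq_square)
  also have "t * (\<bar>b\<bar> + 1) = a" unfolding t_def by (simp add: add_nonneg_eq_0_iff)
  finally have "t * a \<le> 0" by (simp add: mult.commute)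
  moreover have "t * a > 0" using \<open>a \<noteq> 0\<close> by (simp add: t_def power2_eq_square[symmetric] add_nonneg_pos)
  ultimately show False by simp
qed

text \<open>First-order optimality without Lagrange multipliers. The residual y = A x - c x is
  orthogonal to x and, as the \<open>u j\<close> are eigenvectors of a symmetric matrix, to every
  \<open>u j\<close>; so x + t y, normalised, competes with x for every t. The term of order t in
  the comparison is 2 t (y \<bullet> y), which forces y = 0.\<close>

lemma rayleigh_max_eigenvector:
  fixes A :: "real mat" and u :: "nat \<Rightarrow> real vec"
  assumes A: "A \<in> carrier_mat n n" "transpose_mat A = A"
    and u: "\<And>j. j < k \<Longrightarrow> u j \<in> carrier_vec n" "\<And>j. j < k \<Longrightarrow> A *\<^sub>v u j = l j \<cdot>\<^sub>v u j"
  defines "C \<equiv> {v \<in> carrier_vec n. v \<bullet> v = 1 \<and> (\<forall>j<k. u j \<bullet> v = 0)}"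
  assumes x: "x \<in> C" "\<And>y. y \<in> C \<Longrightarrow> y \<bullet> (A *\<^sub>v y) \<le> x \<bullet> (A *\<^sub>v x)"
  shows "A *\<^sub>v x = (x \<bullet> (A *\<^sub>v x)) \<cdot>\<^sub>v x"
proof -
  define c where "c = x \<bullet> (A *\<^sub>v x)"
  define y where "y = A *\<^sub>v x - c \<cdot>\<^sub>v x"
  have xc: "x \<in> carrier_vec n" "x \<bullet> x = 1" "\<And>j. j < k \<Longrightarrow> u j \<bullet> x = 0" using x by (auto simp: C_def)
  have Ax: "A *\<^sub>v x \<in> carrier_vec n" using A xc by auto
  have yc: "y \<in> carrier_vec n" using Ax xc by (auto simp: y_def)
  have yx: "x \<bullet> y = 0" unfolding y_def using Ax xc by (simp add: scalar_prod_minus_distrib[of _ n] c_def)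
  have yu: "u j \<bullet> y = 0" if "j < k" for j
  proof -
    have "u j \<bullet> (A *\<^sub>v x) = l j * (u j \<bullet> x)"
      using sym_mat_scalar_prod[OF A u(1)[OF that] xc(1)] u that xc by simp
    thus ?thesis unfolding y_def using Ax xc u that by (simp add: scalar_prod_minus_distrib[of _ n])
  qed
  have yAx: "x \<bullet> (A *\<^sub>v y) = y \<bullet> y"
  proof -
    have "y \<bullet> y = (A *\<^sub>v x) \<bullet> y - c * (x \<bullet> y)"
      by (subst (1) y_def) (use Ax xc yc in \<open>simp add: minus_scalar_prod_distrib[of _ n]\<close>)
    thus ?thesis using yx sym_mat_scalar_prod[OF A xc(1) yc] by simp
  qed
  have "y \<bullet> y = 0"
  proof (rule quadratic_dominated_imp_zero)
    fix t :: real
    define z where "z = x + t \<cdot>\<^sub>v y"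
    have zc: "z \<in> carrier_vec n" using xc yc by (auto simp: z_def)
    have zz: "z \<bullet> z = 1 + t\<^sup>2 * (y \<bullet> y)"
      unfolding z_def using xc yc yx comm_scalar_prod[OF yc xc(1)]
      by (simp add: scalar_prod_add_distrib[of _ n] add_scalar_prod_distrib[of _ n] power2_eq_square)
    have zp: "z \<bullet> z > 0" unfolding zz by (smt (verit) scalar_prod_self_nonneg mult_nonneg_nonneg zero_le_power2)
    let ?w = "(1 / sqrt (z \<bullet> z)) \<cdot>\<^sub>v z"
    have "?w \<bullet> ?w = 1" using zc zp by (simp add: field_simps)
    moreover have "u j \<bullet> z = 0" if "j < k" for j
      unfolding z_def using xc yc yu u that by (simp add: scalar_prod_add_distrib[of _ n])
    hence "u j \<bullet> ?w = 0" if "j < k" for j using u that zc by simp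
    ultimately have "?w \<in> C" using zc by (auto simp: C_def)
    hence "?w \<bullet> (A *\<^sub>v ?w) \<le> c" using x(2) by (simp add: c_def)
    moreover have "?w \<bullet> (A *\<^sub>v ?w) = (z \<bullet> (A *\<^sub>v z)) / (z \<bullet> z)"
      using A zc zp by (simp add: mult_mat_vec[of _ n n] field_simps)
    ultimately have le: "z \<bullet> (A *\<^sub>v z) \<le> c * (z \<bullet> z)" using zp by (simp add: field_simps)
    have Ay: "A *\<^sub>v y \<in> carrier_vec n" using A yc by auto
    have "A *\<^sub>v z = A *\<^sub>v x + t \<cdot>\<^sub>v (A *\<^sub>v y)"
      unfolding z_def using A xc yc by (simp add: mult_add_distrib_mat_vec[of _ n n] mult_mat_vec[of _ n n])
    hence "z \<bullet> (A *\<^sub>v z) = c + t * (y \<bullet> y) + t * (y \<bullet> (A *\<^sub>v x)) + t\<^sup>2 * (y \<bullet> (A *\<^sub>v y))"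
      unfolding z_def using xc yc Ax Ay yAx
      by (simp add: scalar_prod_add_distrib[of _ n] add_scalar_prod_distrib[of _ n] power2_eq_square c_def algebra_simps)
    moreover have "y \<bullet> (A *\<^sub>v x) = y \<bullet> y"
      using sym_mat_scalar_prod[OF A yc xc(1)] yAx comm_scalar_prod[OF Ay xc(1)] by simp
    ultimately show "2 * t * (y \<bullet> y) \<le> t\<^sup>2 * (c * (y \<bullet> y) - y \<bullet> (A *\<^sub>v y))"
      using le zz by (simp add: algebra_simps)
  qed
  hence "y = 0\<^sub>v n" using scalar_prod_self_eq_0 yc by blast
  hence "A *\<^sub>v x - c \<cdot>\<^sub>v x = 0\<^sub>v n" by (simp add: y_def)
  hence "A *\<^sub>v x = c \<cdot>\<^sub>v x"
    using Ax xc A by (auto simp: vec_eq_iff)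
  thus ?thesis by (simp add: c_def)
qed

text \<open>Deflation: each new eigenvector maximises the Rayleigh quotient on the orthogonal
  complement of the earlier ones.\<close>

theorem symmetric_eigenbasis:
  fixes A :: "real mat"
  assumes A: "A \<in> carrier_mat n n" "transpose_mat A = A"
  obtains u l where "eigenbasis n A u l"
proof -
  have "\<exists>u l. (\<forall>i<k. u i \<in> carrier_vec n \<and> A *\<^sub>v u i = l i \<cdot>\<^sub>v u i) \<and>
     (\<forall>i<k. \<forall>j<k. u i \<bullet> u j = (if i = j then 1 else 0))" if "k \<le> n" for k
    using that
  proof (induction k)
    case (Suc k)
    then obtain u l where u: "\<And>i. i < k \<Longrightarrow> u i \<in> carrier_vec n" "\<And>i. i < k \<Longrightarrow> A *\<^sub>v u i = l i \<cdot>\<^sub>v u i"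
      "\<And>i j. i < k \<Longrightarrow> j < k \<Longrightarrow> u i \<bullet> u j = (if i = j then 1 else 0)" by (metis Suc_leD)
    define C where "C = {v \<in> carrier_vec n. v \<bullet> v = 1 \<and> (\<forall>j<k. u j \<bullet> v = 0)}"
    have "C \<noteq> {}" using exists_orthogonal_unit[of k n u] u Suc.prems by (auto simp: C_def)
    then obtain x where x: "x \<in> C" "\<And>y. y \<in> C \<Longrightarrow> y \<bullet> (A *\<^sub>v y) \<le> x \<bullet> (A *\<^sub>v x)"
      using rayleigh_max[OF A(1), of k u] u unfolding C_def by blast
    have e: "A *\<^sub>v x = (x \<bullet> (A *\<^sub>v x)) \<cdot>\<^sub>v x"
      using rayleigh_max_eigenvector[OF A, of k u l x] u x unfolding C_def by blast
    have xc: "x \<in> carrier_vec n" "x \<bullet> x = 1" "\<And>j. j < k \<Longrightarrow> u j \<bullet> x = 0" "\<And>j. j < k \<Longrightarrow> x \<bullet> u j = 0"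
      using x u(1) by (auto simp: C_def comm_scalar_prod[of x n])
    show ?case
      using u xc e by (intro exI[of _ "u(k := x)"] exI[of _ "l(k := x \<bullet> (A *\<^sub>v x))"])
        (auto simp: less_Suc_eq)
  qed auto
  from this[of n] that show ?thesis using A unfolding eigenbasis_def by auto
qed

section \<open>Matrix norms and functions of symmetric matrices\<close>

lemma vnorm_nonneg [simp]: "0 \<le> vnorm v"
  by (simp add: vnorm_def scalar_prod_self_nonneg)

lemma vnorm_square: "(vnorm v)\<^sup>2 = v \<bullet> v"
  by (simp add: vnorm_def scalar_prod_self_nonneg)

lemma vnorm_smult: "vnorm (c \<cdot>\<^sub>v v) = \<bar>c\<bar> * vnorm v"
proof -
  have "(c \<cdot>\<^sub>v v) \<bullet> (c \<cdot>\<^sub>v v) = c\<^sup>2 * (v \<bullet> v)"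
    by (simp add: scalar_prod_def power2_eq_square sum_distrib_left mult_ac)
  thus ?thesis by (simp add: vnorm_def real_sqrt_mult)
qed

lemma scalar_prod_le_vnorm:
  assumes "x \<in> carrier_vec n" "y \<in> carrier_vec n"
  shows "\<bar>x \<bullet> y\<bar> \<le> vnorm x * vnorm y"
proof (rule power2_le_imp_le)
  have "(x \<bullet> y)\<^sup>2 \<le> (x \<bullet> x) * (y \<bullet> y)"
    using Cauchy_Schwarz_ineq_sum[of "\<lambda>i. x $ i" "\<lambda>i. y $ i" "{..<n}"] assms
    by (simp add: scalar_prod_sum power2_eq_square)
  thus "\<bar>x \<bullet> y\<bar>\<^sup>2 \<le> (vnorm x * vnorm y)\<^sup>2" by (simp add: power_mult_distrib vnorm_square)
qed simp

lemma frob_norm_nonneg [simp]: "0 \<le> frob_norm B"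
  by (simp add: frob_norm_def sum_nonneg)

lemma vnorm_mult_mat_vec_le_frob_norm:
  assumes B: "B \<in> carrier_mat k n" and v: "v \<in> carrier_vec n"
  shows "vnorm (B *\<^sub>v v) \<le> frob_norm B * vnorm v"
proof (rule power2_le_imp_le)
  have Bv: "B *\<^sub>v v \<in> carrier_vec k" using B v by auto
  have "(vnorm (B *\<^sub>v v))\<^sup>2 = (\<Sum>i<k. (\<Sum>j<n. B $$ (i,j) * v $ j)\<^sup>2)"
    unfolding vnorm_square scalar_prod_sum[OF Bv Bv] using B v
    by (intro sum.cong refl) (auto simp: scalar_prod_def power2_eq_square atLeast0LessThan)
  also have "\<dots> \<le> (\<Sum>i<k. (\<Sum>j<n. (B $$ (i,j))\<^sup>2) * (\<Sum>j<n. (v $ j)\<^sup>2))"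
    by (intro sum_mono Cauchy_Schwarz_ineq_sum)
  also have "\<dots> = (frob_norm B)\<^sup>2 * (vnorm v)\<^sup>2"
    using B v unfolding frob_norm_def vnorm_square scalar_prod_sum[OF v v]
    by (simp add: sum_nonneg sum_distrib_right power2_eq_square)
  finally show "(vnorm (B *\<^sub>v v))\<^sup>2 \<le> (frob_norm B * vnorm v)\<^sup>2" by (simp add: power_mult_distrib)
qed simp

text \<open>\<open>Sup\<close> on the reals is informative only for nonempty bounded sets; the
  Frobenius norm supplies the bound.\<close>

lemma bdd_above_spec_norm:
  "bdd_above {vnorm (B *\<^sub>v v) | v. v \<in> carrier_vec (dim_col B) \<and> vnorm v = 1}"
proof (rule bdd_aboveI)
  fix r assume "r \<in> {vnorm (B *\<^sub>v v) | v. v \<in> carrier_vec (dim_col B) \<and> vnorm v = 1}"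
  then obtain v where "r = vnorm (B *\<^sub>v v)" "v \<in> carrier_vec (dim_col B)" "vnorm v = 1" by blast
  thus "r \<le> frob_norm B"
    using vnorm_mult_mat_vec_le_frob_norm[of B "dim_row B" "dim_col B" v] by simp
qed

lemma vnorm_mult_mat_vec_le_spec_norm:
  assumes B: "B \<in> carrier_mat k n" and v: "v \<in> carrier_vec n"
  shows "vnorm (B *\<^sub>v v) \<le> spec_norm B * vnorm v"
proof (cases "vnorm v = 0")
  case True
  thus ?thesis using vnorm_mult_mat_vec_le_frob_norm[OF B v] by simp
next
  case False
  hence p: "vnorm v > 0" using vnorm_nonneg[of v] by linarith
  let ?w = "(1 / vnorm v) \<cdot>\<^sub>v v"
  have "vnorm (B *\<^sub>v ?w) \<le> spec_norm B" unfolding spec_norm_def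
    using v B p by (intro cSup_upper bdd_above_spec_norm CollectI exI[of _ ?w]) (auto simp: vnorm_smult)
  moreover have "B *\<^sub>v ?w = (1 / vnorm v) \<cdot>\<^sub>v (B *\<^sub>v v)" using B v by (simp add: mult_mat_vec)
  ultimately show ?thesis using p by (simp add: vnorm_smult field_simps)
qed

text \<open>In dimension 0 there is no unit vector and \<open>spec_norm\<close> is the
  \<open>Sup\<close> of an empty set, hence 0 < n here and the case distinctions on the dimension in
  later proofs.\<close>

lemma spec_norm_nonneg:
  assumes "B \<in> carrier_mat k n" "0 < n"
  shows "0 \<le> spec_norm B"
proof -
  have "0 \<le> vnorm (B *\<^sub>v unit_vec n 0)" by simp
  also have "\<dots> \<le> spec_norm B * vnorm (unit_vec n 0)"
    by (rule vnorm_mult_mat_vec_le_spec_norm) (use assms in auto)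
  finally show ?thesis using assms by (simp add: vnorm_def)
qed

lemma spec_norm_le_frob_norm:
  assumes "B \<in> carrier_mat k n" "0 < n"
  shows "spec_norm B \<le> frob_norm B"
  unfolding spec_norm_def
proof (rule cSup_least)
  show "{vnorm (B *\<^sub>v v) |v. v \<in> carrier_vec (dim_col B) \<and> vnorm v = 1} \<noteq> {}"
    using assms by (auto simp: vnorm_def intro!: exI[of _ "unit_vec n 0"])
next
  fix r assume "r \<in> {vnorm (B *\<^sub>v v) | v. v \<in> carrier_vec (dim_col B) \<and> vnorm v = 1}"
  then obtain v where "r = vnorm (B *\<^sub>v v)" "v \<in> carrier_vec n" "vnorm v = 1" using assms by blast
  thus "r \<le> frob_norm B" using vnorm_mult_mat_vec_le_frob_norm[OF assms(1)] by fastforce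
qed

lemma bilinear_le_spec_norm:
  assumes "B \<in> carrier_mat n n" "x \<in> carrier_vec n" "y \<in> carrier_vec n"
  shows "\<bar>x \<bullet> (B *\<^sub>v y)\<bar> \<le> spec_norm B * vnorm x * vnorm y"
proof -
  have "\<bar>x \<bullet> (B *\<^sub>v y)\<bar> \<le> vnorm x * vnorm (B *\<^sub>v y)"
    by (rule scalar_prod_le_vnorm) (use assms in auto)
  also have "\<dots> \<le> vnorm x * (spec_norm B * vnorm y)"
    by (intro mult_left_mono vnorm_mult_mat_vec_le_spec_norm) (use assms in auto)
  finally show ?thesis by (simp add: algebra_simps)
qed

lemma bilinear_sum:
  fixes B :: "real mat"
  assumes "B \<in> carrier_mat n n" "x \<in> carrier_vec n" "y \<in> carrier_vec n"
  shows "x \<bullet> (B *\<^sub>v y) = (\<Sum>a<n. \<Sum>b<n. x $ a * B $$ (a,b) * y $ b)"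
proof -
  have "x \<bullet> (B *\<^sub>v y) = (\<Sum>a<n. x $ a * (\<Sum>b<n. B $$ (a,b) * y $ b))"
    using assms by (subst scalar_prod_sum[of _ n]) (auto simp: scalar_prod_def atLeast0LessThan)
  thus ?thesis by (simp add: sum_distrib_left mult.assoc)
qed

section \<open>Spectral calculus in an orthonormal eigenbasis\<close>

context
  fixes n A u l
  assumes eb: "eigenbasis n A u l"
begin

lemma eigenbasis_carrier: "A \<in> carrier_mat n n" "k < n \<Longrightarrow> u k \<in> carrier_vec n"
  using eb by (auto simp: eigenbasis_def)

lemma eigenbasis_symmetric: "transpose_mat A = A"
  using eb by (auto simp: eigenbasis_def)

lemma eigenbasis_eigen: "k < n \<Longrightarrow> A *\<^sub>v u k = l k \<cdot>\<^sub>v u k"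
  using eb by (auto simp: eigenbasis_def)

lemma eigenbasis_orthonormal: "i < n \<Longrightarrow> j < n \<Longrightarrow> u i \<bullet> u j = (if i = j then 1 else 0)"
  using eb by (auto simp: eigenbasis_def)

text \<open>With the \<open>u k\<close> as rows of U, orthonormality says that U times its transpose
  is the identity. A one-sided inverse of a square matrix is two-sided, so the columns are
  orthonormal as well.\<close>

lemma eigenbasis_complete:
  assumes "a < n" "b < n"
  shows "(\<Sum>k<n. u k $ a * u k $ b) = (if a = b then 1 else 0)"
proof -
  define U where "U = mat n n (\<lambda>(i,j). u i $ j)"
  have U: "U \<in> carrier_mat n n" "transpose_mat U \<in> carrier_mat n n" by (auto simp: U_def)
  have "U * transpose_mat U = 1\<^sub>m n"
  proof (rule eq_matI)
    fix i j assume "i < dim_row (1\<^sub>m n :: real mat)" "j < dim_col (1\<^sub>m n :: real mat)"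
    moreover from this have "(U * transpose_mat U) $$ (i,j) = u i \<bullet> u j"
      using eigenbasis_carrier(2)[of i] eigenbasis_carrier(2)[of j] by (auto simp: U_def scalar_prod_def)
    ultimately show "(U * transpose_mat U) $$ (i,j) = 1\<^sub>m n $$ (i,j)"
      using eigenbasis_orthonormal by auto
  qed (auto simp: U_def)
  hence "transpose_mat U * U = 1\<^sub>m n" using mat_mult_left_right_inverse U by blast
  moreover have "(transpose_mat U * U) $$ (a,b) = (\<Sum>k<n. u k $ a * u k $ b)"
    using assms by (auto simp: U_def scalar_prod_def atLeast0LessThan)
  ultimately show ?thesis using assms by auto
qed

lemma eigenbasis_parseval:
  assumes "x \<in> carrier_vec n" "y \<in> carrier_vec n"
  shows "x \<bullet> y = (\<Sum>k<n. (x \<bullet> u k) * (u k \<bullet> y))"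
proof -
  have "(\<Sum>k<n. (x \<bullet> u k) * (u k \<bullet> y)) = (\<Sum>k<n. \<Sum>a<n. \<Sum>b<n. (x $ a * y $ b) * (u k $ a * u k $ b))"
    using assms eigenbasis_carrier
    by (auto simp: scalar_prod_sum[of _ n] sum_product algebra_simps intro!: sum.cong)
  also have "\<dots> = (\<Sum>a<n. \<Sum>k<n. \<Sum>b<n. (x $ a * y $ b) * (u k $ a * u k $ b))" by (rule sum.swap)
  also have "\<dots> = (\<Sum>a<n. \<Sum>b<n. \<Sum>k<n. (x $ a * y $ b) * (u k $ a * u k $ b))"
    by (intro sum.cong refl sum.swap)
  also have "\<dots> = (\<Sum>a<n. \<Sum>b<n. (x $ a * y $ b) * (if a = b then 1 else 0))"
    by (intro sum.cong refl) (simp add: eigenbasis_complete flip: sum_distrib_left)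
  also have "\<dots> = (\<Sum>a<n. x $ a * y $ a)"
    by (intro sum.cong refl) (simp add: if_distrib cong: if_cong)
  finally show ?thesis using assms by (simp add: scalar_prod_sum[of _ n])
qed

lemma eigenbasis_expand:
  assumes "v \<in> carrier_vec n" "a < n"
  shows "v $ a = (\<Sum>k<n. u k $ a * (u k \<bullet> v))"
  using eigenbasis_parseval[of "unit_vec n a" v] assms eigenbasis_carrier by simp

lemma eigenbasis_coeff_mult:
  assumes "v \<in> carrier_vec n" "k < n"
  shows "u k \<bullet> (A *\<^sub>v v) = l k * (u k \<bullet> v)"
  using sym_mat_scalar_prod[OF eigenbasis_carrier(1) eigenbasis_symmetric eigenbasis_carrier(2) assms(1)]
    assms eigenbasis_carrier eigenbasis_eigen by simp

text \<open>Existence for the \<open>THE\<close>: if A v = c v, then v has no component along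
  \<open>u k\<close> unless \<open>l k = c\<close>, so repeated eigenvalues cause no conflict.
  Uniqueness: the values on the basis \<open>u\<close> determine the matrix.\<close>

lemma eigenbasis_mat_fun:
  "mat_fun f A = mat n n (\<lambda>(a,b). \<Sum>k<n. f (l k) * u k $ a * u k $ b)"
  unfolding mat_fun_def
proof (rule the_equality)
  define B where "B = mat n n (\<lambda>(a,b). \<Sum>k<n. f (l k) * u k $ a * u k $ b)"
  have dA: "dim_row A = n" using eigenbasis_carrier by auto
  have "B *\<^sub>v v = f c \<cdot>\<^sub>v v" if v: "v \<in> carrier_vec n" "A *\<^sub>v v = c \<cdot>\<^sub>v v" for v c
  proof (rule eq_vecI)
    fix a assume "a < dim_vec (f c \<cdot>\<^sub>v v)"
    hence a: "a < n" using v by auto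
    have eq: "f (l k) * (u k \<bullet> v) = f c * (u k \<bullet> v)" if "k < n" for k
    proof (cases "u k \<bullet> v = 0")
      case False
      have "l k * (u k \<bullet> v) = c * (u k \<bullet> v)"
        using eigenbasis_coeff_mult[OF v(1) that] v eigenbasis_carrier that by auto
      hence "l k = c" using False by simp
      thus ?thesis by simp
    qed simp
    have "(B *\<^sub>v v) $ a = (\<Sum>b<n. (\<Sum>k<n. f (l k) * u k $ a * u k $ b) * v $ b)"
      using v a by (auto simp: B_def scalar_prod_def atLeast0LessThan)
    also have "\<dots> = (\<Sum>b<n. \<Sum>k<n. f (l k) * u k $ a * (u k $ b * v $ b))"
      by (simp add: sum_distrib_right mult.assoc)
    also have "\<dots> = (\<Sum>k<n. \<Sum>b<n. f (l k) * u k $ a * (u k $ b * v $ b))" by (rule sum.swap)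
    also have "\<dots> = (\<Sum>k<n. u k $ a * (f (l k) * (u k \<bullet> v)))"
      using v eigenbasis_carrier by (simp add: scalar_prod_sum[of _ n] sum_distrib_left algebra_simps)
    also have "\<dots> = f c * (\<Sum>k<n. u k $ a * (u k \<bullet> v))"
      unfolding sum_distrib_left by (intro sum.cong refl) (use eq in force)
    also have "\<dots> = (f c \<cdot>\<^sub>v v) $ a" using eigenbasis_expand[OF v(1) a] v a by simp
    finally show "(B *\<^sub>v v) $ a = (f c \<cdot>\<^sub>v v) $ a" .
  qed (use that in \<open>auto simp: B_def\<close>)
  thus "B \<in> carrier_mat (dim_row A) (dim_row A) \<and>
    (\<forall>v c. v \<in> carrier_vec (dim_row A) \<longrightarrow> A *\<^sub>v v = c \<cdot>\<^sub>v v \<longrightarrow> B *\<^sub>v v = f c \<cdot>\<^sub>v v)"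
    unfolding dA by (auto simp: B_def)
next
  have dA: "dim_row A = n" using eigenbasis_carrier by auto
  fix B assume "B \<in> carrier_mat (dim_row A) (dim_row A) \<and>
    (\<forall>v c. v \<in> carrier_vec (dim_row A) \<longrightarrow> A *\<^sub>v v = c \<cdot>\<^sub>v v \<longrightarrow> B *\<^sub>v v = f c \<cdot>\<^sub>v v)"
  hence B: "B \<in> carrier_mat n n" "\<And>k. k < n \<Longrightarrow> B *\<^sub>v u k = f (l k) \<cdot>\<^sub>v u k"
    using dA eigenbasis_carrier eigenbasis_eigen by auto
  show "B = mat n n (\<lambda>(a,b). \<Sum>k<n. f (l k) * u k $ a * u k $ b)"
  proof (rule eq_matI)
    fix a b assume "a < dim_row (mat n n (\<lambda>(a,b). \<Sum>k<n. f (l k) * u k $ a * u k $ b))"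
      "b < dim_col (mat n n (\<lambda>(a,b). \<Sum>k<n. f (l k) * u k $ a * u k $ b))"
    hence ab: "a < n" "b < n" by auto
    have Bu: "(\<Sum>c<n. B $$ (a,c) * u k $ c) = f (l k) * u k $ a" if "k < n" for k
    proof -
      have "(B *\<^sub>v u k) $ a = (\<Sum>c<n. B $$ (a,c) * u k $ c)"
        using B(1) eigenbasis_carrier(2)[OF that] ab by (auto simp: scalar_prod_def atLeast0LessThan)
      thus ?thesis using B(2)[OF that] eigenbasis_carrier(2)[OF that] ab by simp
    qed
    have "(\<Sum>k<n. f (l k) * u k $ a * u k $ b) = (\<Sum>k<n. \<Sum>c<n. B $$ (a,c) * (u k $ c * u k $ b))"
      by (simp add: Bu[symmetric] sum_distrib_right mult.assoc)
    also have "\<dots> = (\<Sum>c<n. \<Sum>k<n. B $$ (a,c) * (u k $ c * u k $ b))" by (rule sum.swap)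
    also have "\<dots> = (\<Sum>c<n. B $$ (a,c) * (if c = b then 1 else 0))"
      using ab by (intro sum.cong refl) (simp add: eigenbasis_complete flip: sum_distrib_left)
    also have "\<dots> = B $$ (a,b)" using ab by (simp add: if_distrib cong: if_cong)
    finally show "B $$ (a,b) = mat n n (\<lambda>(a,b). \<Sum>k<n. f (l k) * u k $ a * u k $ b) $$ (a,b)"
      using ab by simp
  qed (use B in auto)
qed

lemma eigenbasis_mat_fun_bilinear:
  assumes "x \<in> carrier_vec n" "y \<in> carrier_vec n"
  shows "x \<bullet> (mat_fun f A *\<^sub>v y) = (\<Sum>k<n. f (l k) * (x \<bullet> u k) * (u k \<bullet> y))"
proof -
  have "x \<bullet> (mat_fun f A *\<^sub>v y) = (\<Sum>a<n. \<Sum>b<n. \<Sum>k<n. f (l k) * (x $ a * u k $ a) * (u k $ b * y $ b))"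
    using assms by (subst bilinear_sum[of _ n])
      (auto simp: eigenbasis_mat_fun sum_distrib_left sum_distrib_right algebra_simps intro!: sum.cong)
  also have "\<dots> = (\<Sum>a<n. \<Sum>k<n. \<Sum>b<n. f (l k) * (x $ a * u k $ a) * (u k $ b * y $ b))"
    by (intro sum.cong refl sum.swap)
  also have "\<dots> = (\<Sum>k<n. \<Sum>a<n. \<Sum>b<n. f (l k) * (x $ a * u k $ a) * (u k $ b * y $ b))" by (rule sum.swap)
  also have "\<dots> = (\<Sum>k<n. f (l k) * (x \<bullet> u k) * (u k \<bullet> y))"
    using assms eigenbasis_carrier
    by (intro sum.cong refl, unfold mult.assoc) (simp add: scalar_prod_sum[of _ n] sum_product mult.assoc flip: sum_distrib_left)
  finally show ?thesis .
qed

lemma eigenbasis_comm: "x \<in> carrier_vec n \<Longrightarrow> k < n \<Longrightarrow> x \<bullet> u k = u k \<bullet> x"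
  using eigenbasis_carrier(2) comm_scalar_prod by blast

lemma eigenbasis_mat_fun_quadratic:
  assumes "x \<in> carrier_vec n"
  shows "x \<bullet> (mat_fun f A *\<^sub>v x) = (\<Sum>k<n. f (l k) * (u k \<bullet> x)\<^sup>2)"
  unfolding eigenbasis_mat_fun_bilinear[OF assms assms]
  by (intro sum.cong refl) (simp add: eigenbasis_comm[OF assms] power2_eq_square)

lemma eigenbasis_sum_coeff_square:
  assumes "x \<in> carrier_vec n"
  shows "(\<Sum>k<n. (u k \<bullet> x)\<^sup>2) = x \<bullet> x"
  unfolding eigenbasis_parseval[OF assms assms]
  by (intro sum.cong refl) (simp add: eigenbasis_comm[OF assms] power2_eq_square)

lemma eigenbasis_funpow:
  assumes "v \<in> carrier_vec n"
  shows "((*\<^sub>v) A ^^ j) v \<in> carrier_vec n \<and> (\<forall>k<n. u k \<bullet> ((*\<^sub>v) A ^^ j) v = l k ^ j * (u k \<bullet> v))"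
  using assms eigenbasis_carrier(1) by (induction j) (auto simp: eigenbasis_coeff_mult)

text \<open>These are the moments of the spectral measure of v, which puts mass
  \<open>(u k \<bullet> v)\<^sup>2\<close> at \<open>l k\<close>. The quadrature argument compares
  them for A and for the tridiagonal matrix.\<close>

lemma eigenbasis_moment:
  assumes "v \<in> carrier_vec n"
  shows "v \<bullet> ((*\<^sub>v) A ^^ j) v = (\<Sum>k<n. l k ^ j * (u k \<bullet> v)\<^sup>2)"
proof -
  have c: "((*\<^sub>v) A ^^ j) v \<in> carrier_vec n" using eigenbasis_funpow[OF assms] by blast
  show ?thesis unfolding eigenbasis_parseval[OF assms c]
    using eigenbasis_funpow[OF assms, of j]
    by (intro sum.cong refl) (simp add: eigenbasis_comm[OF assms] power2_eq_square)
qed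

lemma eigenbasis_trace_mat_fun: "(\<Sum>a<n. mat_fun f A $$ (a,a)) = (\<Sum>k<n. f (l k))"
proof -
  have "(\<Sum>a<n. mat_fun f A $$ (a,a)) = (\<Sum>k<n. \<Sum>a<n. f (l k) * (u k $ a * u k $ a))"
    unfolding sum.swap[of "\<lambda>k a. f (l k) * (u k $ a * u k $ a)"] by (simp add: eigenbasis_mat_fun mult.assoc)
  also have "\<dots> = (\<Sum>k<n. f (l k) * (u k \<bullet> u k))"
    using eigenbasis_carrier by (simp add: scalar_prod_sum[of _ n] sum_distrib_left)
  finally show ?thesis by (simp add: eigenbasis_orthonormal)
qed

lemma eigenbasis_det: "det A = (\<Prod>k<n. l k)"
proof -
  define V where "V = mat n n (\<lambda>(i,j). u j $ i)"
  define D where "D = mat n n (\<lambda>(i,j). if i = j then l i else 0)"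
  have c: "V \<in> carrier_mat n n" "D \<in> carrier_mat n n" "A \<in> carrier_mat n n"
    using eigenbasis_carrier by (auto simp: V_def D_def)
  have "A * V = V * D"
  proof (rule eq_matI)
    fix i j assume "i < dim_row (V * D)" "j < dim_col (V * D)"
    hence ij: "i < n" "j < n" using c by auto
    have "(A * V) $$ (i,j) = (A *\<^sub>v u j) $ i"
      using ij c eigenbasis_carrier(2)[of j] by (auto simp: V_def scalar_prod_def intro!: sum.cong)
    also have "\<dots> = l j * u j $ i" using ij eigenbasis_eigen eigenbasis_carrier(2)[of j] by simp
    also have "\<dots> = (V * D) $$ (i,j)"
      using ij by (simp add: V_def D_def scalar_prod_def if_distrib cong: if_cong)
    finally show "(A * V) $$ (i,j) = (V * D) $$ (i,j)" .
  qed (use c in auto)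
  hence "det A * det V = det V * det D" using c by (metis det_mult)
  moreover have "transpose_mat V * V = 1\<^sub>m n"
  proof (rule eq_matI)
    fix i j assume "i < dim_row (1\<^sub>m n :: real mat)" "j < dim_col (1\<^sub>m n :: real mat)"
    moreover from this have "(transpose_mat V * V) $$ (i,j) = u i \<bullet> u j"
      using eigenbasis_carrier(2)[of i] eigenbasis_carrier(2)[of j] by (auto simp: V_def scalar_prod_def)
    ultimately show "(transpose_mat V * V) $$ (i,j) = 1\<^sub>m n $$ (i,j)"
      using eigenbasis_orthonormal by auto
  qed (auto simp: V_def)
  hence "det (transpose_mat V) * det V = 1"
    using c det_mult[of "transpose_mat V" n V] by simp
  hence "det V \<noteq> 0" by auto
  ultimately have "det A = det D" by simp
  also have "\<dots> = prod_list (diag_mat D)"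
    by (rule det_upper_triangular[OF _ c(2)]) (auto simp: D_def upper_triangular_def)
  also have "\<dots> = (\<Prod>k<n. l k)"
    by (simp add: D_def prod_list_diag_prod atLeast0LessThan)
  finally show ?thesis .
qed

lemma eigenbasis_loewner:
  assumes "loewner_between a A b" "k < n"
  shows "a \<le> l k" "l k \<le> b"
proof -
  have "dim_row A = n" "u k \<in> carrier_vec n" "u k \<bullet> u k = 1"
    using eigenbasis_carrier eigenbasis_orthonormal assms(2) by auto
  moreover from this have "u k \<bullet> (A *\<^sub>v u k) = l k" using eigenbasis_eigen[OF assms(2)] by simp
  ultimately show "a \<le> l k" "l k \<le> b" using bspec[OF assms(1)[unfolded loewner_between_def], of "u k"] by auto
qed

end

lemma eigenbasis_coeff_mat_fun:
  assumes A: "eigenbasis n A u l" and w: "w \<in> carrier_vec n" and i: "i < n"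
  shows "u i \<bullet> (mat_fun f A *\<^sub>v w) = f (l i) * (u i \<bullet> w)"
proof -
  have "u i \<bullet> (mat_fun f A *\<^sub>v w) = (\<Sum>k<n. f (l k) * (u i \<bullet> u k) * (u k \<bullet> w))"
    by (rule eigenbasis_mat_fun_bilinear[OF A eigenbasis_carrier(2)[OF A i] w])
  also have "\<dots> = (\<Sum>k<n. if i = k then f (l k) * (u k \<bullet> w) else 0)"
    using eigenbasis_orthonormal[OF A i] by (intro sum.cong refl) simp
  finally show ?thesis using i by simp
qed

lemma eigenbasis_bilinear:
  assumes e: "eigenbasis n A u l" and "x \<in> carrier_vec n" "y \<in> carrier_vec n"
  shows "x \<bullet> (A *\<^sub>v y) = (\<Sum>k<n. l k * (x \<bullet> u k) * (u k \<bullet> y))"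
proof -
  have "A *\<^sub>v y \<in> carrier_vec n" using eigenbasis_carrier[OF e] assms by auto
  thus ?thesis unfolding eigenbasis_parseval[OF e assms(2)]
    using eigenbasis_coeff_mult[OF e assms(3)] eigenbasis_parseval[OF e assms(2), of "A *\<^sub>v y"] by (simp add: mult_ac)
qed

lemma eigenbasis_trace:
  assumes e: "eigenbasis n A u l"
  shows "(\<Sum>a<n. A $$ (a,a)) = (\<Sum>k<n. l k)"
proof -
  have "A $$ (a,a) = (\<Sum>k<n. l k * (u k $ a * u k $ a))" if "a < n" for a
    using eigenbasis_bilinear[OF e, of "unit_vec n a" "unit_vec n a"] that eigenbasis_carrier[OF e] by (simp add: mult_ac)
  hence "(\<Sum>a<n. A $$ (a,a)) = (\<Sum>a<n. \<Sum>k<n. l k * (u k $ a * u k $ a))" by simp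
  also have "\<dots> = (\<Sum>k<n. \<Sum>a<n. l k * (u k $ a * u k $ a))" by (rule sum.swap)
  also have "\<dots> = (\<Sum>k<n. l k * (u k \<bullet> u k))"
    using eigenbasis_carrier[OF e] by (simp add: scalar_prod_sum[of _ n] sum_distrib_left)
  finally show ?thesis by (simp add: eigenbasis_orthonormal[OF e])
qed

section \<open>Lipschitz continuity of the matrix logarithm\<close>

text \<open>Equal total weight allows \<open>ln t\<close> to be subtracted from every logarithm, and
  ln (a + t) - ln t tends to 0.\<close>

lemma shifted_log_gap_tendsto:
  fixes c d l k :: "nat \<Rightarrow> real"
  assumes "sum c {..<n} = sum d {..<n}"
  shows "((\<lambda>t. (\<Sum>i<n. c i * ln (l i + t)) - (\<Sum>i<n. d i * ln (k i + t))) \<longlongrightarrow> 0) at_top"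
proof -
  have ln_gap: "((\<lambda>t. ln (a + t) - ln t) \<longlongrightarrow> 0) at_top" for a :: real
  proof -
    have "((\<lambda>t. ln (1 + a / t)) \<longlongrightarrow> ln (1 + 0)) at_top"
      by (intro tendsto_intros tendsto_divide_0[OF tendsto_const] filterlim_at_top_imp_at_infinity filterlim_ident) auto
    moreover have "\<forall>\<^sub>F t in at_top. ln (1 + a / t) = ln (a + t) - ln t"
      using eventually_gt_at_top[of "max 0 (-a)"]
    proof eventually_elim
      case (elim t)
      hence "1 + a / t = (a + t) / t" by (simp add: field_simps)
      thus ?case using elim by (simp add: ln_div)
    qed
    ultimately show ?thesis by (simp add: tendsto_cong)
  qed
  have "((\<lambda>t. (\<Sum>i<n. c i * (ln (l i + t) - ln t)) - (\<Sum>i<n. d i * (ln (k i + t) - ln t)))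
      \<longlongrightarrow> (\<Sum>i<n. c i * 0) - (\<Sum>i<n. d i * 0)) at_top"
    by (intro tendsto_intros ln_gap)
  moreover have "(\<Sum>i<n. c i * (ln (l i + t) - ln t)) - (\<Sum>i<n. d i * (ln (k i + t) - ln t)) =
     (\<Sum>i<n. c i * ln (l i + t)) - (\<Sum>i<n. d i * ln (k i + t))" for t
    using assms by (simp add: right_diff_distrib sum_subtractf flip: sum_distrib_right)
  ultimately show ?thesis by simp
qed

text \<open>This is the quadratic form of \<open>(A + t)\<^sup>-\<^sup>1 - (B + t)\<^sup>-\<^sup>1 = (A + t)\<^sup>-\<^sup>1 (B - A) (B + t)\<^sup>-\<^sup>1\<close>.\<close>
lemma resolvent_gap:
  assumes A: "eigenbasis n A u l" and B: "eigenbasis n B v k" and w: "w \<in> carrier_vec n"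
    and pos: "0 < \<alpha>" "0 \<le> t" "\<And>i. i < n \<Longrightarrow> \<alpha> \<le> l i" "\<And>i. i < n \<Longrightarrow> \<alpha> \<le> k i"
  shows "\<bar>(\<Sum>i<n. (u i \<bullet> w)\<^sup>2 / (l i + t)) - (\<Sum>j<n. (v j \<bullet> w)\<^sup>2 / (k j + t))\<bar>
     \<le> spec_norm (A - B) * (w \<bullet> w) / (\<alpha> + t)\<^sup>2"
proof -
  note cA = eigenbasis_carrier[OF A] and cB = eigenbasis_carrier[OF B]
  define f where "f = (\<lambda>x. 1 / (x + t))"
  define x where "x = mat_fun f A *\<^sub>v w"
  define y where "y = mat_fun f B *\<^sub>v w"
  have fA: "mat_fun f A \<in> carrier_mat n n" and fB: "mat_fun f B \<in> carrier_mat n n"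
    by (auto simp: eigenbasis_mat_fun[OF A] eigenbasis_mat_fun[OF B])
  have xy: "x \<in> carrier_vec n" "y \<in> carrier_vec n" using w fA fB by (auto simp: x_def y_def)
  have ux: "u i \<bullet> x = f (l i) * (u i \<bullet> w)" if "i < n" for i
    unfolding x_def by (rule eigenbasis_coeff_mat_fun[OF A w that])
  have vy: "v i \<bullet> y = f (k i) * (v i \<bullet> w)" if "i < n" for i
    unfolding y_def by (rule eigenbasis_coeff_mat_fun[OF B w that])
  \<comment> \<open>Both resolvents have norm at most 1 / (\<alpha> + t); the generic form serves x
    and y alike.\<close>
  have small: "vnorm z \<le> vnorm w / (\<alpha> + t)"
    if E: "eigenbasis n C e h" and h: "\<And>i. i < n \<Longrightarrow> \<alpha> \<le> h i" and z: "z \<in> carrier_vec n"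
      "\<And>i. i < n \<Longrightarrow> e i \<bullet> z = f (h i) * (e i \<bullet> w)" for C e h z
  proof (rule power2_le_imp_le)
    have "(vnorm z)\<^sup>2 = (\<Sum>i<n. (f (h i))\<^sup>2 * (e i \<bullet> w)\<^sup>2)"
      unfolding vnorm_square eigenbasis_sum_coeff_square[OF E z(1), symmetric]
      by (intro sum.cong refl) (simp add: z power_mult_distrib)
    also have "\<dots> \<le> (\<Sum>i<n. (1 / (\<alpha> + t))\<^sup>2 * (e i \<bullet> w)\<^sup>2)"
      unfolding f_def using pos h
      by (intro sum_mono mult_right_mono power_mono divide_left_mono mult_pos_pos) (force intro: add_pos_nonneg)+
    also have "\<dots> = (vnorm w / (\<alpha> + t))\<^sup>2"
      by (simp add: vnorm_square power_divide eigenbasis_sum_coeff_square[OF E w] flip: sum_divide_distrib)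
    finally show "(vnorm z)\<^sup>2 \<le> (vnorm w / (\<alpha> + t))\<^sup>2" .
  qed (use pos in simp)
  have "(\<Sum>i<n. (u i \<bullet> w)\<^sup>2 / (l i + t)) = w \<bullet> x"
    unfolding x_def eigenbasis_mat_fun_quadratic[OF A w] by (simp add: f_def)
  also have "\<dots> = x \<bullet> w" using xy w comm_scalar_prod by blast
  \<comment> \<open>Insert w = (B + t) y, verified coefficientwise in the eigenbasis of B.\<close>
  also have "\<dots> = x \<bullet> (B *\<^sub>v y) + t * (x \<bullet> y)"
  proof -
    have By: "B *\<^sub>v y \<in> carrier_vec n" using xy cB by auto
    have "(x \<bullet> v i) * (v i \<bullet> w) = (x \<bullet> v i) * (v i \<bullet> (B *\<^sub>v y)) + t * ((x \<bullet> v i) * (v i \<bullet> y))" if "i < n" for i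
    proof -
      have "v i \<bullet> (B *\<^sub>v y) + t * (v i \<bullet> y) = (k i + t) * (f (k i) * (v i \<bullet> w))"
        using eigenbasis_coeff_mult[OF B xy(2) that] vy[OF that] by (simp add: algebra_simps)
      also have "\<dots> = v i \<bullet> w" using pos(1,2) pos(4)[OF that] by (simp add: f_def)
      finally show ?thesis by (simp only: distrib_left[symmetric] mult.left_commute[of t])
    qed
    thus ?thesis
      by (simp add: eigenbasis_parseval[OF B xy(1) w] eigenbasis_parseval[OF B xy(1) By]
          eigenbasis_parseval[OF B xy] sum.distrib sum_distrib_left)
  qed
  finally have 1: "(\<Sum>i<n. (u i \<bullet> w)\<^sup>2 / (l i + t)) = x \<bullet> (B *\<^sub>v y) + t * (x \<bullet> y)" .
  have "(\<Sum>j<n. (v j \<bullet> w)\<^sup>2 / (k j + t)) = w \<bullet> y"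
    unfolding y_def eigenbasis_mat_fun_quadratic[OF B w] by (simp add: f_def)
  also have "\<dots> = y \<bullet> w" using xy w comm_scalar_prod by blast
  \<comment> \<open>Symmetrically w = (A + t) x. The terms t (x \<bullet> y) cancel in the
    difference, which leaves the bilinear form of A - B at x and y.\<close>
  also have "\<dots> = y \<bullet> (A *\<^sub>v x) + t * (y \<bullet> x)"
  proof -
    have Ax: "A *\<^sub>v x \<in> carrier_vec n" using xy cA by auto
    have "(y \<bullet> u i) * (u i \<bullet> w) = (y \<bullet> u i) * (u i \<bullet> (A *\<^sub>v x)) + t * ((y \<bullet> u i) * (u i \<bullet> x))" if "i < n" for i
    proof -
      have "u i \<bullet> (A *\<^sub>v x) + t * (u i \<bullet> x) = (l i + t) * (f (l i) * (u i \<bullet> w))"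
        using eigenbasis_coeff_mult[OF A xy(1) that] ux[OF that] by (simp add: algebra_simps)
      also have "\<dots> = u i \<bullet> w" using pos(1,2) pos(3)[OF that] by (simp add: f_def)
      finally show ?thesis by (simp only: distrib_left[symmetric] mult.left_commute[of t])
    qed
    thus ?thesis
      by (simp add: eigenbasis_parseval[OF A xy(2) w] eigenbasis_parseval[OF A xy(2) Ax]
          eigenbasis_parseval[OF A xy(2,1)] sum.distrib sum_distrib_left)
  qed
  also have "y \<bullet> (A *\<^sub>v x) = x \<bullet> (A *\<^sub>v y)"
    using sym_mat_scalar_prod[OF cA(1) eigenbasis_symmetric[OF A] xy(2,1)] comm_scalar_prod[of x n "A *\<^sub>v y"] xy cA
    by auto
  also have "y \<bullet> x = x \<bullet> y" using xy comm_scalar_prod by blast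
  finally have 2: "(\<Sum>j<n. (v j \<bullet> w)\<^sup>2 / (k j + t)) = x \<bullet> (A *\<^sub>v y) + t * (x \<bullet> y)" .
  have "x \<bullet> ((A - B) *\<^sub>v y) = x \<bullet> (A *\<^sub>v y) - x \<bullet> (B *\<^sub>v y)"
    using xy cA cB by (simp add: minus_mult_distrib_mat_vec[of _ n n] scalar_prod_minus_distrib[of _ n])
  hence "\<bar>(\<Sum>i<n. (u i \<bullet> w)\<^sup>2 / (l i + t)) - (\<Sum>j<n. (v j \<bullet> w)\<^sup>2 / (k j + t))\<bar> = \<bar>x \<bullet> ((A - B) *\<^sub>v y)\<bar>"
    unfolding 1 2 by simp
  also have "\<dots> \<le> spec_norm (A - B) * vnorm x * vnorm y"
    using xy cA cB by (intro bilinear_le_spec_norm) auto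
  also have "\<dots> \<le> spec_norm (A - B) * (vnorm w / (\<alpha> + t)) * (vnorm w / (\<alpha> + t))"
  proof (cases "n = 0")
    case True
    thus ?thesis using xy w by (simp add: vnorm_def scalar_prod_def)
  next
    case False
    hence "0 \<le> spec_norm (A - B)" using cA cB by (intro spec_norm_nonneg[of _ n n]) auto
    thus ?thesis using small[OF A pos(3) xy(1) ux] small[OF B pos(4) xy(2) vy] pos
      by (intro mult_mono mult_nonneg_nonneg divide_nonneg_nonneg) auto
  qed
  finally show ?thesis by (simp add: vnorm_square[symmetric] power2_eq_square)
qed

text \<open>For t \<ge> 0, \<open>g t\<close> is the difference of the quadratic forms of log (A +
  t) and log (B + t) at w. It vanishes at infinity, and its derivative is a resolvent gap of size at
  most \<open>C / (\<alpha> + t)\<^sup>2\<close>. Integrating this from 0 to infinity would give C /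
  \<alpha>; in place of the integral, \<open>C / (\<alpha> + t) - s * g t\<close> is shown to be
  nonincreasing with limit 0, for s = 1 and s = -1.\<close>

lemma log_quadratic_form_lipschitz:
  assumes A: "eigenbasis n A u l" and B: "eigenbasis n B v k" and w: "w \<in> carrier_vec n"
    and pos: "0 < \<alpha>" "\<And>i. i < n \<Longrightarrow> \<alpha> \<le> l i" "\<And>i. i < n \<Longrightarrow> \<alpha> \<le> k i"
  shows "\<bar>w \<bullet> (mat_log A *\<^sub>v w) - w \<bullet> (mat_log B *\<^sub>v w)\<bar> \<le> spec_norm (A - B) * (w \<bullet> w) / \<alpha>"
proof -
  define g where "g t = (\<Sum>i<n. (u i \<bullet> w)\<^sup>2 * ln (l i + t)) - (\<Sum>i<n. (v i \<bullet> w)\<^sup>2 * ln (k i + t))" for t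
  define g' where "g' t = (\<Sum>i<n. (u i \<bullet> w)\<^sup>2 / (l i + t)) - (\<Sum>j<n. (v j \<bullet> w)\<^sup>2 / (k j + t))" for t
  define C where "C = spec_norm (A - B) * (w \<bullet> w)"
  have lim: "(g \<longlongrightarrow> 0) at_top" unfolding g_def
    by (rule shifted_log_gap_tendsto)
      (simp add: eigenbasis_sum_coeff_square[OF A w] eigenbasis_sum_coeff_square[OF B w])
  have der: "(g has_real_derivative g' t) (at t)" if "0 \<le> t" for t
  proof -
    have p: "0 < l i + t" "0 < k i + t" if "i < n" for i
      using pos(1) pos(2)[OF that] pos(3)[OF that] \<open>0 \<le> t\<close> by linarith+
    show ?thesis unfolding g_def g'_def
      by (rule DERIV_diff; rule DERIV_sum) (auto intro!: derivative_eq_intros simp: p)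
  qed
  have bound: "\<bar>g' t\<bar> \<le> C / (\<alpha> + t)\<^sup>2" if "0 \<le> t" for t
    unfolding g'_def C_def using resolvent_gap[OF A B w pos(1) that pos(2,3)] by simp
  have limC: "((\<lambda>t. C / (\<alpha> + t)) \<longlongrightarrow> 0) at_top"
    by (intro tendsto_divide_0[OF tendsto_const] filterlim_at_top_imp_at_infinity
        filterlim_tendsto_add_at_top[OF tendsto_const] filterlim_ident)
  have derC: "((\<lambda>t. C / (\<alpha> + t)) has_real_derivative - (C / (\<alpha> + t)\<^sup>2)) (at t)" if "0 \<le> t" for t
    using pos that by (auto intro!: derivative_eq_intros simp: power2_eq_square)
  have le: "s * g 0 \<le> C / \<alpha>" if s: "\<bar>s\<bar> = 1" for s
  proof -
    let ?h = "\<lambda>t. C / (\<alpha> + t) - s * g t"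
    have mono: "?h t \<le> ?h 0" if "0 \<le> t" for t
    proof (rule DERIV_nonpos_imp_nonincreasing[OF that])
      fix x assume x: "0 \<le> x" "x \<le> t"
      have "(?h has_real_derivative - (C / (\<alpha> + x)\<^sup>2) - s * g' x) (at x)"
        by (intro DERIV_diff derC DERIV_cmult der x)
      moreover have "\<bar>s * g' x\<bar> \<le> C / (\<alpha> + x)\<^sup>2" using bound[OF x(1)] s by (simp add: abs_mult)
      hence "- (C / (\<alpha> + x)\<^sup>2) - s * g' x \<le> 0" by linarith
      ultimately show "\<exists>y. (?h has_real_derivative y) (at x) \<and> y \<le> 0" by blast
    qed
    have "\<forall>\<^sub>F t in at_top. ?h t \<le> ?h 0"
      by (rule eventually_mono[OF eventually_ge_at_top[of 0]]) (rule mono)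
    hence "0 - s * 0 \<le> ?h 0"
      by (intro tendsto_upperbound[of ?h _ at_top] tendsto_intros limC lim) auto
    thus ?thesis by simp
  qed
  have "g 0 = w \<bullet> (mat_log A *\<^sub>v w) - w \<bullet> (mat_log B *\<^sub>v w)"
    unfolding mat_log_def eigenbasis_mat_fun_quadratic[OF A w] eigenbasis_mat_fun_quadratic[OF B w]
    by (simp add: g_def mult.commute)
  thus ?thesis using le[of 1] le[of "-1"] by (simp add: C_def)
qed

lemma ln_det_eq_trace_mat_log:
  assumes A: "eigenbasis n A u l" and pos: "\<And>i. i < n \<Longrightarrow> 0 < l i"
  shows "ln (det A) = (\<Sum>a<n. mat_log A $$ (a,a))"
  unfolding mat_log_def eigenbasis_trace_mat_fun[OF A] eigenbasis_det[OF A]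
  using pos by (subst ln_prod) force+

text \<open>The trace of the logarithm is the sum of its quadratic forms at the n unit vectors, each
  of squared length 1.\<close>

lemma ln_det_lipschitz:
  assumes A: "eigenbasis n A u l" and B: "eigenbasis n B v k"
    and pos: "0 < \<alpha>" "\<And>i. i < n \<Longrightarrow> \<alpha> \<le> l i" "\<And>i. i < n \<Longrightarrow> \<alpha> \<le> k i"
  shows "\<bar>ln (det A) - ln (det B)\<bar> \<le> real n * (spec_norm (A - B) / \<alpha>)"
proof -
  have tr: "ln (det M) = (\<Sum>a<n. unit_vec n a \<bullet> (mat_log M *\<^sub>v unit_vec n a))"
    if M: "eigenbasis n M e h" and h: "\<And>i. i < n \<Longrightarrow> \<alpha> \<le> h i" for M e h
  proof -
    have "mat_log M \<in> carrier_mat n n" by (simp add: mat_log_def eigenbasis_mat_fun[OF M])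
    hence "(\<Sum>a<n. unit_vec n a \<bullet> (mat_log M *\<^sub>v unit_vec n a)) = (\<Sum>a<n. mat_log M $$ (a,a))"
      by (intro sum.cong refl) auto
    also have "\<dots> = ln (det M)"
      using ln_det_eq_trace_mat_log[OF M] less_le_trans[OF pos(1) h] by simp
    finally show ?thesis ..
  qed
  have "ln (det A) - ln (det B) = (\<Sum>a<n. unit_vec n a \<bullet> (mat_log A *\<^sub>v unit_vec n a)
      - unit_vec n a \<bullet> (mat_log B *\<^sub>v unit_vec n a))"
    using tr[OF A pos(2)] tr[OF B pos(3)] by (simp add: sum_subtractf)
  also have "\<bar>\<dots>\<bar> \<le> (\<Sum>a<n. spec_norm (A - B) / \<alpha>)"
  proof (intro order_trans[OF sum_abs] sum_mono)
    fix a assume "a \<in> {..<n}"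
    thus "\<bar>unit_vec n a \<bullet> (mat_log A *\<^sub>v unit_vec n a) - unit_vec n a \<bullet> (mat_log B *\<^sub>v unit_vec n a)\<bar>
      \<le> spec_norm (A - B) / \<alpha>"
      using log_quadratic_form_lipschitz[OF A B unit_vec_carrier pos, of a] by simp
  qed
  finally show ?thesis by simp
qed

section \<open>Polynomial approximation of the logarithm\<close>

text \<open>The Chebyshev polynomials: adding the two addition formulas gives cos ((j + 2) \<phi>) =
  2 cos \<phi> cos ((j + 1) \<phi>) - cos (j \<phi>).\<close>

lemma chebyshev_poly:
  "\<exists>p :: real poly. degree p \<le> k \<and> (\<forall>\<phi>. poly p (cos \<phi>) = cos (real k * \<phi>))"
proof (induction k rule: less_induct)
  case (less k)
  consider "k = 0" | "k = 1" | j where "k = Suc (Suc j)" by (metis One_nat_def not0_implies_Suc)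
  thus ?case
  proof cases
    case 1
    thus ?thesis by (intro exI[of _ 1]) auto
  next
    case 2
    thus ?thesis by (intro exI[of _ "[:0, 1:]"]) auto
  next
    case 3
    obtain p where p: "degree p \<le> j" "\<And>\<phi>. poly p (cos \<phi>) = cos (real j * \<phi>)" using less[of j] 3 by auto
    obtain p' where p': "degree p' \<le> Suc j" "\<And>\<phi>. poly p' (cos \<phi>) = cos (real (Suc j) * \<phi>)" using less[of "Suc j"] 3 by auto
    have "degree ([:0, 2:] * p' - p) \<le> k"
    proof (rule degree_diff_le)
      have "degree ([:0, 2:] * p') \<le> degree [:0, 2 :: real:] + degree p'" by (rule degree_mult_le)
      thus "degree ([:0, 2:] * p') \<le> k" using p' 3 by simp
    qed (use p 3 in simp)
    moreover have "poly ([:0, 2:] * p' - p) (cos \<phi>) = cos (real k * \<phi>)" for \<phi>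
      using cos_add[of "real (Suc j) * \<phi>" \<phi>] cos_diff[of "real (Suc j) * \<phi>" \<phi>]
      by (simp add: p p' 3 algebra_simps)
    ultimately show ?thesis by blast
  qed
qed

text \<open>Real part of the power series of log (1 + q exp (i \<phi>)), since the squared modulus
  of 1 + q exp (i \<phi>) is 1 + 2 q cos \<phi> + q^2. The term k = 0 is a division by zero, hence
  0.\<close>

lemma ln_fourier_sums:
  fixes q \<phi> :: real
  assumes "\<bar>q\<bar> < 1"
  shows "(\<lambda>k. - ((-q) ^ k) * cos (real k * \<phi>) / real k) sums (ln (1 + 2 * q * cos \<phi> + q\<^sup>2) / 2)"
proof -
  let ?z = "of_real q * cis \<phi>"
  have z: "cmod ?z < 1" using assms by (simp add: norm_mult)
  have nz: "1 + ?z \<noteq> 0"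
  proof
    assume "1 + ?z = 0"
    hence "?z = -1" by (simp add: add_eq_0_iff)
    thus False using z by simp
  qed
  have "(\<lambda>k. Re (- ((- ?z) ^ k) / of_nat k)) sums Re (ln (1 + ?z))"
    by (rule sums_Re[OF Ln_series'[OF z]])
  moreover have "Re (- ((- ?z) ^ k) / of_nat k) = - ((-q) ^ k) * cos (real k * \<phi>) / real k" for k
  proof -
    have "(- ?z) ^ k = of_real ((-q) ^ k) * cis (real k * \<phi>)"
      by (simp only: mult_minus_left[symmetric] of_real_minus[symmetric] power_mult_distrib of_real_power)
        (simp add: Complex.DeMoivre)
    thus ?thesis by simp
  qed
  moreover have "Re (ln (1 + ?z)) = ln (1 + 2 * q * cos \<phi> + q\<^sup>2) / 2"
  proof -
    have "(cmod (1 + ?z))\<^sup>2 = 1 + 2 * q * cos \<phi> + (q\<^sup>2 * (sin \<phi>)\<^sup>2 + q\<^sup>2 * (cos \<phi>)\<^sup>2)"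
      by (simp add: cmod_power2 power2_sum power_mult_distrib)
    also have "q\<^sup>2 * (sin \<phi>)\<^sup>2 + q\<^sup>2 * (cos \<phi>)\<^sup>2 = q\<^sup>2"
      by (metis distrib_left sin_cos_squared_add mult_1_right)
    finally have "(cmod (1 + ?z))\<^sup>2 = 1 + 2 * q * cos \<phi> + q\<^sup>2" .
    moreover have "ln ((cmod (1 + ?z))\<^sup>2) = 2 * ln (cmod (1 + ?z))" using nz by (simp add: ln_realpow)
    ultimately show ?thesis using nz by simp
  qed
  ultimately show ?thesis by (simp only:)
qed

text \<open>In the tail 1 / k \<le> 1 / n and the cosines are bounded by 1, which leaves a geometric
  series. Keeping the factor 1 / n matters for the final constants.\<close>

lemma ln_fourier_truncation:
  fixes q \<phi> :: real
  assumes q: "0 \<le> q" "q < 1" and n: "0 < n"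
  shows "\<bar>ln (1 + 2 * q * cos \<phi> + q\<^sup>2) - 2 * (\<Sum>k<n. - ((-q) ^ k) * cos (real k * \<phi>) / real k)\<bar>
    \<le> 2 / (1 - q) / real n * q ^ n"
proof -
  define t where "t k = - ((-q) ^ k) * cos (real k * \<phi>) / real k" for k
  have t: "t sums (ln (1 + 2 * q * cos \<phi> + q\<^sup>2) / 2)" unfolding t_def using ln_fourier_sums[of q \<phi>] q by simp
  have tail: "(\<lambda>k. t (k + n)) sums (ln (1 + 2 * q * cos \<phi> + q\<^sup>2) / 2 - sum t {..<n})"
    using sums_split_initial_segment[OF t] by simp
  have bd: "\<bar>t (k + n)\<bar> \<le> q ^ n / real n * q ^ k" for k
  proof -
    have "\<bar>t (k + n)\<bar> = q ^ (k + n) * \<bar>cos (real (k + n) * \<phi>)\<bar> / real (k + n)"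
      using q by (simp add: t_def abs_mult power_abs)
    also have "\<dots> \<le> q ^ (k + n) * 1 / real n"
      using q n by (intro frac_le mult_left_mono abs_cos_le_one mult_nonneg_nonneg) auto
    finally show ?thesis by (simp add: power_add mult.commute)
  qed
  have geo: "(\<lambda>k. q ^ n / real n * q ^ k) sums (q ^ n / real n * (1 / (1 - q)))"
    using q by (intro sums_mult geometric_sums) auto
  have "\<bar>ln (1 + 2 * q * cos \<phi> + q\<^sup>2) / 2 - sum t {..<n}\<bar> \<le> q ^ n / real n * (1 / (1 - q))"
    using norm_suminf_le[of "\<lambda>k. t (k + n)" "\<lambda>k. q ^ n / real n * q ^ k"] bd geo tail
    by (simp add: sums_iff)
  thus ?thesis unfolding t_def[symmetric] by (simp add: field_simps abs_le_iff)
qed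

text \<open>The substitution x = c (1 + 2 q cos \<phi> + q^2) carries the range [-1, 1] of cos
  \<phi> onto [\<alpha>, \<beta>] when c (1 - q)^2 = \<alpha> and c (1 + q)^2 = \<beta>, which
  determines q. Then ln x - ln c has the Fourier series above, and its partial sums are polynomials
  in x.\<close>

lemma ln_poly_approx:
  fixes \<alpha> \<beta> :: real
  assumes ab: "0 < \<alpha>" "\<alpha> \<le> \<beta>" and n: "0 < n"
  defines "q \<equiv> (sqrt (\<beta> / \<alpha>) - 1) / (sqrt (\<beta> / \<alpha>) + 1)"
  shows "\<exists>p. degree p < n \<and> (\<forall>x\<in>{\<alpha>..\<beta>}. \<bar>ln x - poly p x\<bar> \<le> (sqrt (\<beta> / \<alpha>) + 1) / real n * q ^ n)"
proof -
  define s where "s = sqrt (\<beta> / \<alpha>)"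
  have s: "1 \<le> s" "s\<^sup>2 = \<beta> / \<alpha>" using ab by (auto simp: s_def)
  have q: "0 \<le> q" "q < 1" using s by (auto simp: q_def s_def[symmetric])
  have q1: "1 - q = 2 / (s + 1)" "1 + q = 2 * s / (s + 1)" using s by (auto simp: q_def s_def[symmetric] field_simps)
  define c where "c = \<alpha> / (1 - q)\<^sup>2"
  have c: "0 < c" "\<alpha> = c * (1 - q)\<^sup>2" using ab q by (auto simp: c_def)
  have c2: "\<beta> = c * (1 + q)\<^sup>2"
  proof -
    have "c * (1 + q)\<^sup>2 = \<alpha> * ((1 + q) / (1 - q))\<^sup>2" by (simp add: c_def power_divide)
    also have "(1 + q) / (1 - q) = s" using s by (simp add: q1)
    finally show ?thesis using s ab by simp
  qed
  show ?thesis
  proof (cases "q = 0")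
    \<comment> \<open>For q = 0 the interval is a single point, and the affine map \<open>r\<close>
      of the other case would divide by q.\<close>
    case True
    hence "\<alpha> = \<beta>" using c c2 by simp
    thus ?thesis using n s q by (intro exI[of _ "[:ln \<alpha>:]"]) (auto simp flip: s_def)
  next
    case False
    hence q0: "0 < q" using q by simp
    obtain T :: "nat \<Rightarrow> real poly" where T: "\<And>k. degree (T k) \<le> k" "\<And>k \<phi>. poly (T k) (cos \<phi>) = cos (real k * \<phi>)"
      using chebyshev_poly by metis
    define r where "r = [: - (1 + q\<^sup>2) / (2 * q), 1 / (2 * q * c) :]"
    define p where "p = [:ln c:] + Polynomial.smult 2 (\<Sum>k<n. Polynomial.smult (- ((-q) ^ k) / real k) (pcompose (T k) r))"
    have "degree (pcompose (T k) r) \<le> k" for k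
      using degree_pcompose_le[of "T k" r] T(1)[of k] by (simp add: r_def split: if_splits)
    hence "degree p \<le> n - 1" unfolding p_def
      by (intro degree_add_le order_trans[OF degree_smult_le] degree_sum_le) 
        (auto intro: order_trans[OF \<open>\<And>k. degree (pcompose (T k) r) \<le> k\<close>])
    moreover have "\<bar>ln x - poly p x\<bar> \<le> (s + 1) / real n * q ^ n" if x: "x \<in> {\<alpha>..\<beta>}" for x
    proof -
      define y where "y = poly r x"
      have y: "2 * q * y = x / c - (1 + q\<^sup>2)" using q0 c by (simp add: y_def r_def field_simps)
      have xc: "(1 - q)\<^sup>2 \<le> x / c" "x / c \<le> (1 + q)\<^sup>2"
        using x c c2 by (auto simp: field_simps)
      have "2 * q * y \<le> 2 * q * 1" "2 * q * (-1) \<le> 2 * q * y"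
        using xc unfolding y by (auto simp: power2_eq_square algebra_simps)
      hence yb: "y \<le> 1" "-1 \<le> y"
        using mult_le_cancel_left_pos[of "2 * q" y 1] mult_le_cancel_left_pos[of "2 * q" "-1" y] q0 by linarith+
      define \<phi> where "\<phi> = arccos y"
      have cy: "cos \<phi> = y" using yb by (simp add: \<phi>_def)
      have "x / c = 1 + 2 * q * cos \<phi> + q\<^sup>2" using y cy by simp
      moreover have "ln x = ln c + ln (x / c)" using x ab c by (simp add: ln_div)
      moreover have "poly p x = ln c + 2 * (\<Sum>k<n. - ((-q) ^ k) * cos (real k * \<phi>) / real k)"
        by (simp add: p_def poly_sum poly_pcompose y_def[symmetric] cy[symmetric] T(2))
      moreover have "2 / (1 - q) = s + 1" using s by (simp add: q1)
      ultimately show ?thesis using ln_fourier_truncation[OF q n, of \<phi>] by simp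
    qed
    ultimately show ?thesis using n unfolding s_def by (intro exI[of _ p]) auto
  qed
qed

text \<open>With x = 1 / s this is artanh x \<ge> x; \<open>f\<close> is twice the
  difference.\<close>

lemma diff_quotient_le_exp:
  fixes s :: real
  assumes "1 < s"
  shows "(s - 1) / (s + 1) \<le> exp (- 2 / s)"
proof -
  define x where "x = 1 / s"
  have x: "0 < x" "x < 1" using assms by (auto simp: x_def)
  define f where "f = (\<lambda>x :: real. ln (1 + x) - ln (1 - x) - 2 * x)"
  have "f 0 \<le> f x"
  proof (rule DERIV_nonneg_imp_nondecreasing[of 0 x f])
    fix y assume y: "0 \<le> y" "y \<le> x"
    have "(f has_real_derivative (1 / (1 + y) + 1 / (1 - y) - 2)) (at y)"
      unfolding f_def using y x by (auto intro!: derivative_eq_intros)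
    moreover have "1 / (1 + y) + 1 / (1 - y) - 2 = 2 * y\<^sup>2 / ((1 + y) * (1 - y))"
      using y x by (simp add: divide_simps) (simp add: algebra_simps power2_eq_square)
    moreover have "\<dots> \<ge> 0" using y x by simp
    ultimately show "\<exists>z. (f has_real_derivative z) (at y) \<and> 0 \<le> z" by metis
  qed (use x in auto)
  hence "ln ((1 - x) / (1 + x)) \<le> - 2 * x" using x by (simp add: ln_div f_def)
  hence "(1 - x) / (1 + x) \<le> exp (- 2 * x)" using x exp_le_cancel_iff[of "ln ((1 - x) / (1 + x))"] by simp
  moreover have "1 - x = (s - 1) / s" "1 + x = (s + 1) / s" using assms by (auto simp: x_def field_simps)
  hence "(1 - x) / (1 + x) = (s - 1) / (s + 1)" using assms by simp
  ultimately show ?thesis by (simp add: x_def)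
qed

section \<open>Lanczos quadrature\<close>

lemma funpow_mult_mat_vec_ip:
  fixes M :: "real mat"
  assumes M: "M \<in> carrier_mat d d" "transpose_mat M = M" and "x \<in> carrier_vec d" "y \<in> carrier_vec d"
  shows "x \<bullet> ((*\<^sub>v) M ^^ (i + j)) y = ((*\<^sub>v) M ^^ i) x \<bullet> ((*\<^sub>v) M ^^ j) y"
  using assms(3)
proof (induction i arbitrary: x)
  case (Suc i)
  have "((*\<^sub>v) M ^^ k) y \<in> carrier_vec d" for k using assms by (induction k) auto
  hence "x \<bullet> ((*\<^sub>v) M ^^ (Suc i + j)) y = (M *\<^sub>v x) \<bullet> ((*\<^sub>v) M ^^ (i + j)) y"
    using sym_mat_scalar_prod[OF M Suc.prems] by simp
  also have "\<dots> = ((*\<^sub>v) M ^^ i) (M *\<^sub>v x) \<bullet> ((*\<^sub>v) M ^^ j) y" using Suc M by simp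
  finally show ?case by (simp add: funpow_swap1)
qed simp

text \<open>The Lanczos vectors \<open>q\<^sub>1, q\<^sub>2, \<dots>\<close> are \<open>r 1, r 2, \<dots>\<close>, preceded by \<open>r 0 = 0\<close>; \<open>c j\<close> is the
  off-diagonal coefficient linking \<open>r j\<close> and \<open>r (j + 1)\<close>, and \<open>a j\<close> the diagonal one of \<open>r (j + 1)\<close>.
  After a breakdown all later vectors and coefficients vanish.\<close>
locale lanczos_seq =
  fixes n :: nat and A :: "real mat" and r :: "nat \<Rightarrow> real vec" and a c :: "nat \<Rightarrow> real"
  assumes A_carrier: "A \<in> carrier_mat n n" and A_sym: "transpose_mat A = A"
    and r_carrier: "r j \<in> carrier_vec n"
    and r_0: "r 0 = 0\<^sub>v n" and r_1: "r (Suc 0) \<bullet> r (Suc 0) = 1" and c_0: "c 0 = 0"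
    and rec: "A *\<^sub>v r (Suc j) = c j \<cdot>\<^sub>v r j + a j \<cdot>\<^sub>v r (Suc j) + c (Suc j) \<cdot>\<^sub>v r (Suc (Suc j))"
    and a_def: "a j = r (Suc j) \<bullet> (A *\<^sub>v r (Suc j) - c j \<cdot>\<^sub>v r j)"
    and breakdown: "c (Suc j) = 0 \<Longrightarrow> r (Suc (Suc j)) = 0\<^sub>v n"
    and unit: "c (Suc j) \<noteq> 0 \<Longrightarrow> r (Suc (Suc j)) \<bullet> r (Suc (Suc j)) = 1"
begin

section \<open>Orthogonality of the Lanczos vectors and breakdown\<close>

lemma Ar_carrier: "A *\<^sub>v r j \<in> carrier_vec n"
  using A_carrier r_carrier by auto

lemma comm: "r i \<bullet> r j = r j \<bullet> r i"
  using r_carrier comm_scalar_prod by blast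

lemma zero_ip: "0\<^sub>v n \<bullet> r j = 0" "r j \<bullet> 0\<^sub>v n = 0"
  using r_carrier by (auto)

lemma zero_or_unit: "r (Suc j) = 0\<^sub>v n \<or> r (Suc j) \<bullet> r (Suc j) = 1"
  using r_1 breakdown unit by (cases j) auto

lemma ip_rec: "r i \<bullet> (A *\<^sub>v r (Suc j)) =
    c j * (r i \<bullet> r j) + a j * (r i \<bullet> r (Suc j)) + c (Suc j) * (r i \<bullet> r (Suc (Suc j)))"
  unfolding rec using r_carrier by (simp add: scalar_prod_add_distrib[of _ n] scalar_prod_smult_distrib[of _ n])

lemma ip_sym: "r i \<bullet> (A *\<^sub>v r j) = r j \<bullet> (A *\<^sub>v r i)"
  using sym_mat_scalar_prod[OF A_carrier A_sym r_carrier r_carrier, of i j]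
    comm_scalar_prod[OF Ar_carrier r_carrier] by simp

text \<open>A zero vector decouples from both neighbours: from the previous one because a nonzero
  coefficient is always followed by a unit vector, from the next one because by symmetry its pairing
  with A applied to the zero vector is 0.\<close>

lemma c_eq_0:
  assumes "r (Suc j) = 0\<^sub>v n"
  shows "c j = 0" "c (Suc j) = 0"
proof -
  show cj: "c j = 0"
  proof (cases j)
    case 0
    thus ?thesis using c_0 by simp
  next
    case (Suc i)
    thus ?thesis using unit[of i] assms zero_ip(1)[of 0] r_0 by force
  qed
  have "r (Suc (Suc j)) \<bullet> (A *\<^sub>v r (Suc j)) = 0"
    unfolding ip_sym[of "Suc (Suc j)"] using Ar_carrier assms by simp
  hence "c (Suc j) * (r (Suc (Suc j)) \<bullet> r (Suc (Suc j))) = 0"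
    using ip_rec[of "Suc (Suc j)" j] cj assms zero_ip by simp
  thus "c (Suc j) = 0" using unit[of j] by (cases "c (Suc j) = 0") auto
qed

lemma a_eq_0: "r (Suc j) = 0\<^sub>v n \<Longrightarrow> a j = 0"
  using a_def[of j] r_carrier[of j] Ar_carrier[of "Suc j"] by simp

lemma a_eq: "a j = r (Suc j) \<bullet> (A *\<^sub>v r (Suc j)) - c j * (r (Suc j) \<bullet> r j)"
  using a_def[of j] r_carrier Ar_carrier
  by (simp add: scalar_prod_minus_distrib[of _ n] scalar_prod_smult_distrib[of _ n])

text \<open>The coefficient \<open>a\<close> makes r (k + 1) orthogonal to r k. For an older r i,
  symmetry moves A onto r i, where the three-term recurrence meets only vectors already known to be
  orthogonal to r k, except r k itself when i = k - 1; that term is cancelled by the subtraction of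
  c (k - 1) r (k - 1). If c k = 0 for k > 0, the new vector is 0.\<close>

lemma orthogonal_aux: "i < j \<Longrightarrow> j \<le> k \<Longrightarrow> r i \<bullet> r j = 0"
proof (induction k arbitrary: i j)
  case (Suc k)
  note IH = Suc.IH
  show ?case
  proof (cases "j \<le> k")
    case True
    thus ?thesis using Suc by auto
  next
    case False
    hence j: "j = Suc k" "i \<le> k" using Suc.prems by auto
    show ?thesis
    proof (cases "i = 0 \<or> c k = 0")
      case True
      have "r (Suc k) = 0\<^sub>v n" if "c k = 0" "i \<noteq> 0" using breakdown[of "k - 1"] that j by (cases k) auto
      thus ?thesis using True zero_ip r_0 j by (cases "i = 0") auto
    next
      case False
      then obtain h i' where h: "k = Suc h" and i': "i = Suc i'" using j by (cases k; cases i) auto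
      have ck: "c (Suc h) \<noteq> 0" using False h by simp
      have nk: "r (Suc h) \<bullet> r (Suc h) = 1" using zero_or_unit[of h] c_eq_0[of h] ck by auto
      have main: "c (Suc h) * (r i \<bullet> r (Suc (Suc h))) = r i \<bullet> (A *\<^sub>v r (Suc h)) - c h * (r i \<bullet> r h) - a h * (r i \<bullet> r (Suc h))"
        using ip_rec[of i h] by simp
      have "r i \<bullet> (A *\<^sub>v r (Suc h)) - c h * (r i \<bullet> r h) - a h * (r i \<bullet> r (Suc h)) = 0"
      proof (cases "i' = h")
        case True
        thus ?thesis using a_eq[of h] i' nk by simp
      next
        case ne: False
        hence lt: "Suc i' \<le> h" using i' j h by simp
        have "r i \<bullet> (A *\<^sub>v r (Suc h)) = c (Suc i') * (r (Suc (Suc i')) \<bullet> r (Suc h))"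
          unfolding ip_sym[of i] unfolding i' ip_rec using IH[of i' "Suc h"] IH[of "Suc i'" "Suc h"] lt h
          by (simp add: comm[of "Suc h"])
        moreover have "r i \<bullet> r (Suc h) = 0" using IH[of i "Suc h"] lt h i' by simp
        moreover have "c (Suc i') * (r (Suc (Suc i')) \<bullet> r (Suc h)) = c h * (r i \<bullet> r h)"
        proof (cases "Suc i' = h")
          case True
          show ?thesis
          proof (cases "c h = 0")
            case False
            hence "r h \<bullet> r h = 1" using zero_or_unit[of i'] c_eq_0[of i'] True by auto
            thus ?thesis using True nk i' by simp
          qed (use True in simp)
        next
          case False
          thus ?thesis using IH[of "Suc (Suc i')" "Suc h"] IH[of i h] lt h i' by simp
        qed
        ultimately show ?thesis by simp
      qed
      thus ?thesis using main ck j h by simp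
    qed
  qed
qed simp

lemma orthogonal: "i \<noteq> j \<Longrightarrow> r i \<bullet> r j = 0"
  using orthogonal_aux[of i j j] orthogonal_aux[of j i i] comm[of i j] by (cases i j rule: linorder_cases) auto

section \<open>The tridiagonal matrix as a compression of A\<close>

definition Tm :: "nat \<Rightarrow> real mat" where
  "Tm K = mat K K (\<lambda>(i,j). if i = j then a i else if j = i + 1 then c (Suc i) else if i = j + 1 then c (Suc j) else 0)"

lemma Tm_carrier: "Tm K \<in> carrier_mat K K" by (simp add: Tm_def)

text \<open>Orthogonality leaves one term of the recurrence in each position of the band; at a zero
  Lanczos vector both sides vanish.\<close>

lemma Tm_entry:
  assumes "i < K" "j < K"
  shows "Tm K $$ (i,j) = r (Suc i) \<bullet> (A *\<^sub>v r (Suc j))"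
proof -
  have ip: "r (Suc i) \<bullet> (A *\<^sub>v r (Suc j)) =
      c j * (r (Suc i) \<bullet> r j) + a j * (r (Suc i) \<bullet> r (Suc j)) + c (Suc j) * (r (Suc i) \<bullet> r (Suc (Suc j)))"
    by (rule ip_rec)
  consider "i = j" | "j = Suc i" | "i = Suc j" | "i \<noteq> j" "j \<noteq> Suc i" "i \<noteq> Suc j" by blast
  thus ?thesis
  proof cases
    case 1
    have "a j * (r (Suc j) \<bullet> r (Suc j)) = a j" using zero_or_unit[of j] a_eq_0[of j] by auto
    thus ?thesis using assms ip 1 orthogonal[of "Suc j" j] orthogonal[of "Suc j" "Suc (Suc j)"] by (simp add: Tm_def)
  next
    case 2
    have "c (Suc i) * (r (Suc i) \<bullet> r (Suc i)) = c (Suc i)" using zero_or_unit[of i] c_eq_0[of i] by auto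
    thus ?thesis using assms ip 2 orthogonal[of "Suc i" "Suc (Suc i)"] orthogonal[of "Suc i" "Suc (Suc (Suc i))"]
      by (simp add: Tm_def)
  next
    case 3
    have "c (Suc j) * (r (Suc (Suc j)) \<bullet> r (Suc (Suc j))) = c (Suc j)" using unit[of j] by auto
    thus ?thesis using assms ip 3 orthogonal[of "Suc (Suc j)" "Suc j"] orthogonal[of "Suc (Suc j)" j]
      by (simp add: Tm_def)
  next
    case 4
    thus ?thesis using assms ip orthogonal[of "Suc i"] by (simp add: Tm_def)
  qed
qed

lemma Tm_sym: "transpose_mat (Tm K) = Tm K"
  by (rule eq_matI) (auto simp: Tm_def)

lemma Tm_column:
  assumes "j < K"
  shows "(\<Sum>i<K. Tm K $$ (i,j) * r (Suc i) $ x) =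
    c j * r j $ x + a j * r (Suc j) $ x + (if Suc j < K then c (Suc j) * r (Suc (Suc j)) $ x else 0)"
proof -
  have "(\<Sum>i<K. Tm K $$ (i,j) * r (Suc i) $ x) = (\<Sum>i<K. (if i = j then a j * r (Suc j) $ x else 0)
     + (if Suc i = j then c j * r j $ x else 0) + (if i = Suc j then c (Suc j) * r (Suc (Suc j)) $ x else 0))"
    using assms by (intro sum.cong refl) (auto simp: Tm_def)
  also have "(\<Sum>i<K. if Suc i = j then c j * r j $ x else 0) = c j * r j $ x"
    using assms by (cases j) (auto simp: c_0)
  ultimately show ?thesis using assms by (simp add: sum.distrib)
qed

text \<open>The Lanczos basis matrix, with columns \<open>r 1\<close> to \<open>r K\<close>, applied
  to z. After a breakdown some columns are 0, so it need not be an isometry.\<close>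

definition Q :: "nat \<Rightarrow> real vec \<Rightarrow> real vec" where
  "Q K z = vec n (\<lambda>x. \<Sum>j<K. z $ j * r (Suc j) $ x)"

lemma Q_carrier: "Q K z \<in> carrier_vec n" by (simp add: Q_def)

lemma ip_Q:
  assumes "w \<in> carrier_vec n"
  shows "w \<bullet> Q K z = (\<Sum>j<K. z $ j * (w \<bullet> r (Suc j)))"
proof -
  have "w \<bullet> Q K z = (\<Sum>x<n. \<Sum>j<K. z $ j * (w $ x * r (Suc j) $ x))"
    by (simp add: Q_def scalar_prod_def atLeast0LessThan sum_distrib_left mult_ac)
  also have "\<dots> = (\<Sum>j<K. \<Sum>x<n. z $ j * (w $ x * r (Suc j) $ x))" by (rule sum.swap)
  finally show ?thesis using assms r_carrier by (simp add: scalar_prod_sum[of _ n] sum_distrib_left)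
qed

lemma Q_ip_Q: "Q K y \<bullet> Q K z = (\<Sum>j<K. y $ j * z $ j * (r (Suc j) \<bullet> r (Suc j)))"
proof -
  have "Q K y \<bullet> r (Suc j) = y $ j * (r (Suc j) \<bullet> r (Suc j))" if "j < K" for j
  proof -
    have "Q K y \<bullet> r (Suc j) = (\<Sum>i<K. y $ i * (r (Suc j) \<bullet> r (Suc i)))"
      using ip_Q[OF r_carrier] comm_scalar_prod[OF Q_carrier r_carrier] by simp
    also have "\<dots> = (\<Sum>i<K. if i = j then y $ j * (r (Suc j) \<bullet> r (Suc j)) else 0)"
      using orthogonal by (intro sum.cong refl) auto
    finally show ?thesis using that by simp
  qed
  thus ?thesis unfolding ip_Q[OF Q_carrier] by (intro sum.cong refl) auto
qed

lemma A_Q: "A *\<^sub>v Q K z = vec n (\<lambda>x. \<Sum>j<K. z $ j * (A *\<^sub>v r (Suc j)) $ x)"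
proof (rule eq_vecI)
  fix x assume "x < dim_vec (vec n (\<lambda>x. \<Sum>j<K. z $ j * (A *\<^sub>v r (Suc j)) $ x))"
  hence x: "x < n" by simp
  have "row A x \<in> carrier_vec n" using A_carrier x by auto
  thus "(A *\<^sub>v Q K z) $ x = vec n (\<lambda>x. \<Sum>j<K. z $ j * (A *\<^sub>v r (Suc j)) $ x) $ x"
    using ip_Q[of "row A x" K z] x A_carrier by simp
qed (use A_carrier in simp)

lemma ip_A_Q:
  assumes "y \<in> carrier_vec K" "z \<in> carrier_vec K"
  shows "Q K y \<bullet> (A *\<^sub>v Q K z) = y \<bullet> (Tm K *\<^sub>v z)"
proof -
  have 1: "w \<bullet> (A *\<^sub>v Q K z) = (\<Sum>j<K. z $ j * (w \<bullet> (A *\<^sub>v r (Suc j))))" if w: "w \<in> carrier_vec n" for w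
  proof -
    have "w \<bullet> (A *\<^sub>v Q K z) = (\<Sum>x<n. \<Sum>j<K. z $ j * (w $ x * (A *\<^sub>v r (Suc j)) $ x))"
      unfolding A_Q by (simp add: scalar_prod_def atLeast0LessThan sum_distrib_left mult_ac del: index_mult_mat_vec)
    also have "\<dots> = (\<Sum>j<K. \<Sum>x<n. z $ j * (w $ x * (A *\<^sub>v r (Suc j)) $ x))" by (rule sum.swap)
    also have "\<dots> = (\<Sum>j<K. z $ j * (w \<bullet> (A *\<^sub>v r (Suc j))))"
      unfolding scalar_prod_sum[OF w Ar_carrier] sum_distrib_left ..
    finally show ?thesis .
  qed
  have "Q K y \<bullet> (A *\<^sub>v Q K z) = (\<Sum>j<K. z $ j * (\<Sum>i<K. y $ i * (r (Suc i) \<bullet> (A *\<^sub>v r (Suc j)))))"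
    unfolding 1[OF Q_carrier] comm_scalar_prod[OF Q_carrier Ar_carrier] ip_Q[OF Ar_carrier]
    by (simp add: comm_scalar_prod[OF Ar_carrier r_carrier])
  also have "\<dots> = (\<Sum>j<K. \<Sum>i<K. y $ i * Tm K $$ (i,j) * z $ j)"
    by (simp add: Tm_entry sum_distrib_left mult_ac)
  also have "\<dots> = (\<Sum>i<K. \<Sum>j<K. y $ i * Tm K $$ (i,j) * z $ j)" by (rule sum.swap)
  also have "\<dots> = y \<bullet> (Tm K *\<^sub>v z)" by (rule bilinear_sum[symmetric, OF Tm_carrier assms])
  finally show ?thesis .
qed

text \<open>A Q and Q T differ only in the last column, by a multiple of \<open>r (Suc K)\<close>; a
  vanishing last coordinate of z removes this remainder.\<close>

lemma A_Q_eq: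
  assumes z: "z \<in> carrier_vec K" and K: "0 < K" and z0: "z $ (K - 1) = 0"
  shows "A *\<^sub>v Q K z = Q K (Tm K *\<^sub>v z)"
proof (rule eq_vecI)
  fix x assume "x < dim_vec (Q K (Tm K *\<^sub>v z))"
  hence x: "x < n" by (simp add: Q_def)
  have "(Q K (Tm K *\<^sub>v z)) $ x = (\<Sum>i<K. (\<Sum>j<K. Tm K $$ (i,j) * z $ j) * r (Suc i) $ x)"
    using x z Tm_carrier[of K] by (simp add: Q_def scalar_prod_def atLeast0LessThan)
  also have "\<dots> = (\<Sum>i<K. \<Sum>j<K. z $ j * (Tm K $$ (i,j) * r (Suc i) $ x))"
    by (simp add: sum_distrib_right sum_distrib_left mult_ac)
  also have "\<dots> = (\<Sum>j<K. \<Sum>i<K. z $ j * (Tm K $$ (i,j) * r (Suc i) $ x))" by (rule sum.swap)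
  also have "\<dots> = (\<Sum>j<K. z $ j * (A *\<^sub>v r (Suc j)) $ x)"
  proof (intro sum.cong refl)
    fix j assume "j \<in> {..<K}"
    hence j: "j < K" by simp
    have "(A *\<^sub>v r (Suc j)) $ x = c j * r j $ x + a j * r (Suc j) $ x + c (Suc j) * r (Suc (Suc j)) $ x"
      unfolding rec using x by (simp add: carrier_vecD[OF r_carrier])
    moreover have "Suc j < K \<or> z $ j = 0" using z0 j by (cases "Suc j < K") (auto dest: Suc_lessI)
    ultimately show "(\<Sum>i<K. z $ j * (Tm K $$ (i,j) * r (Suc i) $ x)) = z $ j * (A *\<^sub>v r (Suc j)) $ x"
      using Tm_column[OF j, of x] by (auto simp flip: sum_distrib_left)
  qed
  also have "\<dots> = (A *\<^sub>v Q K z) $ x" unfolding A_Q using x by simp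
  finally show "(A *\<^sub>v Q K z) $ x = (Q K (Tm K *\<^sub>v z)) $ x" ..
qed (use A_carrier in \<open>simp add: Q_def\<close>)

section \<open>Krylov vectors, moments and Gauss quadrature\<close>

abbreviation s :: "nat \<Rightarrow> real vec" where "s i \<equiv> ((*\<^sub>v) A ^^ i) (r 1)"
abbreviation t :: "nat \<Rightarrow> nat \<Rightarrow> real vec" where "t K i \<equiv> ((*\<^sub>v) (Tm K) ^^ i) (unit_vec K 0)"

lemma t_carrier: "t K i \<in> carrier_vec K"
  using Tm_carrier[of K] by (induction i) auto

lemma t_entry: "j < K \<Longrightarrow> t K (Suc i) $ j = (\<Sum>k<K. Tm K $$ (j,k) * t K i $ k)"
  using Tm_carrier[of K] t_carrier[of i K] by (simp add: scalar_prod_def atLeast0LessThan)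

text \<open>Each application of a tridiagonal matrix extends the support by one coordinate.\<close>

lemma t_support: "i < j \<Longrightarrow> j < K \<Longrightarrow> t K i $ j = 0"
proof (induction i arbitrary: j)
  case (Suc i)
  have "Tm K $$ (j,k) * t K i $ k = 0" if "k < K" for k
  proof (cases "i < k")
    case True
    thus ?thesis using Suc.IH that by simp
  next
    case False
    thus ?thesis using Suc.prems that by (simp add: Tm_def)
  qed
  thus ?case unfolding t_entry[OF Suc.prems(2)] by (intro sum.neutral) auto
qed simp

text \<open>These Krylov vectors never charge a coordinate whose Lanczos vector is 0, so
  \<open>Q\<close> preserves their lengths in spite of a breakdown.\<close>

lemma t_breakdown:
  assumes "j < K" "r (Suc j) = 0\<^sub>v n"
  shows "t K i $ j = 0"
proof (cases i)
  case 0
  have "j \<noteq> 0" using r_1 assms(2) zero_ip(1)[of "Suc 0"] by (metis zero_neq_one)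
  thus ?thesis using 0 assms by simp
next
  case (Suc i')
  have "Tm K $$ (j,k) = 0" if "k < K" for k
    using Tm_entry[OF assms(1) that] assms(2) Ar_carrier[of "Suc k"] by simp
  thus ?thesis unfolding Suc t_entry[OF assms(1)] by simp
qed

text \<open>Up to this power the remainder behind \<open>A_Q_eq\<close> is never met: the last
  coordinate is still 0 whenever A is applied.\<close>

lemma krylov: "i < K \<Longrightarrow> s i = Q K (t K i)"
proof (induction i)
  case 0
  have "Q K (unit_vec K 0) = r 1"
  proof (rule eq_vecI)
    fix x assume "x < dim_vec (r 1)"
    hence "x < n" using r_carrier[of 1] by simp
    moreover have "(\<Sum>j<K. unit_vec K 0 $ j * r (Suc j) $ x) = (\<Sum>j<K. if j = 0 then r 1 $ x else 0)"
      by (intro sum.cong refl) (auto simp: unit_vec_def)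
    ultimately show "Q K (unit_vec K 0) $ x = r 1 $ x" using 0 by (simp add: Q_def)
  qed (use r_carrier[of 1] in \<open>simp add: Q_def\<close>)
  thus ?case by simp
next
  case (Suc i)
  hence "t K i $ (K - 1) = 0" by (intro t_support) auto
  thus ?case using Suc A_Q_eq[OF t_carrier[of i K]] by simp
qed

text \<open>The powers are split evenly between the two factors of the scalar product, so each side
  needs fewer than K of them. For odd m one A is left in the middle, and between vectors in the
  range of \<open>Q\<close> it may be replaced by the tridiagonal matrix; this reaches m = 2K -
  1.\<close>

lemma moments_agree:
  assumes "m < 2 * K"
  shows "r 1 \<bullet> s m = unit_vec K 0 \<bullet> t K m"
proof -
  define i where "i = m div 2"
  have i: "i < K" using assms by (auto simp: i_def)
  have tQ: "Q K (t K i) \<bullet> Q K (t K i) = t K i \<bullet> t K i"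
  proof -
    have "t K i $ j * t K i $ j * (r (Suc j) \<bullet> r (Suc j)) = t K i $ j * t K i $ j" if "j < K" for j
      using zero_or_unit[of j] t_breakdown[OF that] by auto
    thus ?thesis unfolding Q_ip_Q scalar_prod_sum[OF t_carrier t_carrier] by (intro sum.cong refl) auto
  qed
  note fA = funpow_mult_mat_vec_ip[OF A_carrier A_sym r_carrier r_carrier, of 1 _ _ 1]
    and fT = funpow_mult_mat_vec_ip[OF Tm_carrier Tm_sym unit_vec_carrier unit_vec_carrier, of K 0 _ _ 0]
  show ?thesis
  proof (cases "even m")
    case True
    hence "m = i + i" by (auto simp: i_def)
    thus ?thesis using fA[of i i] fT[of i i] tQ krylov[OF i] by simp
  next
    case False
    hence "m = i + Suc i" by (simp add: i_def) presburger
    thus ?thesis using fA[of i "Suc i"] fT[of i "Suc i"] krylov[OF i] ip_A_Q[of "t K i" K "t K i", OF t_carrier t_carrier] by simp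
  qed
qed

text \<open>Since y has a component along \<open>r 1\<close>, the vector \<open>Q K y\<close> is
  nonzero and its Rayleigh quotient lies in [\<alpha>, \<beta>]. The quotient equals \<tau> once
  \<open>Q K y\<close> and y have the same length: where a Lanczos vector is 0, the row of the
  matrix vanishes, and as \<tau> is not 0 the coordinate of y must.\<close>

lemma ritz_value_bounds:
  assumes lb: "loewner_between \<alpha> A \<beta>" and \<alpha>: "0 < \<alpha>"
    and y: "y \<in> carrier_vec K" "Tm K *\<^sub>v y = \<tau> \<cdot>\<^sub>v y" and K: "0 < K" and y0: "y $ 0 \<noteq> 0"
  shows "\<tau> \<in> {\<alpha>..\<beta>}"
proof -
  let ?z = "Q K y"
  have Az: "\<alpha> * (?z \<bullet> ?z) \<le> ?z \<bullet> (A *\<^sub>v ?z)" "?z \<bullet> (A *\<^sub>v ?z) \<le> \<beta> * (?z \<bullet> ?z)"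
    using lb A_carrier Q_carrier unfolding loewner_between_def by auto
  have zAz: "?z \<bullet> (A *\<^sub>v ?z) = \<tau> * (y \<bullet> y)" using ip_A_Q[OF y(1) y(1)] y by simp
  have "0 < (y $ 0)\<^sup>2 * (r (Suc 0) \<bullet> r (Suc 0))" using y0 r_1 by simp
  also have "\<dots> \<le> ?z \<bullet> ?z" unfolding Q_ip_Q power2_eq_square
    by (rule member_le_sum) (use K scalar_prod_self_nonneg in auto)
  finally have zp: "0 < ?z \<bullet> ?z" .
  hence "0 < \<tau> * (y \<bullet> y)" using Az zAz \<alpha> by (smt (verit) mult_pos_pos)
  hence \<tau>: "\<tau> \<noteq> 0" by auto
  have "y $ j * y $ j * (r (Suc j) \<bullet> r (Suc j)) = y $ j * y $ j" if j: "j < K" for j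
  proof (cases "r (Suc j) = 0\<^sub>v n")
    case True
    have "(Tm K *\<^sub>v y) $ j = (\<Sum>k<K. Tm K $$ (j,k) * y $ k)"
      using y(1) j Tm_carrier[of K] by (simp add: scalar_prod_def atLeast0LessThan)
    also have "\<dots> = 0" using Tm_entry[OF j] True Ar_carrier by simp
    finally have "\<tau> * y $ j = 0" using y j by simp
    thus ?thesis using \<tau> by simp
  qed (use zero_or_unit[of j] in auto)
  hence "?z \<bullet> ?z = y \<bullet> y" unfolding Q_ip_Q scalar_prod_sum[OF y(1) y(1)] by (intro sum.cong refl) auto
  thus ?thesis using Az zAz zp by (simp add: mult_le_cancel_right_pos)
qed

text \<open>Gauss quadrature: a polynomial of degree below 2K sees only moments on which the two
  spectral measures agree.\<close>

lemma quadrature_exact: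
  assumes "degree p < 2 * K" and eT: "eigenbasis K (Tm K) y \<tau>" and eA: "eigenbasis n A u l"
  shows "(\<Sum>k<K. poly p (\<tau> k) * (y k \<bullet> unit_vec K 0)\<^sup>2) = (\<Sum>i<n. poly p (l i) * (u i \<bullet> r 1)\<^sup>2)"
proof -
  have "(\<Sum>k<K. poly p (\<tau> k) * (y k \<bullet> unit_vec K 0)\<^sup>2) = (\<Sum>m\<le>degree p. coeff p m * (unit_vec K 0 \<bullet> t K m))"
    unfolding poly_altdef eigenbasis_moment[OF eT unit_vec_carrier] sum_distrib_left sum_distrib_right
    by (subst sum.swap) (simp add: mult.assoc)
  also have "\<dots> = (\<Sum>m\<le>degree p. coeff p m * (r 1 \<bullet> s m))"
    using assms(1) by (intro sum.cong refl arg_cong2[of _ _ _ _ "(*)"] moments_agree[symmetric]) auto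
  also have "\<dots> = (\<Sum>i<n. poly p (l i) * (u i \<bullet> r 1)\<^sup>2)"
    unfolding poly_altdef eigenbasis_moment[OF eA r_carrier] sum_distrib_left sum_distrib_right
    by (subst sum.swap) (simp add: mult.assoc)
  finally show ?thesis .
qed

text \<open>Both spectral measures have total mass 1, so replacing ln by p costs at most e on each
  side, and the integrals of p agree.\<close>

lemma lanczos_log_error:
  assumes lb: "loewner_between \<alpha> A \<beta>" and \<alpha>: "0 < \<alpha>" and K: "0 < K"
    and p: "degree p < 2 * K" "\<And>x. x \<in> {\<alpha>..\<beta>} \<Longrightarrow> \<bar>ln x - poly p x\<bar> \<le> e"
  shows "\<bar>mat_log (Tm K) $$ (0,0) - r 1 \<bullet> (mat_log A *\<^sub>v r 1)\<bar> \<le> 2 * e"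
proof -
  obtain y \<tau> where eT: "eigenbasis K (Tm K) y \<tau>" using symmetric_eigenbasis[OF Tm_carrier Tm_sym] .
  obtain u l where eA: "eigenbasis n A u l" using symmetric_eigenbasis[OF A_carrier A_sym] .
  let ?e = "unit_vec K 0 :: real vec"
  have "mat_log (Tm K) \<in> carrier_mat K K" by (simp add: mat_log_def eigenbasis_mat_fun[OF eT])
  hence "mat_log (Tm K) $$ (0,0) = ?e \<bullet> (mat_log (Tm K) *\<^sub>v ?e)" using K by simp
  also have "\<dots> = (\<Sum>k<K. ln (\<tau> k) * (y k \<bullet> ?e)\<^sup>2)"
    unfolding mat_log_def by (rule eigenbasis_mat_fun_quadratic[OF eT]) simp
  finally have T: "mat_log (Tm K) $$ (0,0) = (\<Sum>k<K. ln (\<tau> k) * (y k \<bullet> ?e)\<^sup>2)" .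
  have B: "r 1 \<bullet> (mat_log A *\<^sub>v r 1) = (\<Sum>i<n. ln (l i) * (u i \<bullet> r 1)\<^sup>2)"
    unfolding mat_log_def by (rule eigenbasis_mat_fun_quadratic[OF eA r_carrier])
  have "\<bar>(\<Sum>k<K. ln (\<tau> k) * (y k \<bullet> ?e)\<^sup>2) - (\<Sum>k<K. poly p (\<tau> k) * (y k \<bullet> ?e)\<^sup>2)\<bar>
      \<le> (\<Sum>k<K. e * (y k \<bullet> ?e)\<^sup>2)"
    unfolding sum_subtractf[symmetric] left_diff_distrib[symmetric]
  proof (intro order_trans[OF sum_abs] sum_mono)
    fix k assume "k \<in> {..<K}"
    hence k: "k < K" by simp
    show "\<bar>(ln (\<tau> k) - poly p (\<tau> k)) * (y k \<bullet> ?e)\<^sup>2\<bar> \<le> e * (y k \<bullet> ?e)\<^sup>2"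
    \<comment> \<open>Nodes outside [\<alpha>, \<beta>], such as the eigenvalue 0 after a breakdown,
      have weight 0.\<close>
    proof (cases "y k $ 0 = 0")
      case True
      thus ?thesis using eigenbasis_carrier(2)[OF eT k] K by simp
    next
      case False
      have "\<tau> k \<in> {\<alpha>..\<beta>}"
        by (rule ritz_value_bounds[OF lb \<alpha> eigenbasis_carrier(2)[OF eT k] eigenbasis_eigen[OF eT k] K False])
      thus ?thesis using p(2) by (auto simp: abs_mult intro!: mult_right_mono)
    qed
  qed
  also have "\<dots> = e" unfolding sum_distrib_left[symmetric] eigenbasis_sum_coeff_square[OF eT unit_vec_carrier]
    using K by simp
  finally have 1: "\<bar>(\<Sum>k<K. ln (\<tau> k) * (y k \<bullet> ?e)\<^sup>2) - (\<Sum>k<K. poly p (\<tau> k) * (y k \<bullet> ?e)\<^sup>2)\<bar> \<le> e" .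
  have "\<bar>(\<Sum>i<n. ln (l i) * (u i \<bullet> r 1)\<^sup>2) - (\<Sum>i<n. poly p (l i) * (u i \<bullet> r 1)\<^sup>2)\<bar>
      \<le> (\<Sum>i<n. e * (u i \<bullet> r 1)\<^sup>2)"
    unfolding sum_subtractf[symmetric] left_diff_distrib[symmetric]
    using eigenbasis_loewner[OF eA lb] p(2)
    by (intro order_trans[OF sum_abs] sum_mono) (auto simp: abs_mult intro!: mult_right_mono)
  also have "\<dots> = e" unfolding sum_distrib_left[symmetric] eigenbasis_sum_coeff_square[OF eA r_carrier]
    using r_1 by simp
  finally show ?thesis using 1 quadrature_exact[OF p(1) eT eA] unfolding T B by linarith
qed

end

section \<open>Unrolling the list recursion into a Lanczos sequence\<close>

fun lanczos_step :: "real mat \<Rightarrow> real vec \<times> real vec \<times> real \<Rightarrow> real vec \<times> real vec \<times> real" where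
  "lanczos_step A (qp, q, bp) =
     (let v = A *\<^sub>v q - bp \<cdot>\<^sub>v qp; v' = v - (q \<bullet> v) \<cdot>\<^sub>v q in (q, (1 / vnorm v') \<cdot>\<^sub>v v', vnorm v'))"

fun lanczos_diag :: "real mat \<Rightarrow> real vec \<times> real vec \<times> real \<Rightarrow> real" where
  "lanczos_diag A (qp, q, bp) = q \<bullet> (A *\<^sub>v q - bp \<cdot>\<^sub>v qp)"

lemma lanczos_aux_nth:
  assumes "i < k"
  shows "fst (lanczos_aux A k qp q bp) ! i = lanczos_diag A ((lanczos_step A ^^ i) (qp, q, bp)) \<and>
    snd (lanczos_aux A k qp q bp) ! i = snd (snd ((lanczos_step A ^^ Suc i) (qp, q, bp)))"
  using assms
proof (induction k arbitrary: i qp q bp)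
  case (Suc k)
  show ?case
  proof (cases i)
    case 0
    thus ?thesis by (simp add: Let_def)
  next
    case (Suc i')
    hence "i' < k" using Suc.prems by simp
    thus ?thesis using Suc.IH[of i'] Suc
      by (simp add: Let_def funpow_Suc_right del: funpow.simps)
  qed
qed simp

lemma lanczos_T_lanczos_seq:
  fixes A :: "real mat"
  assumes A: "A \<in> carrier_mat n n" "transpose_mat A = A" and q: "q \<in> carrier_vec n" "q \<bullet> q = 1"
  obtains r a c where "lanczos_seq n A r a c" "r 1 = q" "\<And>K. lanczos_T K A q = lanczos_seq.Tm a c K"
proof -
  define S where "S j = (lanczos_step A ^^ j) (0\<^sub>v n, q, 0)" for j
  define r where "r j = fst (S j)" for j
  define c where "c j = snd (snd (S j))" for j
  define a where "a j = lanczos_diag A (S j)" for j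
  have S_Suc: "S (Suc j) = lanczos_step A (S j)" for j by (simp add: S_def)
  have r_Suc: "fst (snd (S j)) = r (Suc j)" for j unfolding r_def S_Suc
    by (cases "S j" rule: prod_cases3) (simp add: Let_def)
  have S: "S j = (r j, r (Suc j), c j)" for j
    by (metis c_def r_Suc r_def prod.collapse)
  define v where "v j = A *\<^sub>v r (Suc j) - c j \<cdot>\<^sub>v r j" for j
  define v' where "v' j = v j - a j \<cdot>\<^sub>v r (Suc j)" for j
  have a: "a j = r (Suc j) \<bullet> v j" for j by (simp add: a_def S v_def)
  have step: "r (Suc (Suc j)) = (1 / vnorm (v' j)) \<cdot>\<^sub>v v' j" "c (Suc j) = vnorm (v' j)" for j
    using S_Suc[of j] unfolding S by (auto simp: Let_def v_def[symmetric] a[symmetric] v'_def[symmetric])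
  have base: "r 0 = 0\<^sub>v n" "r (Suc 0) = q" "c 0 = 0"
    using S[of 0] by (auto simp: S_def)
  have rc: "r j \<in> carrier_vec n \<and> r (Suc j) \<in> carrier_vec n" for j
    by (induction j) (use A q in \<open>auto simp: base step v'_def v_def\<close>)
  hence rc: "r j \<in> carrier_vec n" for j by blast
  have vc: "v j \<in> carrier_vec n" "v' j \<in> carrier_vec n" for j using rc A by (auto simp: v_def v'_def)
  have L: "lanczos_seq n A r a c"
  proof
    fix j
    show "r j \<in> carrier_vec n" by (rule rc)
    \<comment> \<open>If the norm is 0 then \<open>v' j\<close> is already zero, so the convention 1
      / 0 = 0 does not disturb the recurrence; otherwise normalising and rescaling cancel.\<close>
    have cr: "c (Suc j) \<cdot>\<^sub>v r (Suc (Suc j)) = v' j"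
    proof (cases "vnorm (v' j) = 0")
      case True
      hence "v' j = 0\<^sub>v n" using vnorm_square[of "v' j"] scalar_prod_self_eq_0[OF vc(2)] by simp
      thus ?thesis unfolding step True by (intro eq_vecI) auto
    qed (simp add: step smult_smult_assoc)
    show "A *\<^sub>v r (Suc j) = c j \<cdot>\<^sub>v r j + a j \<cdot>\<^sub>v r (Suc j) + c (Suc j) \<cdot>\<^sub>v r (Suc (Suc j))"
      unfolding cr using A
      by (intro eq_vecI) (auto simp: v'_def v_def carrier_vecD[OF rc])
    show "a j = r (Suc j) \<bullet> (A *\<^sub>v r (Suc j) - c j \<cdot>\<^sub>v r j)" by (simp add: a v_def)
    show "r (Suc (Suc j)) = 0\<^sub>v n" if "c (Suc j) = 0"
      using that vc(2)[of j] by (intro eq_vecI) (auto simp: step)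
    show "r (Suc (Suc j)) \<bullet> r (Suc (Suc j)) = 1" if "c (Suc j) \<noteq> 0"
      using that unfolding vnorm_square[symmetric] step by (simp add: vnorm_smult)
  qed (use A q base in auto)
  moreover have "lanczos_T K A q = lanczos_seq.Tm a c K" for K
    unfolding lanczos_seq.Tm_def[OF L] lanczos_T_def Let_def
    using lanczos_aux_nth[of _ K A "0\<^sub>v n" q 0] A
    by (intro eq_matI) (auto simp: a_def c_def S_def simp del: funpow.simps)
  ultimately show ?thesis using base that[of r a c] by simp
qed

lemma slq_quad_error:
  assumes A: "A \<in> carrier_mat n n" "transpose_mat A = A" and w: "w \<in> carrier_vec n" "0 < w \<bullet> w"
    and lb: "loewner_between \<alpha> A \<beta>" and \<alpha>: "0 < \<alpha>" and K: "0 < K"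
    and p: "degree p < 2 * K" "\<And>x. x \<in> {\<alpha>..\<beta>} \<Longrightarrow> \<bar>ln x - poly p x\<bar> \<le> e"
  shows "\<bar>slq_quad K A w - w \<bullet> (mat_log A *\<^sub>v w)\<bar> \<le> (w \<bullet> w) * (2 * e)"
proof -
  define q where "q = (1 / vnorm w) \<cdot>\<^sub>v w"
  have vw: "vnorm w > 0" using w by (simp add: vnorm_def)
  have q: "q \<in> carrier_vec n" "q \<bullet> q = 1"
    unfolding vnorm_square[symmetric] q_def using w vw by (auto simp: vnorm_smult)
  obtain r a c where L: "lanczos_seq n A r a c" "r 1 = q" "\<And>K. lanczos_T K A q = lanczos_seq.Tm a c K"
    using lanczos_T_lanczos_seq[OF A q] by metis
  have err: "\<bar>mat_log (lanczos_T K A q) $$ (0,0) - q \<bullet> (mat_log A *\<^sub>v q)\<bar> \<le> 2 * e"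
    using lanczos_seq.lanczos_log_error[OF L(1) lb \<alpha> K p] L by simp
  obtain u l where eA: "eigenbasis n A u l" using symmetric_eigenbasis[OF A] .
  have "mat_log A \<in> carrier_mat n n" by (simp add: mat_log_def eigenbasis_mat_fun[OF eA])
  hence "w \<bullet> (mat_log A *\<^sub>v w) = (w \<bullet> w) * (q \<bullet> (mat_log A *\<^sub>v q))"
    unfolding q_def using w vw by (simp add: mult_mat_vec[of _ n n] vnorm_square[symmetric] power2_eq_square)
  moreover have "slq_quad K A w = (w \<bullet> w) * mat_log (lanczos_T K A q) $$ (0,0)"
    by (simp add: slq_quad_def q_def vnorm_square)
  ultimately have "\<bar>slq_quad K A w - w \<bullet> (mat_log A *\<^sub>v w)\<bar> =
      (w \<bullet> w) * \<bar>mat_log (lanczos_T K A q) $$ (0,0) - q \<bullet> (mat_log A *\<^sub>v q)\<bar>"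
    using w(2) by (simp add: abs_mult flip: right_diff_distrib)
  also have "\<dots> \<le> (w \<bullet> w) * (2 * e)" using err w(2) by (intro mult_left_mono) auto
  finally show ?thesis .
qed

section \<open>Exponential moments of Rademacher chaos\<close>

definition signs :: "nat \<Rightarrow> real vec set" where
  "signs m = {w \<in> carrier_vec m. \<forall>j<m. w $ j \<in> {-1, 1}}"

definition avg :: "nat \<Rightarrow> (real vec \<Rightarrow> real) \<Rightarrow> real" where
  "avg m f = (\<Sum>w\<in>signs m. f w) / 2 ^ m"

lemma signs_bij: "bij_betw (vec m) (PiE {..<m} (\<lambda>_. {-1, 1})) (signs m)"
proof (rule bij_betwI[where g = "\<lambda>w. \<lambda>i\<in>{..<m}. w $ i"])
  show "(\<lambda>i\<in>{..<m}. vec m x $ i) = x" if "x \<in> PiE {..<m} (\<lambda>_. {-1, 1})" for x :: "nat \<Rightarrow> real"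
    using that by (intro ext) (auto simp: PiE_def extensional_def)
qed (auto simp: signs_def PiE_def Pi_def)

lemma finite_signs [simp]: "finite (signs m)"
  using bij_betw_finite[OF signs_bij[of m]] by (simp add: finite_PiE)

lemma signs_carrier: "w \<in> signs m \<Longrightarrow> w \<in> carrier_vec m"
  by (simp add: signs_def)

text \<open>Independence of the coordinates: a sum of products over the cube factorises.\<close>

lemma sum_signs_prod: "(\<Sum>w\<in>signs m. \<Prod>i<m. f i (w $ i)) = (\<Prod>i<m. f i (-1) + f i 1)" for f :: "nat \<Rightarrow> real \<Rightarrow> real"
proof -
  have "(\<Sum>w\<in>signs m. \<Prod>i<m. f i (w $ i)) = (\<Sum>g\<in>PiE {..<m} (\<lambda>_. {-1, 1}). \<Prod>i<m. f i (vec m g $ i))"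
    by (rule sum.reindex_bij_betw[OF signs_bij, symmetric])
  also have "\<dots> = (\<Sum>g\<in>PiE {..<m} (\<lambda>_. {-1, 1}). \<Prod>i<m. f i (g i))" by simp
  also have "\<dots> = (\<Prod>i<m. \<Sum>y\<in>{-1, 1}. f i y)" by (rule prod_sum_PiE[symmetric]) auto
  finally show ?thesis by simp
qed

lemma card_signs [simp]: "card (signs m) = 2 ^ m"
proof -
  have "real (card (signs m)) = real (2 ^ m)" using sum_signs_prod[of "\<lambda>_ _. 1" m] by simp
  thus ?thesis by (simp only: of_nat_eq_iff)
qed

lemma avg_prod: "avg m (\<lambda>w. \<Prod>i<m. f i (w $ i)) = (\<Prod>i<m. (f i (-1) + f i 1) / 2)"
  unfolding avg_def sum_signs_prod by (simp add: prod_dividef)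

lemma avg_const [simp]: "avg m (\<lambda>_. c) = c"
  by (simp add: avg_def)

lemma avg_mono: "(\<And>w. w \<in> signs m \<Longrightarrow> f w \<le> g w) \<Longrightarrow> avg m f \<le> avg m g"
  unfolding avg_def by (intro divide_right_mono sum_mono) auto

lemma avg_cong: "(\<And>w. w \<in> signs m \<Longrightarrow> f w = g w) \<Longrightarrow> avg m f = avg m g"
  unfolding avg_def by (intro arg_cong2[of _ _ _ _ "(/)"] sum.cong) auto

lemma avg_add: "avg m (\<lambda>w. f w + g w) = avg m f + avg m g"
  by (simp add: avg_def sum.distrib add_divide_distrib)

lemma avg_mult: "avg m (\<lambda>w. c * f w) = c * avg m f"
  by (simp add: avg_def sum_distrib_left)

lemma avg_sum: "avg m (\<lambda>w. \<Sum>i\<in>A. f i w) = (\<Sum>i\<in>A. avg m (f i))"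
  unfolding avg_def sum_divide_distrib[symmetric] by (subst sum.swap) simp

lemma avg_swap: "avg m (\<lambda>x. avg m (\<lambda>y. f x y)) = avg m (\<lambda>y. avg m (\<lambda>x. f x y))"
  unfolding avg_def sum_divide_distrib[symmetric] by (subst sum.swap) simp

text \<open>Jensen's inequality, from the tangent line of exp at the mean.\<close>

lemma exp_avg_le: "exp (avg m f) \<le> avg m (\<lambda>w. exp (f w))"
proof -
  let ?\<mu> = "avg m f"
  have "exp ?\<mu> = avg m (\<lambda>w. exp ?\<mu> * ((1 - ?\<mu>) + f w))"
    unfolding avg_mult avg_add by simp
  also have "\<dots> \<le> avg m (\<lambda>w. exp (f w))"
  proof (rule avg_mono)
    fix w
    have "exp ?\<mu> * ((1 - ?\<mu>) + f w) \<le> exp ?\<mu> * exp (f w - ?\<mu>)"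
      by (intro mult_left_mono) (use exp_ge_add_one_self[of "f w - ?\<mu>"] in linarith, simp)
    thus "exp ?\<mu> * ((1 - ?\<mu>) + f w) \<le> exp (f w)" by (simp add: exp_diff)
  qed
  finally show ?thesis .
qed

section \<open>Sub-Gaussian and Gaussian exponential moments\<close>

lemma tanh_le_self:
  fixes x :: real
  assumes "0 \<le> x"
  shows "tanh x \<le> x"
proof -
  have "(\<lambda>x. x - tanh x) 0 \<le> (\<lambda>x. x - tanh x) x"
  proof (rule DERIV_nonneg_imp_nondecreasing[of 0 x "\<lambda>x. x - tanh x", OF assms])
    fix y :: real
    have "((\<lambda>x. x - tanh x) has_real_derivative (tanh y)\<^sup>2) (at y)"
      by (auto intro!: derivative_eq_intros simp: cosh_real_nonzero)
    thus "\<exists>z. ((\<lambda>x. x - tanh x) has_real_derivative z) (at y) \<and> 0 \<le> z" by fastforce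
  qed
  thus ?thesis by simp
qed

text \<open>The logarithm of the quotient of the two sides has derivative x - tanh x, which is
  nonnegative for x \<ge> 0; evenness covers the rest.\<close>

lemma cosh_le_exp_square: "cosh x \<le> exp (x\<^sup>2 / 2)" for x :: real
proof -
  have *: "cosh x \<le> exp (x\<^sup>2 / 2)" if "0 \<le> x" for x :: real
  proof -
    let ?f = "\<lambda>x. x\<^sup>2 / 2 - ln (cosh x)"
    have "?f 0 \<le> ?f x"
    proof (rule DERIV_nonneg_imp_nondecreasing[of 0 x ?f, OF that])
      fix y :: real assume "0 \<le> y"
      have "(?f has_real_derivative (y - tanh y)) (at y)"
        by (auto intro!: derivative_eq_intros simp: cosh_real_pos tanh_def)
      thus "\<exists>z. (?f has_real_derivative z) (at y) \<and> 0 \<le> z" using tanh_le_self[OF \<open>0 \<le> y\<close>] by fastforce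
    qed
    hence "ln (cosh x) \<le> x\<^sup>2 / 2" by simp
    thus ?thesis by (metis cosh_real_pos exp_le_cancel_iff exp_ln)
  qed
  show ?thesis using *[of x] *[of "-x"] by (cases "0 \<le> x") auto
qed

lemma avg_exp_linear:
  assumes "b \<in> carrier_vec m"
  shows "avg m (\<lambda>x. exp (b \<bullet> x)) \<le> exp (b \<bullet> b / 2)"
proof -
  have "avg m (\<lambda>x. exp (b \<bullet> x)) = avg m (\<lambda>x. \<Prod>i<m. exp (b $ i * (x $ i)))"
    using assms by (intro avg_cong) (simp add: scalar_prod_sum[of _ m] signs_carrier exp_sum)
  also have "\<dots> = (\<Prod>i<m. cosh (b $ i))"
    unfolding avg_prod[of m "\<lambda>i t. exp (b $ i * t)"] by (intro prod.cong refl) (simp add: cosh_field_def)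
  also have "\<dots> \<le> (\<Prod>i<m. exp ((b $ i)\<^sup>2 / 2))"
    by (intro prod_mono conjI cosh_le_exp_square) (simp add: cosh_real_nonneg)
  also have "\<dots> = exp (b \<bullet> b / 2)"
    using assms by (simp add: exp_sum[symmetric] scalar_prod_sum[of _ m] sum_divide_distrib power2_eq_square)
  finally show ?thesis .
qed

text \<open>Completing the square: the integrand is a constant multiple of the normal density with
  mean c / (1 - a) and variance 1 / (1 - a).\<close>

lemma std_normal_exp_quadratic:
  fixes a c :: real
  assumes a: "a < 1"
  shows "has_bochner_integral lborel (\<lambda>g. std_normal_density g * exp (c * g + a * g\<^sup>2 / 2))
    (1 / sqrt (1 - a) * exp (c\<^sup>2 / (2 * (1 - a))))"
proof -
  define \<sigma> where "\<sigma> = 1 / sqrt (1 - a)"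
  define \<mu> where "\<mu> = c / (1 - a)"
  define C where "C = 1 / sqrt (1 - a) * exp (c\<^sup>2 / (2 * (1 - a)))"
  have \<sigma>: "0 < \<sigma>" "\<sigma>\<^sup>2 = 1 / (1 - a)" using a by (auto simp: \<sigma>_def power_divide)
  have "has_bochner_integral lborel (normal_density \<mu> \<sigma>) 1"
    using \<sigma> by (simp add: has_bochner_integral_iff)
  from has_bochner_integral_mult_right[OF this, of C]
  have "has_bochner_integral lborel (\<lambda>g. C * normal_density \<mu> \<sigma> g) C" by simp
  moreover have "C * normal_density \<mu> \<sigma> g = std_normal_density g * exp (c * g + a * g\<^sup>2 / 2)" for g
  proof -
    have e: "c\<^sup>2 / (2 * (1 - a)) + - (g - \<mu>)\<^sup>2 / (2 * \<sigma>\<^sup>2) = - g\<^sup>2 / 2 + (c * g + a * g\<^sup>2 / 2)"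
    proof -
      define d where "d = 1 - a"
      have d: "0 < d" "a = 1 - d" using a by (auto simp: d_def)
      have "(g - c / d)\<^sup>2 = g\<^sup>2 - 2 * g * c / d + c\<^sup>2 / d\<^sup>2" by (simp add: power2_diff power_divide)
      hence "d * (g - c / d)\<^sup>2 = d * g\<^sup>2 - 2 * g * c + c\<^sup>2 / d"
        using d by (simp add: field_simps power2_eq_square)
      thus ?thesis unfolding \<sigma>(2) \<mu>_def d(2) by (simp add: algebra_simps add_divide_distrib diff_divide_distrib)
    qed
    have "sqrt (2 * pi * \<sigma>\<^sup>2) = sqrt (2 * pi) / sqrt (1 - a)" by (simp add: \<sigma>(2) real_sqrt_divide)
    hence "C * normal_density \<mu> \<sigma> g = 1 / sqrt (2 * pi) * exp (c\<^sup>2 / (2 * (1 - a)) + - (g - \<mu>)\<^sup>2 / (2 * \<sigma>\<^sup>2))"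
      using a unfolding normal_density_def C_def exp_add by simp
    also have "\<dots> = std_normal_density g * exp (c * g + a * g\<^sup>2 / 2)"
      unfolding e exp_add std_normal_density_def by simp
    finally show ?thesis .
  qed
  ultimately show ?thesis unfolding C_def by simp
qed

lemma has_bochner_integral_real_mono:
  fixes f g :: "'a \<Rightarrow> real"
  assumes "has_bochner_integral M f x" "has_bochner_integral M g y" "\<And>w. f w \<le> g w"
  shows "x \<le> y"
  using integral_mono[of M f g] assms by (simp add: has_bochner_integral_iff)

text \<open>Hubbard--Stratonovich: each square \<open>exp (a (u \<bullet> x)\<^sup>2 / 2)\<close> is a Gaussian average of
  \<open>exp (sqrt a g (u \<bullet> x))\<close>, which is absorbed in the linear term.\<close>
lemma avg_exp_quadratic:
  fixes a :: "nat \<Rightarrow> real"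
  assumes "\<And>i. i < k \<Longrightarrow> u i \<in> carrier_vec m"
    and "\<And>i j. i < k \<Longrightarrow> j < k \<Longrightarrow> u i \<bullet> u j = (if i = j then 1 else 0)"
    and "\<And>i. i < k \<Longrightarrow> 0 \<le> a i \<and> a i < 1" and "b \<in> carrier_vec m"
  shows "avg m (\<lambda>x. exp ((\<Sum>i<k. a i * (u i \<bullet> x)\<^sup>2) / 2 + b \<bullet> x)) \<le>
    (\<Prod>i<k. 1 / sqrt (1 - a i)) * exp ((\<Sum>i<k. a i / (1 - a i) * (u i \<bullet> b)\<^sup>2) / 2 + b \<bullet> b / 2)"
  using assms
proof (induction k arbitrary: b)
  case 0
  thus ?case using avg_exp_linear by simp
next
  case (Suc k)
  note b = \<open>b \<in> carrier_vec m\<close>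
  define v where "v = u k"
  define z where "z = a k"
  have v: "v \<in> carrier_vec m" "v \<bullet> v = 1" "\<And>i. i < k \<Longrightarrow> u i \<bullet> v = 0"
    using Suc.prems(1)[of k] Suc.prems(2)[of k k] Suc.prems(2)[of _ k] by (auto simp: v_def)
  have z: "0 \<le> z" "z < 1" using Suc.prems(3)[of k] by (auto simp: z_def)
  define P where "P = (\<Prod>i<k. 1 / sqrt (1 - a i))"
  define E where "E = (\<Sum>i<k. a i / (1 - a i) * (u i \<bullet> b)\<^sup>2)"
  define q where "q x = (\<Sum>i<k. a i * (u i \<bullet> x)\<^sup>2)" for x
  \<comment> \<open>The square in direction v becomes a random shift of b along v. As v is
    orthogonal to the other \<open>u i\<close>, the shift leaves \<open>E\<close> unchanged, and the
    induction hypothesis applies for each g.\<close>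
  define bg where "bg g = b + (sqrt z * g) \<cdot>\<^sub>v v" for g
  have bg: "bg g \<in> carrier_vec m" for g using b v by (auto simp: bg_def)
  have lhs: "has_bochner_integral lborel (\<lambda>g. std_normal_density g * avg m (\<lambda>x. exp (q x / 2 + bg g \<bullet> x)))
     (avg m (\<lambda>x. exp (q x / 2 + z * (v \<bullet> x)\<^sup>2 / 2 + b \<bullet> x)))"
  proof -
    have "has_bochner_integral lborel (\<lambda>g. std_normal_density g * exp (q x / 2 + bg g \<bullet> x))
       (exp (q x / 2 + z * (v \<bullet> x)\<^sup>2 / 2 + b \<bullet> x))" if x: "x \<in> signs m" for x
    proof -
      have "bg g \<bullet> x = b \<bullet> x + sqrt z * (v \<bullet> x) * g" for g
        unfolding bg_def using b v signs_carrier[OF x] by (simp add: add_scalar_prod_distrib[of _ m])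
      hence eq: "std_normal_density g * exp (q x / 2 + bg g \<bullet> x) =
          exp (q x / 2 + b \<bullet> x) * (std_normal_density g * exp (sqrt z * (v \<bullet> x) * g + 0 * g\<^sup>2 / 2))" for g
        by (simp add: exp_add)
      have val: "exp (q x / 2 + z * (v \<bullet> x)\<^sup>2 / 2 + b \<bullet> x) =
          exp (q x / 2 + b \<bullet> x) * (1 / sqrt (1 - 0) * exp ((sqrt z * (v \<bullet> x))\<^sup>2 / (2 * (1 - 0))))"
        using z by (simp add: power_mult_distrib exp_add)
      show ?thesis unfolding eq val
        by (intro has_bochner_integral_mult_right std_normal_exp_quadratic) auto
    qed
    hence "has_bochner_integral lborel (\<lambda>g. (\<Sum>x\<in>signs m. std_normal_density g * exp (q x / 2 + bg g \<bullet> x)) / 2 ^ m)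
       ((\<Sum>x\<in>signs m. exp (q x / 2 + z * (v \<bullet> x)\<^sup>2 / 2 + b \<bullet> x)) / 2 ^ m)"
      by (intro has_bochner_integral_divide has_bochner_integral_sum) auto
    thus ?thesis unfolding avg_def by (simp add: sum_distrib_left)
  qed
  have rhs: "has_bochner_integral lborel
      (\<lambda>g. std_normal_density g * (P * exp (E / 2 + bg g \<bullet> bg g / 2)))
      (P * exp (E / 2 + b \<bullet> b / 2) * (1 / sqrt (1 - z) * exp ((sqrt z * (v \<bullet> b))\<^sup>2 / (2 * (1 - z)))))"
  proof -
    have sq: "(b + c \<cdot>\<^sub>v v) \<bullet> (b + c \<cdot>\<^sub>v v) = b \<bullet> b + 2 * c * (v \<bullet> b) + c\<^sup>2" for c
      using b v comm_scalar_prod[OF b v(1)]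
      by (simp add: add_scalar_prod_distrib[of _ m] scalar_prod_add_distrib[of _ m] power2_eq_square algebra_simps)
    have "bg g \<bullet> bg g = b \<bullet> b + 2 * (sqrt z * (v \<bullet> b)) * g + z * g\<^sup>2" for g
      unfolding bg_def sq using z by (simp add: power_mult_distrib)
    hence eq: "std_normal_density g * (P * exp (E / 2 + bg g \<bullet> bg g / 2)) =
        P * exp (E / 2 + b \<bullet> b / 2) * (std_normal_density g * exp (sqrt z * (v \<bullet> b) * g + z * g\<^sup>2 / 2))" for g
      by (simp add: exp_add add_divide_distrib)
    show ?thesis unfolding eq by (intro has_bochner_integral_mult_right std_normal_exp_quadratic z)
  qed
  have "avg m (\<lambda>x. exp (q x / 2 + z * (v \<bullet> x)\<^sup>2 / 2 + b \<bullet> x)) \<le>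
    P * exp (E / 2 + b \<bullet> b / 2) * (1 / sqrt (1 - z) * exp ((sqrt z * (v \<bullet> b))\<^sup>2 / (2 * (1 - z))))"
  proof (rule has_bochner_integral_real_mono[OF lhs rhs])
    fix g :: real
    have "u i \<bullet> bg g = u i \<bullet> b" if "i < k" for i
      unfolding bg_def using v b that Suc.prems(1)[of i] by (simp add: scalar_prod_add_distrib[of _ m])
    hence E: "(\<Sum>i<k. a i / (1 - a i) * (u i \<bullet> bg g)\<^sup>2) = E" by (simp add: E_def)
    have "avg m (\<lambda>x. exp (q x / 2 + bg g \<bullet> x)) \<le> P * exp (E / 2 + bg g \<bullet> bg g / 2)"
      using Suc.IH[OF _ _ _ bg[of g]] Suc.prems unfolding q_def P_def E by simp
    thus "std_normal_density g * avg m (\<lambda>x. exp (q x / 2 + bg g \<bullet> x)) \<le>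
        std_normal_density g * (P * exp (E / 2 + bg g \<bullet> bg g / 2))"
      by (intro mult_left_mono) auto
  qed
  also have "\<dots> = P * (1 / sqrt (1 - z)) * exp ((E + z / (1 - z) * (v \<bullet> b)\<^sup>2) / 2 + b \<bullet> b / 2)"
    using z by (simp add: power_mult_distrib add_divide_distrib exp_add)
  finally show ?case by (simp add: P_def E_def q_def v_def z_def add_divide_distrib)
qed

text \<open>This turns a product of inverse square roots, the determinant of a Gaussian integral,
  into the exponential of a trace.\<close>

lemma inverse_sqrt_le_exp:
  fixes a :: real
  assumes "a < 1"
  shows "1 / sqrt (1 - a) \<le> exp (a / (1 - a) / 2)"
proof -
  have "1 / (1 - a) = 1 + a / (1 - a)" using assms by (simp add: field_simps)
  also have "\<dots> \<le> exp (a / (1 - a))" by (rule exp_ge_add_one_self)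
  also have "exp y = (exp (y / 2))\<^sup>2" for y :: real by (simp add: power2_eq_square flip: exp_add)
  finally have "(1 / sqrt (1 - a))\<^sup>2 \<le> (exp (a / (1 - a) / 2))\<^sup>2" using assms by (simp add: power_divide)
  thus ?thesis by (rule power2_le_imp_le) simp
qed

text \<open>For fixed x the average over y is that of the exponential of a linear form with
  coefficient vector t times the transpose of M applied to x; it is at most the exponential of half
  the squared length of that vector. This exponent is a quadratic form in x with matrix t^2
  \<open>G\<close>, up to the factor 1/2, whose eigenvalues are at most t^2 S^2 < 1 and whose trace
  is t^2 times the squared Frobenius norm of M.\<close>

lemma decoupled_chaos_mgf:
  fixes M :: "real mat"
  assumes M: "M \<in> carrier_mat m m"
    and S: "\<And>v. v \<in> carrier_vec m \<Longrightarrow> vnorm (transpose_mat M *\<^sub>v v) \<le> S * vnorm v"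
    and t: "t\<^sup>2 * S\<^sup>2 < 1"
  shows "avg m (\<lambda>x. avg m (\<lambda>y. exp (t * (x \<bullet> (M *\<^sub>v y))))) \<le>
    exp (t\<^sup>2 * (\<Sum>i<m. \<Sum>j<m. (M $$ (i,j))\<^sup>2) / (1 - t\<^sup>2 * S\<^sup>2) / 2)"
proof -
  define G where "G = M * transpose_mat M"
  have Mt: "transpose_mat M \<in> carrier_mat m m" using M by simp
  have G: "G \<in> carrier_mat m m" "transpose_mat G = G" using M Mt by (auto simp: G_def transpose_mult[OF M Mt])
  have xG: "x \<bullet> (G *\<^sub>v x) = (vnorm (transpose_mat M *\<^sub>v x))\<^sup>2" if x: "x \<in> carrier_vec m" for x
  proof -
    have c: "transpose_mat M *\<^sub>v x \<in> carrier_vec m" using Mt x by auto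
    have "G *\<^sub>v x = M *\<^sub>v (transpose_mat M *\<^sub>v x)" unfolding G_def by (rule assoc_mult_mat_vec[OF M Mt x])
    thus ?thesis using transpose_vec_mult_scalar[OF M c x] unfolding vnorm_square
      by (metis c M comm_scalar_prod mult_mat_vec_carrier x)
  qed
  obtain u g where e: "eigenbasis m G u g" using symmetric_eigenbasis[OF G] .
  have g: "0 \<le> g k" "g k \<le> S\<^sup>2" if k: "k < m" for k
  proof -
    have u: "u k \<in> carrier_vec m" "u k \<bullet> u k = 1"
      using eigenbasis_carrier(2)[OF e k] eigenbasis_orthonormal[OF e k k] by auto
    have gk: "g k = (vnorm (transpose_mat M *\<^sub>v u k))\<^sup>2"
      using xG[OF u(1)] eigenbasis_eigen[OF e k] u by simp
    show "0 \<le> g k" by (simp add: gk)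
    have "vnorm (u k) = 1" using u(2) by (simp add: vnorm_def)
    hence "vnorm (transpose_mat M *\<^sub>v u k) \<le> S" using S[OF u(1)] by simp
    thus "g k \<le> S\<^sup>2" unfolding gk by (intro power_mono) auto
  qed
  define a where "a k = t\<^sup>2 * g k" for k
  have a: "0 \<le> a k" "a k \<le> t\<^sup>2 * S\<^sup>2" if "k < m" for k
    using g[OF that] by (auto simp: a_def intro!: mult_left_mono)
  hence a1: "0 \<le> a k \<and> a k < 1" if "k < m" for k using that t by force
  have inner: "avg m (\<lambda>y. exp (t * (x \<bullet> (M *\<^sub>v y)))) \<le> exp ((\<Sum>k<m. a k * (u k \<bullet> x)\<^sup>2) / 2 + 0\<^sub>v m \<bullet> x)"
    if x: "x \<in> signs m" for x
  proof -
    note xc = signs_carrier[OF x]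
    let ?b = "t \<cdot>\<^sub>v (transpose_mat M *\<^sub>v x)"
    have c: "transpose_mat M *\<^sub>v x \<in> carrier_vec m" using Mt xc by auto
    have "avg m (\<lambda>y. exp (t * (x \<bullet> (M *\<^sub>v y)))) = avg m (\<lambda>y. exp (?b \<bullet> y))"
    proof (rule avg_cong)
      fix y assume "y \<in> signs m"
      thus "exp (t * (x \<bullet> (M *\<^sub>v y))) = exp (?b \<bullet> y)"
        using transpose_vec_mult_scalar[OF M signs_carrier xc] c signs_carrier[of y m] by simp
    qed
    also have "\<dots> \<le> exp (?b \<bullet> ?b / 2)" using c by (intro avg_exp_linear) auto
    also have "?b \<bullet> ?b = t\<^sup>2 * (x \<bullet> (G *\<^sub>v x))"
      unfolding vnorm_square[symmetric] vnorm_smult xG[OF xc] by (simp add: power_mult_distrib)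
    also have "\<dots> = (\<Sum>k<m. a k * (u k \<bullet> x)\<^sup>2)"
      unfolding eigenbasis_bilinear[OF e xc xc] sum_distrib_left a_def
      by (intro sum.cong refl) (simp add: eigenbasis_comm[OF e xc] power2_eq_square)
    finally show ?thesis using xc by simp
  qed
  have "avg m (\<lambda>x. avg m (\<lambda>y. exp (t * (x \<bullet> (M *\<^sub>v y))))) \<le>
      avg m (\<lambda>x. exp ((\<Sum>k<m. a k * (u k \<bullet> x)\<^sup>2) / 2 + 0\<^sub>v m \<bullet> x))"
    by (rule avg_mono[OF inner])
  also have "\<dots> \<le> (\<Prod>k<m. 1 / sqrt (1 - a k)) *
      exp ((\<Sum>k<m. a k / (1 - a k) * (u k \<bullet> 0\<^sub>v m)\<^sup>2) / 2 + 0\<^sub>v m \<bullet> 0\<^sub>v m / 2)"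
    using eigenbasis_carrier(2)[OF e] eigenbasis_orthonormal[OF e] a1 by (intro avg_exp_quadratic) auto
  also have "\<dots> = (\<Prod>k<m. 1 / sqrt (1 - a k))" using eigenbasis_carrier(2)[OF e] by simp
  also have "\<dots> \<le> (\<Prod>k<m. exp (a k / (1 - t\<^sup>2 * S\<^sup>2) / 2))"
  proof (intro prod_mono conjI)
    fix k assume "k \<in> {..<m}"
    hence k: "0 \<le> a k" "a k < 1" "a k \<le> t\<^sup>2 * S\<^sup>2" using a a1 by auto
    have "1 / sqrt (1 - a k) \<le> exp (a k / (1 - a k) / 2)" by (rule inverse_sqrt_le_exp[OF k(2)])
    also have "\<dots> \<le> exp (a k / (1 - t\<^sup>2 * S\<^sup>2) / 2)"
      using k t by (simp add: divide_left_mono)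
    finally show "1 / sqrt (1 - a k) \<le> exp (a k / (1 - t\<^sup>2 * S\<^sup>2) / 2)" .
  qed (use a1 in \<open>auto simp: less_imp_le\<close>)
  also have "\<dots> = exp (t\<^sup>2 * (\<Sum>k<m. g k) / (1 - t\<^sup>2 * S\<^sup>2) / 2)"
    by (simp add: exp_sum[symmetric] a_def sum_divide_distrib sum_distrib_left)
  also have "(\<Sum>k<m. g k) = (\<Sum>i<m. \<Sum>j<m. (M $$ (i,j))\<^sup>2)"
    unfolding eigenbasis_trace[OF e, symmetric] using M
    by (intro sum.cong refl) (auto simp: G_def scalar_prod_def atLeast0LessThan power2_eq_square)
  finally show ?thesis .
qed

text \<open>For a sign vector e the two weights are indicators: an entry is kept exactly when e is 1
  at its row and -1 at its column.\<close>

definition split_mat :: "real vec \<Rightarrow> real mat \<Rightarrow> real mat" where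
  "split_mat e B = mat (dim_row B) (dim_col B) (\<lambda>(i,j). (1 + e $ i) / 2 * ((1 - e $ j) / 2) * B $$ (i,j))"

lemma avg_split:
  assumes "i < m" "j < m" "i \<noteq> j"
  shows "avg m (\<lambda>e. (1 + e $ i) / 2 * ((1 - e $ j) / 2)) = 1 / 4"
proof -
  define f where "f k t = (if k = i then (1 + t) / 2 else if k = j then (1 - t) / 2 else 1)" for k and t :: real
  have two: "prod h {..<m} = h i * h j" if "\<And>k. k \<noteq> i \<Longrightarrow> k \<noteq> j \<Longrightarrow> h k = 1" for h :: "nat \<Rightarrow> real"
  proof -
    have "prod h {..<m} = prod h {i, j}" using assms that by (intro prod.mono_neutral_right) auto
    thus ?thesis using assms by simp
  qed
  have "avg m (\<lambda>e. (1 + e $ i) / 2 * ((1 - e $ j) / 2)) = avg m (\<lambda>e. \<Prod>k<m. f k (e $ k))"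
    using assms by (subst two) (auto simp: f_def)
  also have "\<dots> = 1 / 4" unfolding avg_prod using assms by (subst two) (auto simp: f_def)
  finally show ?thesis .
qed

text \<open>An off-diagonal entry survives the random split with probability 1/4, hence the factor
  4. A diagonal entry never survives, so the diagonal has to be 0.\<close>

lemma avg_split_mat:
  assumes B: "B \<in> carrier_mat m m" "\<And>i. i < m \<Longrightarrow> B $$ (i,i) = 0" and x: "x \<in> carrier_vec m"
  shows "avg m (\<lambda>e. 4 * (x \<bullet> (split_mat e B *\<^sub>v x))) = x \<bullet> (B *\<^sub>v x)"
proof -
  have sc: "split_mat e B \<in> carrier_mat m m" for e using B by (simp add: split_mat_def)
  have "avg m (\<lambda>e. 4 * (x \<bullet> (split_mat e B *\<^sub>v x))) =
      avg m (\<lambda>e. \<Sum>i<m. \<Sum>j<m. (4 * x $ i * B $$ (i,j) * x $ j) * ((1 + e $ i) / 2 * ((1 - e $ j) / 2)))"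
    unfolding bilinear_sum[OF sc x x] sum_distrib_left using B
    by (intro avg_cong sum.cong refl) (auto simp: split_mat_def)
  also have "\<dots> = (\<Sum>i<m. \<Sum>j<m. (4 * x $ i * B $$ (i,j) * x $ j) * avg m (\<lambda>e. (1 + e $ i) / 2 * ((1 - e $ j) / 2)))"
    unfolding avg_sum avg_mult ..
  also have "\<dots> = (\<Sum>i<m. \<Sum>j<m. x $ i * B $$ (i,j) * x $ j)"
  proof (intro sum.cong refl)
    fix i j assume "i \<in> {..<m}" "j \<in> {..<m}"
    thus "(4 * x $ i * B $$ (i,j) * x $ j) * avg m (\<lambda>e. (1 + e $ i) / 2 * ((1 - e $ j) / 2)) = x $ i * B $$ (i,j) * x $ j"
      using avg_split[of i m j] B(2)[of i] by (cases "i = j") auto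
  qed
  finally show ?thesis using bilinear_sum[OF B(1) x x] by simp
qed

definition mix :: "real vec \<Rightarrow> real vec \<Rightarrow> real vec \<Rightarrow> real vec" where
  "mix e x y = vec (dim_vec e) (\<lambda>i. if e $ i = 1 then x $ i else y $ i)"

text \<open>Exchanging the coordinates of x and y where e is -1 is an involution on pairs of sign
  vectors, so the mixture of two independent sign vectors is again uniform.\<close>

lemma avg_mix:
  assumes e: "e \<in> signs m"
  shows "avg m (\<lambda>x. avg m (\<lambda>y. h (mix e x y))) = avg m h"
proof -
  have de: "dim_vec e = m" using e by (auto simp: signs_def)
  have mix: "mix e x y \<in> signs m" if "x \<in> signs m" "y \<in> signs m" for x y
    using that by (auto simp: signs_def mix_def de)
  have inv: "mix e (mix e x y) (mix e y x) = x" if "x \<in> signs m" "y \<in> signs m" for x y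
    using that by (intro eq_vecI) (auto simp: signs_def mix_def de)
  let ?j = "\<lambda>(x, y). (mix e x y, mix e y x)"
  have "(\<Sum>(x,y)\<in>signs m \<times> signs m. h (mix e x y)) = (\<Sum>(x,y)\<in>signs m \<times> signs m. h x)"
    by (rule sum.reindex_bij_witness[of _ ?j ?j]) (auto simp: mix inv)
  hence "(\<Sum>x\<in>signs m. \<Sum>y\<in>signs m. h (mix e x y)) = 2 ^ m * (\<Sum>x\<in>signs m. h x)"
    by (simp add: sum_distrib_left flip: sum.cartesian_product)
  thus ?thesis by (simp add: avg_def flip: sum_divide_distrib)
qed

text \<open>Decoupling: the coordinates are split at random in two groups, so that \<open>x \<bullet> (B *\<^sub>v x)\<close> becomes an
  average of forms that are bilinear in independent sign vectors.\<close>
theorem rademacher_chaos_mgf: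
  assumes B: "B \<in> carrier_mat m m" "transpose_mat B = B" "\<And>i. i < m \<Longrightarrow> B $$ (i,i) = 0"
    and t: "16 * t\<^sup>2 * (spec_norm B)\<^sup>2 < 1"
  shows "avg m (\<lambda>x. exp (t * (x \<bullet> (B *\<^sub>v x)))) \<le>
    exp (4 * t\<^sup>2 * (frob_norm B)\<^sup>2 / (1 - 16 * t\<^sup>2 * (spec_norm B)\<^sup>2))"
proof -
  define S where "S = spec_norm B"
  have sc: "split_mat e B \<in> carrier_mat m m" for e using B by (simp add: split_mat_def)
  have Bsym: "B $$ (i,j) = B $$ (j,i)" if "i < m" "j < m" for i j
    using B(1) that arg_cong[OF B(2), of "\<lambda>A. A $$ (i,j)"] by simp
  have one: "avg m (\<lambda>x. exp (4 * t * (x \<bullet> (split_mat e B *\<^sub>v x)))) \<le>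
      exp (4 * t\<^sup>2 * (frob_norm B)\<^sup>2 / (1 - 16 * t\<^sup>2 * S\<^sup>2))" if e: "e \<in> signs m" for e
  proof -
    let ?M = "split_mat e B"
    have ee: "e $ i = -1 \<or> e $ i = 1" if "i < m" for i using e that by (auto simp: signs_def)
    have de: "dim_vec e = m" using e by (auto simp: signs_def)
    \<comment> \<open>Rows are read only where e is 1 and columns only where e is -1, so a single
      mixed vector can stand for both x and y.\<close>
    have "x \<bullet> (?M *\<^sub>v y) = mix e x y \<bullet> (?M *\<^sub>v mix e x y)" if "x \<in> signs m" "y \<in> signs m" for x y
    proof -
      have mc: "mix e x y \<in> carrier_vec m" by (simp add: mix_def de)
      show ?thesis
        unfolding bilinear_sum[OF sc mc mc] bilinear_sum[OF sc signs_carrier[OF that(1)] signs_carrier[OF that(2)]]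
        using B(1) ee by (intro sum.cong refl) (force simp: mix_def split_mat_def de)
    qed
    hence "avg m (\<lambda>x. avg m (\<lambda>y. exp (4 * t * (x \<bullet> (?M *\<^sub>v y))))) =
        avg m (\<lambda>x. avg m (\<lambda>y. exp (4 * t * (mix e x y \<bullet> (?M *\<^sub>v mix e x y)))))"
      by (intro avg_cong) simp
    also have "\<dots> = avg m (\<lambda>x. exp (4 * t * (x \<bullet> (?M *\<^sub>v x))))"
      by (rule avg_mix[OF e])
    finally have eq: "avg m (\<lambda>x. exp (4 * t * (x \<bullet> (?M *\<^sub>v x)))) =
        avg m (\<lambda>x. avg m (\<lambda>y. exp (4 * t * (x \<bullet> (?M *\<^sub>v y)))))" ..
    \<comment> \<open>For symmetric B the transpose of the split matrix is B between two coordinate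
      projections, neither of which increases length.\<close>
    have nrm: "vnorm (transpose_mat ?M *\<^sub>v v) \<le> S * vnorm v" if v: "v \<in> carrier_vec m" for v
    proof -
      define v' where "v' = vec m (\<lambda>i. (1 + e $ i) / 2 * v $ i)"
      have v': "v' \<in> carrier_vec m" by (simp add: v'_def)
      have Bv: "B *\<^sub>v v' \<in> carrier_vec m" using B v' by auto
      have Mv: "transpose_mat ?M *\<^sub>v v \<in> carrier_vec m" using sc[of e] v by auto
      have shrink: "vnorm y \<le> vnorm z"
        if "y \<in> carrier_vec m" "z \<in> carrier_vec m" "\<And>i. i < m \<Longrightarrow> (y $ i)\<^sup>2 \<le> (z $ i)\<^sup>2" for y z
        unfolding vnorm_def scalar_prod_sum[OF that(1,1)] scalar_prod_sum[OF that(2,2)]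
        using that(3) by (intro real_sqrt_le_mono sum_mono) (simp add: power2_eq_square)
      have "(transpose_mat ?M *\<^sub>v v) $ j = (1 - e $ j) / 2 * (B *\<^sub>v v') $ j" if "j < m" for j
      proof -
        have "(transpose_mat ?M *\<^sub>v v) $ j = (\<Sum>i<m. (1 + e $ i) / 2 * ((1 - e $ j) / 2) * B $$ (i,j) * v $ i)"
          using B(1) v that by (simp add: split_mat_def scalar_prod_def atLeast0LessThan)
        also have "\<dots> = (\<Sum>i<m. (1 - e $ j) / 2 * (B $$ (j,i) * v' $ i))"
          using that by (intro sum.cong refl) (simp add: Bsym v'_def)
        also have "\<dots> = (1 - e $ j) / 2 * (B *\<^sub>v v') $ j"
          unfolding sum_distrib_left[symmetric] using B(1) that v' by (simp add: scalar_prod_def atLeast0LessThan)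
        finally show ?thesis .
      qed
      hence "vnorm (transpose_mat ?M *\<^sub>v v) \<le> vnorm (B *\<^sub>v v')"
        using ee by (intro shrink Mv Bv) (force simp: power_mult_distrib)
      also have "\<dots> \<le> S * vnorm v'" unfolding S_def by (rule vnorm_mult_mat_vec_le_spec_norm[OF B(1) v'])
      also have "\<dots> \<le> S * vnorm v"
      proof (cases "m = 0")
        case True
        thus ?thesis using v v' by (simp add: vnorm_def scalar_prod_def)
      next
        case False
        have "vnorm v' \<le> vnorm v"
          using ee by (intro shrink v v') (force simp: v'_def power_mult_distrib)
        thus ?thesis using False spec_norm_nonneg[OF B(1)] by (intro mult_left_mono) (auto simp: S_def)
      qed
      finally show ?thesis .
    qed
    \<comment> \<open>An entry and its mirror image are never both kept, so a symmetric B retains at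
      most half of its squared Frobenius norm.\<close>
    have F: "(\<Sum>i<m. \<Sum>j<m. (?M $$ (i,j))\<^sup>2) \<le> (frob_norm B)\<^sup>2 / 2"
    proof -
      have "2 * (\<Sum>i<m. \<Sum>j<m. (?M $$ (i,j))\<^sup>2) = (\<Sum>i<m. \<Sum>j<m. (?M $$ (i,j))\<^sup>2 + (?M $$ (j,i))\<^sup>2)"
        unfolding sum.distrib by (subst sum.swap[of "\<lambda>i j. (?M $$ (j,i))\<^sup>2"]) simp
      also have "\<dots> \<le> (\<Sum>i<m. \<Sum>j<m. (B $$ (i,j))\<^sup>2)"
      proof (intro sum_mono)
        fix i j assume "i \<in> {..<m}" "j \<in> {..<m}"
        thus "(?M $$ (i,j))\<^sup>2 + (?M $$ (j,i))\<^sup>2 \<le> (B $$ (i,j))\<^sup>2"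
          using B(1) ee[of i] ee[of j] Bsym[of i j] by (auto simp: split_mat_def)
      qed
      also have "\<dots> = (frob_norm B)\<^sup>2" using B(1) by (simp add: frob_norm_def sum_nonneg)
      finally show ?thesis by simp
    qed
    have "avg m (\<lambda>x. avg m (\<lambda>y. exp (4 * t * (x \<bullet> (?M *\<^sub>v y))))) \<le>
      exp ((4 * t)\<^sup>2 * (\<Sum>i<m. \<Sum>j<m. (?M $$ (i,j))\<^sup>2) / (1 - (4 * t)\<^sup>2 * S\<^sup>2) / 2)"
      using t by (intro decoupled_chaos_mgf sc nrm) (auto simp: S_def power_mult_distrib)
    also have "\<dots> \<le> exp ((4 * t)\<^sup>2 * ((frob_norm B)\<^sup>2 / 2) / (1 - (4 * t)\<^sup>2 * S\<^sup>2) / 2)"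
      using t F by (intro exp_le_cancel_iff[THEN iffD2] divide_right_mono mult_left_mono)
        (auto simp: S_def power_mult_distrib)
    also have "(4 * t)\<^sup>2 = 16 * t\<^sup>2" by (simp add: power_mult_distrib)
    also have "16 * x * (f / 2) / d / 2 = 4 * x * f / d" for x f d :: real by simp
    finally show ?thesis unfolding eq .
  qed
  have "avg m (\<lambda>x. exp (t * (x \<bullet> (B *\<^sub>v x)))) =
      avg m (\<lambda>x. exp (avg m (\<lambda>e. 4 * t * (x \<bullet> (split_mat e B *\<^sub>v x)))))"
  proof (rule avg_cong)
    fix x assume "x \<in> signs m"
    have "avg m (\<lambda>e. 4 * t * (x \<bullet> (split_mat e B *\<^sub>v x))) = t * avg m (\<lambda>e. 4 * (x \<bullet> (split_mat e B *\<^sub>v x)))"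
      unfolding avg_mult[symmetric] by (simp add: mult_ac)
    thus "exp (t * (x \<bullet> (B *\<^sub>v x))) = exp (avg m (\<lambda>e. 4 * t * (x \<bullet> (split_mat e B *\<^sub>v x))))"
      using avg_split_mat[OF B(1,3) signs_carrier[OF \<open>x \<in> signs m\<close>]] by simp
  qed
  also have "\<dots> \<le> avg m (\<lambda>x. avg m (\<lambda>e. exp (4 * t * (x \<bullet> (split_mat e B *\<^sub>v x)))))"
    by (intro avg_mono exp_avg_le)
  also have "\<dots> = avg m (\<lambda>e. avg m (\<lambda>x. exp (4 * t * (x \<bullet> (split_mat e B *\<^sub>v x)))))" by (rule avg_swap)
  also have "\<dots> \<le> avg m (\<lambda>e. exp (4 * t\<^sup>2 * (frob_norm B)\<^sup>2 / (1 - 16 * t\<^sup>2 * S\<^sup>2)))"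
    by (rule avg_mono[OF one])
  finally show ?thesis by (simp add: S_def)
qed

section \<open>Nets and the choice of parameters\<close>

text \<open>Balls of radius \<rho>/2 about the points of F are disjoint and lie in the ball of
  radius r + \<rho>/2 about c; volumes are compared.\<close>

lemma card_separated_le:
  fixes c :: "'a :: euclidean_space"
  assumes F: "finite F" "F \<subseteq> cball c r" and r: "0 \<le> r" and \<rho>: "0 < \<rho>"
    and sep: "\<And>x y. x \<in> F \<Longrightarrow> y \<in> F \<Longrightarrow> x \<noteq> y \<Longrightarrow> \<rho> \<le> dist x y"
  shows "real (card F) \<le> (1 + 2 * r / \<rho>) ^ DIM('a)"
proof -
  let ?V = "measure lborel (ball 0 1 :: 'a set)"
  have V: "0 < ?V" by (simp add: content_ball_pos)
  have disj: "disjoint_family_on (\<lambda>x. ball x (\<rho> / 2)) F"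
  proof (unfold disjoint_family_on_def, intro ballI impI)
    fix x y assume xy: "x \<in> F" "y \<in> F" "x \<noteq> y"
    show "ball x (\<rho> / 2) \<inter> ball y (\<rho> / 2) = {}"
    proof (rule ccontr)
      assume "ball x (\<rho> / 2) \<inter> ball y (\<rho> / 2) \<noteq> {}"
      then obtain z where "dist x z < \<rho> / 2" "dist y z < \<rho> / 2" by auto
      hence "dist x y < \<rho>" using dist_triangle2[of x y z] by simp
      thus False using sep[OF xy] by simp
    qed
  qed
  have "real (card F) * ((\<rho> / 2) ^ DIM('a) * ?V) = (\<Sum>x\<in>F. measure lborel (ball x (\<rho> / 2)))"
    using \<rho> by (simp add: content_ball_conv_unit_ball[of "\<rho> / 2"])
  also have "\<dots> = measure lborel (\<Union>x\<in>F. ball x (\<rho> / 2))"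
  proof (rule measure_finite_Union[symmetric, OF F(1) _ disj])
    show "emeasure lborel (ball x (\<rho> / 2)) \<noteq> \<infinity>" for x
      using emeasure_lborel_ball_finite[of x "\<rho> / 2"] by simp
  qed auto
  also have "\<dots> \<le> measure lborel (cball c (r + \<rho> / 2))"
  proof (rule measure_mono_fmeasurable)
    show "(\<Union>x\<in>F. ball x (\<rho> / 2)) \<subseteq> cball c (r + \<rho> / 2)"
    proof
      fix z assume "z \<in> (\<Union>x\<in>F. ball x (\<rho> / 2))"
      then obtain x where "x \<in> F" "dist x z < \<rho> / 2" by auto
      moreover from this have "dist c x \<le> r" using F by auto
      ultimately show "z \<in> cball c (r + \<rho> / 2)" using dist_triangle[of c z x] by simp
    qed
    show "(\<Union>x\<in>F. ball x (\<rho> / 2)) \<in> sets lborel" by (simp add: borel_open open_UN)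
    show "cball c (r + \<rho> / 2) \<in> fmeasurable lborel" by (intro fmeasurable_compact compact_cball)
  qed
  also have "\<dots> = (r + \<rho> / 2) ^ DIM('a) * ?V"
    using \<rho> r by (simp add: content_cball_conv_ball content_ball_conv_unit_ball[of "r + \<rho> / 2"])
  also have "r + \<rho> / 2 = (1 + 2 * r / \<rho>) * (\<rho> / 2)" using \<rho> by (simp add: field_simps)
  finally have "real (card F) * ((\<rho> / 2) ^ DIM('a) * ?V) \<le> (1 + 2 * r / \<rho>) ^ DIM('a) * ((\<rho> / 2) ^ DIM('a) * ?V)"
    by (simp only: power_mult_distrib mult.assoc)
  thus ?thesis using V \<rho> by (simp add: mult_le_cancel_right_pos)
qed

text \<open>A separated subset of T of largest cardinality exists by the volume bound, and it is a
  net: a point farther than \<rho> from all of it could be added.\<close>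

lemma exists_net:
  fixes c :: "'a :: euclidean_space"
  assumes T: "T \<subseteq> cball c r" and r: "0 \<le> r" and \<rho>: "0 < \<rho>"
  obtains F where "finite F" "F \<subseteq> T" "real (card F) \<le> (1 + 2 * r / \<rho>) ^ DIM('a)"
    "\<And>x. x \<in> T \<Longrightarrow> \<exists>y\<in>F. dist x y \<le> \<rho>"
proof -
  define P where "P F \<longleftrightarrow> finite F \<and> F \<subseteq> T \<and> (\<forall>x\<in>F. \<forall>y\<in>F. x \<noteq> y \<longrightarrow> \<rho> \<le> dist x y)" for F
  have bound: "real (card F) \<le> (1 + 2 * r / \<rho>) ^ DIM('a)" if "P F" for F
    using that T by (intro card_separated_le[OF _ _ r \<rho>, of F c]) (auto simp: P_def)
  have "\<exists>F. P F \<and> (\<forall>G. P G \<longrightarrow> card G \<le> card F)"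
  proof (rule ex_has_greatest_nat[of P "{}"])
    show "P {}" by (simp add: P_def)
    show "\<forall>G. P G \<longrightarrow> card G < Suc (nat \<lfloor>(1 + 2 * r / \<rho>) ^ DIM('a)\<rfloor>)"
      using bound le_nat_floor by (metis less_Suc_eq_le)
  qed
  then obtain F where F: "P F" "\<And>G. P G \<Longrightarrow> card G \<le> card F" by blast
  have "\<exists>y\<in>F. dist x y \<le> \<rho>" if x: "x \<in> T" for x
  proof (rule ccontr)
    assume "\<not> (\<exists>y\<in>F. dist x y \<le> \<rho>)"
    hence far: "\<rho> < dist x y" if "y \<in> F" for y using that by force
    hence "P (insert x F)" using F(1) x by (auto simp: P_def dist_commute less_imp_le)
    moreover have "x \<notin> F" using far[of x] \<rho> by auto
    ultimately show False using F(2)[of "insert x F"] F(1) by (simp add: P_def)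
  qed
  thus ?thesis using that[of F] F(1) bound by (auto simp: P_def)
qed

text \<open>The factor \<open>4/3\<close> makes the volume bound \<open>(3r/\<eta>)\<^sup>p\<close> valid for all \<open>\<eta>\<close>: a net of radius \<open>4\<eta>/3\<close> has at most
  \<open>(1 + 3r/(2\<eta>))\<^sup>p\<close> points, which suffices when \<open>\<eta> \<le> 3r/2\<close>, and otherwise a single point is enough.\<close>
lemma exists_lipschitz_net:
  fixes T :: "'a :: euclidean_space set"
  assumes T: "T \<subseteq> cball c r" "T \<noteq> {}" and r: "0 < r" and L: "0 \<le> L" and h: "0 < h"
  obtains F where "finite F" "F \<subseteq> T" "real (card F) \<le> max ((3 * r / (h / L)) ^ DIM('a)) 1"
    "\<And>x. x \<in> T \<Longrightarrow> \<exists>y\<in>F. L * norm (x - y) \<le> 4 / 3 * h"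
\<comment> \<open>One centre suffices when the diameter is small enough. This includes L = 0, where
  h / L is 0 by convention and the bound reduces to 1.\<close>
proof (cases "L * (2 * r) \<le> 4 / 3 * h")
  case True
  obtain y where y: "y \<in> T" using T by blast
  have "L * norm (x - y) \<le> 4 / 3 * h" if "x \<in> T" for x
  proof -
    have "norm (x - y) \<le> 2 * r" using subsetD[OF T(1) that] subsetD[OF T(1) y] dist_triangle3[of x y c]
      by (simp add: dist_norm)
    thus ?thesis using True L mult_left_mono[of "norm (x - y)" "2 * r" L] by linarith
  qed
  thus ?thesis using y by (intro that[of "{y}"]) auto
next
  case False
  hence Lp: "0 < L" using L h by (cases "L = 0") auto
  define \<eta> where "\<eta> = h / L"
  have \<eta>: "0 < \<eta>" using Lp h by (simp add: \<eta>_def)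
  have small: "\<eta> < 3 / 2 * r" using False Lp by (simp add: \<eta>_def field_simps)
  obtain F where F: "finite F" "F \<subseteq> T" "real (card F) \<le> (1 + 2 * r / (4 / 3 * \<eta>)) ^ DIM('a)"
    "\<And>x. x \<in> T \<Longrightarrow> \<exists>y\<in>F. dist x y \<le> 4 / 3 * \<eta>"
    using exists_net[OF T(1), of "4 / 3 * \<eta>"] r \<eta> by auto
  have "(1 + 2 * r / (4 / 3 * \<eta>)) ^ DIM('a) \<le> (3 * r / \<eta>) ^ DIM('a)"
    using r \<eta> small by (intro power_mono) (auto simp: field_simps)
  hence "real (card F) \<le> max ((3 * r / (h / L)) ^ DIM('a)) 1" using F(3) by (simp add: \<eta>_def)
  moreover have "\<exists>y\<in>F. L * norm (x - y) \<le> 4 / 3 * h" if x: "x \<in> T" for x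
  proof -
    obtain y where y: "y \<in> F" "norm (x - y) \<le> 4 / 3 * \<eta>" using F(4)[OF x] by (auto simp: dist_norm)
    hence "L * norm (x - y) \<le> L * (4 / 3 * \<eta>)" using L by (intro mult_left_mono)
    also have "\<dots> = 4 / 3 * h" using Lp by (simp add: \<eta>_def)
    finally show ?thesis using y by blast
  qed
  ultimately show ?thesis using that F(1,2) by blast
qed

text \<open>In units of \<epsilon>' = 2\<epsilon>/5 the hypothesis reads N \<ge> 32 (f + g) L, while
  the deviation to be excluded is only 19\<epsilon>/60 = 19\<epsilon>'/24. The exponent still has to
  reach L, whatever the ratio of f to g.\<close>

lemma chernoff_parameter:
  fixes F2 S \<epsilon> N L :: real
  assumes nn: "0 \<le> F2" "0 \<le> S" and \<epsilon>: "0 < \<epsilon>" and L: "0 < L" and N: "0 < N"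
    and le: "32 * (25/4 * inverse \<epsilon> ^ 2 * F2 + 5/2 * inverse \<epsilon> * S) * L \<le> N"
  shows "\<exists>s>0. 16 * s\<^sup>2 * S\<^sup>2 < 1 \<and> L \<le> N * (s * (19/60 * \<epsilon>) - 4 * s\<^sup>2 * F2 / (1 - 16 * s\<^sup>2 * S\<^sup>2))"
proof -
  define \<epsilon>' where "\<epsilon>' = 2 / 5 * \<epsilon>"
  define f where "f = F2 / \<epsilon>'\<^sup>2"
  define g where "g = S / \<epsilon>'"
  have \<epsilon>': "0 < \<epsilon>'" using \<epsilon> by (simp add: \<epsilon>'_def)
  have fg: "0 \<le> f" "0 \<le> g" "F2 = f * \<epsilon>'\<^sup>2" "S = g * \<epsilon>'" using nn \<epsilon>' by (auto simp: f_def g_def)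
  have "25/4 * inverse \<epsilon> ^ 2 * F2 = f" "5/2 * inverse \<epsilon> * S = g"
    by (auto simp: f_def g_def \<epsilon>'_def power2_eq_square divide_simps)
  hence le: "32 * (f + g) * L \<le> N" using le by simp
  show ?thesis
  proof (cases "f + g = 0")
    \<comment> \<open>With both norms 0 the exponent is linear in s, and s is chosen to make it
      exactly L.\<close>
    case True
    hence "F2 = 0" "S = 0" using fg by auto
    moreover have "L \<le> N * (L / (N * (19/60 * \<epsilon>)) * (19/60 * \<epsilon>))" using N \<epsilon> by simp
    moreover have "0 < L / (N * (19/60 * \<epsilon>))" using L N \<epsilon> by simp
    ultimately show ?thesis by (intro exI[of _ "L / (N * (19/60 * \<epsilon>))"]) auto
  next
    case False
    define D where "D = f + g"
    define u where "u = g / D"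
    have D: "0 < D" using False fg by (simp add: D_def)
    have u: "0 \<le> u" "u \<le> 1" "g = u * D" "f = (1 - u) * D" using D fg by (auto simp: u_def D_def field_simps)
    \<comment> \<open>With this s the gain is 19 / (240 D) and the loss at most 1 / (25 D), because
      (1 - u) / (1 - 4 u^2 / 25) \<le> 1 for u in [0, 1]. The difference 47 / (1200 D) exceeds the
      required 1 / (32 D).\<close>
    define s where "s = 1 / (10 * D * \<epsilon>')"
    have s: "0 < s" using D \<epsilon>' by (simp add: s_def)
    have s\<epsilon>: "s * \<epsilon>' = 1 / (10 * D)" using D \<epsilon>' by (simp add: s_def)
    have "16 * s\<^sup>2 * S\<^sup>2 = 16 * (s * \<epsilon>')\<^sup>2 * g\<^sup>2" by (simp add: fg(4) power_mult_distrib)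
    also have "\<dots> = 4 / 25 * u\<^sup>2" unfolding s\<epsilon> u(3) using D by (simp add: power_divide power_mult_distrib)
    finally have s2: "16 * s\<^sup>2 * S\<^sup>2 = 4 / 25 * u\<^sup>2" .
    have uu: "u\<^sup>2 \<le> u" using u by (simp add: power2_eq_square mult_left_le)
    have "4 * s\<^sup>2 * F2 = 4 * (s * \<epsilon>')\<^sup>2 * f" by (simp add: fg(3) power_mult_distrib)
    also have "\<dots> = (1 - u) / (25 * D)"
      unfolding s\<epsilon> u(4) using D by (simp add: power_divide power_mult_distrib power2_eq_square)
    finally have "4 * s\<^sup>2 * F2 = (1 - u) / (25 * D)" .
    hence "4 * s\<^sup>2 * F2 / (1 - 16 * s\<^sup>2 * S\<^sup>2) = (1 - u) / (1 - 4 / 25 * u\<^sup>2) / (25 * D)" by (simp add: s2)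
    also have "\<dots> \<le> 1 / (25 * D)"
      using u uu D by (intro divide_right_mono) (auto simp: divide_le_eq)
    finally have psi: "4 * s\<^sup>2 * F2 / (1 - 16 * s\<^sup>2 * S\<^sup>2) \<le> 1 / (25 * D)" .
    have "s * (19/60 * \<epsilon>) = 19 / (240 * D)" using D \<epsilon> by (simp add: s_def \<epsilon>'_def field_simps)
    hence "s * (19/60 * \<epsilon>) - 4 * s\<^sup>2 * F2 / (1 - 16 * s\<^sup>2 * S\<^sup>2) \<ge> 19 / (240 * D) - 1 / (25 * D)"
      using psi by simp
    also have "19 / (240 * D) - 1 / (25 * D) = 47 / (1200 * D)" using D by (simp add: field_simps)
    also have "1 / (32 * D) \<le> 47 / (1200 * D)" using D by (simp add: field_simps)
    finally have "1 / (32 * D) \<le> s * (19/60 * \<epsilon>) - 4 * s\<^sup>2 * F2 / (1 - 16 * s\<^sup>2 * S\<^sup>2)" .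
    moreover have "L \<le> N * (1 / (32 * D))" using le D by (simp add: D_def field_simps)
    ultimately have "L \<le> N * (s * (19/60 * \<epsilon>) - 4 * s\<^sup>2 * F2 / (1 - 16 * s\<^sup>2 * S\<^sup>2))"
      using N by (smt (verit) mult_left_mono)
    moreover have "16 * s\<^sup>2 * S\<^sup>2 < 1" unfolding s2 using uu u by linarith
    ultimately show ?thesis using s by blast
  qed
qed

text \<open>Since sqrt \<kappa> \<le> s = sqrt (\<kappa> + 1), the ratio q is at most (s - 1) / (s +
  1) \<le> exp (-2/s), so q^(2K) \<le> exp (-4K/s) \<le> 1/X, where X is the argument of the
  logarithm. The factor 1/(2K) absorbs the factor 2, and ln (2\<kappa>) \<ge> 2/3 bounds the
  resulting \<epsilon> / (10 ln (2\<kappa>)) by 3\<epsilon>/20.\<close>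

lemma lanczos_budget:
  fixes \<alpha> \<beta> \<epsilon> :: real
  assumes ab: "0 < \<alpha>" "\<alpha> \<le> \<beta>" and \<epsilon>: "0 < \<epsilon>" and m: "0 < m" and K: "0 < K"
    and le: "sqrt (\<beta>/\<alpha> + 1) / 4 *
           ln (4 * (5/2) * inverse \<epsilon> * real m * (sqrt (\<beta>/\<alpha> + 1) + 1) * ln (2 * (\<beta>/\<alpha>))) \<le> real K"
  shows "real m * (2 * ((sqrt (\<beta> / \<alpha>) + 1) / real (2 * K) *
           ((sqrt (\<beta> / \<alpha>) - 1) / (sqrt (\<beta> / \<alpha>) + 1)) ^ (2 * K))) \<le> 3/20 * \<epsilon>"
proof -
  define \<kappa> where "\<kappa> = \<beta> / \<alpha>"
  define z where "z = sqrt \<kappa>"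
  define s where "s = sqrt (\<kappa> + 1)"
  define q where "q = (z - 1) / (z + 1)"
  define X where "X = 4 * (5/2) * inverse \<epsilon> * real m * (s + 1) * ln (2 * \<kappa>)"
  have \<kappa>: "1 \<le> \<kappa>" using ab by (simp add: \<kappa>_def)
  have z: "1 \<le> z" "z \<le> s" using \<kappa> by (auto simp: z_def s_def)
  have s: "1 < s" using \<kappa> by (simp add: s_def)
  have "2 / 3 \<le> ln (2 :: real)" by (rule ln2_ge_two_thirds)
  also have "\<dots> \<le> ln (2 * \<kappa>)" using \<kappa> by simp
  finally have ln: "2 / 3 \<le> ln (2 * \<kappa>)" .
  have X: "0 < X" unfolding X_def using \<epsilon> m s ln by (intro mult_pos_pos) auto
  have "q = 1 - 2 / (z + 1)" using z by (simp add: q_def field_simps)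
  also have "\<dots> \<le> 1 - 2 / (s + 1)" using z s by (simp add: frac_le)
  also have "\<dots> = (s - 1) / (s + 1)" using s by (simp add: field_simps)
  also have "\<dots> \<le> exp (- 2 / s)" by (rule diff_quotient_le_exp[OF s])
  finally have "q ^ (2 * K) \<le> exp (- 2 / s) ^ (2 * K)" using z by (intro power_mono) (auto simp: q_def)
  also have "\<dots> = exp (- (4 * real K / s))" by (simp flip: exp_of_nat_mult)
  also have "\<dots> \<le> exp (- ln X)"
  proof -
    have "s / 4 * ln X \<le> real K" using le by (simp add: X_def s_def \<kappa>_def)
    hence "ln X \<le> 4 * real K / s" using s by (simp add: field_simps)
    thus ?thesis by simp
  qed
  also have "\<dots> = 1 / X" using X by (simp add: exp_minus inverse_eq_divide)
  finally have qK: "q ^ (2 * K) \<le> 1 / X" .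
  have "real m * (2 * ((z + 1) / real (2 * K) * q ^ (2 * K))) = (real m * ((z + 1) / real K)) * q ^ (2 * K)" by simp
  also have "\<dots> \<le> (real m * (s + 1)) * (1 / X)"
  proof (rule mult_mono[OF _ qK])
    have "(z + 1) / real K \<le> (s + 1) / 1" using z K by (intro frac_le) auto
    thus "real m * ((z + 1) / real K) \<le> real m * (s + 1)" by (intro mult_left_mono) auto
  qed (use z s in \<open>auto simp: q_def\<close>)
  also have "\<dots> = \<epsilon> / (10 * ln (2 * \<kappa>))"
  proof -
    define w where "w = real m * (s + 1)"
    have "0 < w" using m s by (simp add: w_def)
    moreover have "X = 10 * w * ln (2 * \<kappa>) / \<epsilon>" by (simp add: X_def w_def inverse_eq_divide)
    ultimately show ?thesis unfolding w_def[symmetric] by simp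
  qed
  also have "\<dots> \<le> \<epsilon> / (10 * (2 / 3))" using \<epsilon> ln by (intro divide_left_mono) auto
  finally show ?thesis by (simp add: z_def q_def \<kappa>_def)
qed

section \<open>Concentration of the trace estimator\<close>

lemma rademacher_tuples_signs: "rademacher_tuples N m = {ws. set ws \<subseteq> signs m \<and> length ws = N}"
  by (auto simp: rademacher_tuples_def signs_def)

lemma finite_rademacher_tuples: "finite (rademacher_tuples N m)"
  unfolding rademacher_tuples_signs by (rule finite_lists_length_eq) simp

lemma card_rademacher_tuples: "card (rademacher_tuples N m) = (2 ^ m) ^ N"
  unfolding rademacher_tuples_signs by (simp add: card_lists_length_eq)

lemma rademacher_tuples_nonempty: "rademacher_tuples N m \<noteq> {}"
  using card_rademacher_tuples[of N m] by auto

text \<open>Independence of the N samples: the exponential of a sum over a list factorises over its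
  entries.\<close>

lemma sum_exp_lists:
  fixes f :: "'a \<Rightarrow> real"
  assumes "finite S"
  shows "(\<Sum>ws | set ws \<subseteq> S \<and> length ws = N. exp (\<Sum>w\<leftarrow>ws. f w)) = (\<Sum>w\<in>S. exp (f w)) ^ N"
proof (induction N)
  case 0
  have "{ws. set ws \<subseteq> S \<and> length ws = 0} = {[]}" by auto
  thus ?case by simp
next
  case (Suc N)
  let ?T = "{ws. set ws \<subseteq> S \<and> length ws = N}"
  have "(\<Sum>ws | set ws \<subseteq> S \<and> length ws = Suc N. exp (\<Sum>w\<leftarrow>ws. f w)) =
      (\<Sum>(w, ws)\<in>S \<times> ?T. exp (f w) * exp (\<Sum>w\<leftarrow>ws. f w))"
    by (rule sum.reindex_bij_witness[of _ "\<lambda>(w, ws). w # ws" "\<lambda>ws. (hd ws, tl ws)"])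
      (auto simp: length_Suc_conv exp_add)
  also have "\<dots> = (\<Sum>w\<in>S. exp (f w)) * (\<Sum>ws\<in>?T. exp (\<Sum>w\<leftarrow>ws. f w))"
    by (simp add: sum_product flip: sum.cartesian_product)
  finally show ?case using Suc by simp
qed

text \<open>Markov's inequality for the exponential of the sum, by counting samples.\<close>

lemma rademacher_chernoff:
  "measure_pmf.prob (pmf_of_set (rademacher_tuples N m)) {ws. real N * c < (\<Sum>w\<leftarrow>ws. f w)}
    \<le> (exp (- c) * avg m (\<lambda>w. exp (f w))) ^ N"
proof -
  let ?T = "rademacher_tuples N m" and ?E = "{ws. real N * c < (\<Sum>w\<leftarrow>ws. f w)}"
  have "real (card (?T \<inter> ?E)) = (\<Sum>ws\<in>?T \<inter> ?E. 1)" by simp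
  also have "\<dots> \<le> (\<Sum>ws\<in>?T \<inter> ?E. exp (- (real N * c)) * exp (\<Sum>w\<leftarrow>ws. f w))"
    by (intro sum_mono) (auto simp flip: exp_add)
  also have "\<dots> \<le> (\<Sum>ws\<in>?T. exp (- (real N * c)) * exp (\<Sum>w\<leftarrow>ws. f w))"
    using finite_rademacher_tuples by (intro sum_mono2) auto
  also have "\<dots> = exp (- c) ^ N * (\<Sum>w\<in>signs m. exp (f w)) ^ N"
    unfolding sum_distrib_left[symmetric] rademacher_tuples_signs sum_exp_lists[OF finite_signs]
    by (simp flip: exp_of_nat_mult)
  finally have "real (card (?T \<inter> ?E)) / real (card ?T) \<le> exp (- c) ^ N * (\<Sum>w\<in>signs m. exp (f w)) ^ N / real (card ?T)"
    by (intro divide_right_mono) auto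
  also have "\<dots> = (exp (- c) * avg m (\<lambda>w. exp (f w))) ^ N"
    by (simp add: card_rademacher_tuples avg_def power_mult_distrib power_divide)
  finally show ?thesis
    by (simp add: measure_pmf_of_set rademacher_tuples_nonempty finite_rademacher_tuples)
qed

text \<open>The norms enter through upper bounds S and F so that one s can serve every net point.
  The two signs of s give the two tails; the resulting factor 2 is the one inside the logarithm of
  the sample size.\<close>

lemma rademacher_chaos_tail:
  assumes B: "B \<in> carrier_mat m m" "transpose_mat B = B" "\<And>i. i < m \<Longrightarrow> B $$ (i,i) = 0"
    and s: "0 < s" and N: "0 < N"
    and S: "16 * s\<^sup>2 * S\<^sup>2 < 1" "0 \<le> spec_norm B" "spec_norm B \<le> S" and F: "(frob_norm B)\<^sup>2 \<le> F"
  shows "measure_pmf.prob (pmf_of_set (rademacher_tuples N m))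
      {ws. t < \<bar>(\<Sum>w\<leftarrow>ws. w \<bullet> (B *\<^sub>v w)) / real N\<bar>}
    \<le> 2 * exp (- (real N * (s * t - 4 * s\<^sup>2 * F / (1 - 16 * s\<^sup>2 * S\<^sup>2))))"
proof -
  let ?p = "pmf_of_set (rademacher_tuples N m)"
  let ?E = "\<lambda>x. {ws. real N * (s * t) < (\<Sum>w\<leftarrow>ws. x * (w \<bullet> (B *\<^sub>v w)))}"
  define \<psi> where "\<psi> = 4 * s\<^sup>2 * F / (1 - 16 * s\<^sup>2 * S\<^sup>2)"
  have one: "measure_pmf.prob ?p (?E x) \<le> exp (- (real N * (s * t - \<psi>)))" if x: "x\<^sup>2 = s\<^sup>2" for x
  proof -
    have "(spec_norm B)\<^sup>2 \<le> S\<^sup>2" using S by (intro power_mono) auto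
    hence le: "16 * s\<^sup>2 * (spec_norm B)\<^sup>2 \<le> 16 * s\<^sup>2 * S\<^sup>2" by (intro mult_left_mono) auto
    have "avg m (\<lambda>w. exp (x * (w \<bullet> (B *\<^sub>v w)))) \<le>
        exp (4 * x\<^sup>2 * (frob_norm B)\<^sup>2 / (1 - 16 * x\<^sup>2 * (spec_norm B)\<^sup>2))"
    proof (rule rademacher_chaos_mgf[OF B])
      show "16 * x\<^sup>2 * (spec_norm B)\<^sup>2 < 1" unfolding x using le S(1) by linarith
    qed
    also have "\<dots> \<le> exp \<psi>" unfolding \<psi>_def x
      using le S F order_trans[OF zero_le_power2 F]
      by (intro exp_le_cancel_iff[THEN iffD2] frac_le mult_left_mono) auto
    finally have mgf: "avg m (\<lambda>w. exp (x * (w \<bullet> (B *\<^sub>v w)))) \<le> exp \<psi>" .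
    have "measure_pmf.prob ?p (?E x) \<le> (exp (- (s * t)) * avg m (\<lambda>w. exp (x * (w \<bullet> (B *\<^sub>v w))))) ^ N"
      by (rule rademacher_chernoff)
    also have "\<dots> \<le> (exp (- (s * t)) * exp \<psi>) ^ N"
      using mgf by (intro power_mono mult_left_mono mult_nonneg_nonneg) (auto simp: avg_def intro!: divide_nonneg_nonneg sum_nonneg)
    also have "\<dots> = exp (- (real N * (s * t - \<psi>)))"
      by (simp add: algebra_simps flip: exp_add exp_of_nat_mult)
    finally show ?thesis .
  qed
  have "{ws. t < \<bar>(\<Sum>w\<leftarrow>ws. w \<bullet> (B *\<^sub>v w)) / real N\<bar>} \<subseteq> ?E s \<union> ?E (- s)"
  proof
    fix ws assume "ws \<in> {ws. t < \<bar>(\<Sum>w\<leftarrow>ws. w \<bullet> (B *\<^sub>v w)) / real N\<bar>}"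
    hence "real N * t < \<bar>\<Sum>w\<leftarrow>ws. w \<bullet> (B *\<^sub>v w)\<bar>" using N by (simp add: field_simps abs_divide)
    hence "s * (real N * t) < s * \<bar>\<Sum>w\<leftarrow>ws. w \<bullet> (B *\<^sub>v w)\<bar>" using s by simp
    thus "ws \<in> ?E s \<union> ?E (- s)" unfolding Un_iff mem_Collect_eq sum_list_const_mult
      by (cases "0 \<le> (\<Sum>w\<leftarrow>ws. w \<bullet> (B *\<^sub>v w))") (auto simp: mult_ac)
  qed
  hence "measure_pmf.prob ?p {ws. t < \<bar>(\<Sum>w\<leftarrow>ws. w \<bullet> (B *\<^sub>v w)) / real N\<bar>} \<le> measure_pmf.prob ?p (?E s \<union> ?E (- s))"
    by (intro measure_pmf.finite_measure_mono) auto
  also have "\<dots> \<le> measure_pmf.prob ?p (?E s) + measure_pmf.prob ?p (?E (- s))"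
    by (rule measure_Un_le) auto
  also have "\<dots> \<le> 2 * exp (- (real N * (s * t - \<psi>)))" using one[of s] one[of "- s"] by simp
  finally show ?thesis by (simp add: \<psi>_def)
qed

lemma signs_scalar_prod: "w \<in> signs m \<Longrightarrow> w \<bullet> w = real m"
proof -
  assume w: "w \<in> signs m"
  have "w \<bullet> w = (\<Sum>i<m. w $ i * w $ i)" using scalar_prod_sum[OF signs_carrier signs_carrier] w by blast
  also have "\<dots> = (\<Sum>i<m. 1)" using w by (intro sum.cong refl) (auto simp: signs_def)
  finally show ?thesis by simp
qed

lemma offdiag_carrier: "B \<in> carrier_mat m m \<Longrightarrow> offdiag B \<in> carrier_mat m m"
  by (simp add: offdiag_def)

text \<open>Squares of signs are 1, so the diagonal contributes its trace without randomness and all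
  fluctuation comes from the off-diagonal part.\<close>

lemma signs_quadratic_offdiag:
  assumes B: "B \<in> carrier_mat m m" and w: "w \<in> signs m"
  shows "w \<bullet> (B *\<^sub>v w) = w \<bullet> (offdiag B *\<^sub>v w) + (\<Sum>a<m. B $$ (a,a))"
proof -
  note wc = signs_carrier[OF w]
  have "w \<bullet> (B *\<^sub>v w) - w \<bullet> (offdiag B *\<^sub>v w) = (\<Sum>a<m. \<Sum>b<m. if a = b then B $$ (a,a) else 0)"
    unfolding bilinear_sum[OF B wc wc] bilinear_sum[OF offdiag_carrier[OF B] wc wc] sum_subtractf[symmetric]
    using B w by (intro sum.cong refl) (auto simp: offdiag_def signs_def)
  thus ?thesis by simp
qed

text \<open>A crude bound in terms of the range of the eigenvalues; it guarantees that the suprema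
  in the sample size are taken over bounded sets.\<close>

lemma frob_norm_offdiag_mat_log_le:
  assumes A: "eigenbasis m A u l" and l: "\<And>k. k < m \<Longrightarrow> \<bar>ln (l k)\<bar> \<le> c"
  shows "(frob_norm (offdiag (mat_log A)))\<^sup>2 \<le> real m * (real m * (real m * c)\<^sup>2)"
proof -
  have u: "\<bar>u k $ a\<bar> \<le> 1" if "k < m" "a < m" for k a
  proof -
    have "(u k $ a)\<^sup>2 \<le> (\<Sum>i<m. (u k $ i)\<^sup>2)" using that by (intro member_le_sum) auto
    also have "\<dots> = 1" using eigenbasis_orthonormal[OF A that(1) that(1)] eigenbasis_carrier(2)[OF A that(1)]
      by (simp add: scalar_prod_sum[of _ m] power2_eq_square)
    finally show ?thesis by (simp add: abs_square_le_1)
  qed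
  have entry: "\<bar>mat_log A $$ (a,b)\<bar> \<le> real m * c" if "a < m" "b < m" for a b
  proof -
    have "\<bar>mat_log A $$ (a,b)\<bar> \<le> (\<Sum>k<m. \<bar>ln (l k) * u k $ a * u k $ b\<bar>)"
      using that unfolding mat_log_def eigenbasis_mat_fun[OF A] by (simp add: sum_abs)
    also have "\<dots> \<le> (\<Sum>k<m. c * 1 * 1)"
      unfolding abs_mult using u l that by (intro sum_mono mult_mono) (auto intro: order_trans[OF abs_ge_zero])
    finally show ?thesis by simp
  qed
  have d: "dim_row (mat_log A) = m" "dim_col (mat_log A) = m" by (auto simp: mat_log_def eigenbasis_mat_fun[OF A])
  have "(frob_norm (offdiag (mat_log A)))\<^sup>2 = (\<Sum>i<m. \<Sum>j<m. (offdiag (mat_log A) $$ (i,j))\<^sup>2)"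
    by (simp add: frob_norm_def sum_nonneg offdiag_def d)
  also have "\<dots> \<le> (\<Sum>i<m. \<Sum>j<m. (real m * c)\<^sup>2)"
  proof (intro sum_mono)
    fix i j assume "i \<in> {..<m}" "j \<in> {..<m}"
    hence "\<bar>offdiag (mat_log A) $$ (i,j)\<bar> \<le> real m * c"
      using entry[of i j] by (auto simp: offdiag_def d intro: order_trans[OF abs_ge_zero])
    from power_mono[OF this, of 2] show "(offdiag (mat_log A) $$ (i,j))\<^sup>2 \<le> (real m * c)\<^sup>2" by simp
  qed
  finally show ?thesis by simp
qed

lemma mean_diff_le:
  fixes f g :: "'a \<Rightarrow> real"
  assumes "\<And>w. w \<in> set ws \<Longrightarrow> \<bar>f w - g w\<bar> \<le> e" "length ws = N" "0 < N"
  shows "\<bar>(\<Sum>w\<leftarrow>ws. f w) / real N - (\<Sum>w\<leftarrow>ws. g w) / real N\<bar> \<le> e"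
proof -
  have "\<bar>(\<Sum>w\<leftarrow>ws. f w) - (\<Sum>w\<leftarrow>ws. g w)\<bar> \<le> real (length ws) * e" using assms(1)
  proof (induction ws)
    case (Cons w ws)
    have "\<bar>f w - g w\<bar> \<le> e" "\<bar>(\<Sum>w\<leftarrow>ws. f w) - (\<Sum>w\<leftarrow>ws. g w)\<bar> \<le> real (length ws) * e" using Cons by auto
    thus ?case by (simp add: algebra_simps)
  qed simp
  thus ?thesis using assms(2,3) by (simp add: field_simps abs_divide flip: diff_divide_distrib)
qed

theorem theorem4p3:
  fixes \<Theta> :: "(real^'p) set"
    and \<Psi> :: "real^'p \<Rightarrow> real mat"
    and m K N :: nat and \<delta> \<epsilon> r L\<^sub>\<Psi> \<alpha> \<beta> :: real
  assumes "0 < \<delta>" "\<delta> < 1" "0 < \<epsilon>"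
    and "compact \<Theta>" "0 < r" "\<exists>c. \<Theta> \<subseteq> cball c r"
    and "0 < m"
    and "\<And>\<theta>. \<theta> \<in> \<Theta> \<Longrightarrow> \<Psi> \<theta> \<in> carrier_mat m m \<and> sym_mat (\<Psi> \<theta>)"
    and "0 \<le> L\<^sub>\<Psi>"
    and "\<And>\<theta> \<theta>'. \<theta> \<in> \<Theta> \<Longrightarrow> \<theta>' \<in> \<Theta> \<Longrightarrow> spec_norm (\<Psi> \<theta> - \<Psi> \<theta>') \<le> L\<^sub>\<Psi> * norm (\<theta> - \<theta>')"
    and "0 < \<alpha>" "\<alpha> \<le> \<beta>"
    and "\<And>\<theta>. \<theta> \<in> \<Theta> \<Longrightarrow> loewner_between \<alpha> (\<Psi> \<theta>) \<beta>"
    and "1 \<le> K" "1 \<le> N"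
    and "real K \<ge> sqrt (\<beta>/\<alpha> + 1) / 4 *
           ln (4 * (5/2) * inverse \<epsilon> * real m * (sqrt (\<beta>/\<alpha> + 1) + 1) * ln (2 * (\<beta>/\<alpha>)))"
    and "real N \<ge> 32 * ((25/4) * inverse \<epsilon> ^ 2 * (SUP \<theta>\<in>\<Theta>. (frob_norm (offdiag (mat_log (\<Psi> \<theta>))))^2)
                        + (5/2) * inverse \<epsilon> * (SUP \<theta>\<in>\<Theta>. spec_norm (offdiag (mat_log (\<Psi> \<theta>)))))
                 * ln (2 * max ((3 * r / (\<alpha> * \<epsilon> / (5 * real m * L\<^sub>\<Psi>))) ^ CARD('p)) 1 / \<delta>)"
  shows "measure_pmf.prob (pmf_of_set (rademacher_tuples N m))
           {ws. \<forall>\<theta>\<in>\<Theta>. \<bar>slq K (\<Psi> \<theta>) ws - ln (det (\<Psi> \<theta>))\<bar> \<le> \<epsilon>} \<ge> 1 - \<delta>"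
proof (cases "\<Theta> = {}")
  case True
  thus ?thesis using assms(1) by simp
next
  case False
  note \<delta> = assms(1,2) and \<epsilon> = assms(3) and r = assms(5) and m = assms(7) and L = assms(9) and lip = assms(10)
    and \<alpha> = assms(11) and lb = assms(13)
  have K: "0 < K" and N: "0 < N" using assms(14,15) by auto
  have \<Psi>: "\<Psi> \<theta> \<in> carrier_mat m m" "transpose_mat (\<Psi> \<theta>) = \<Psi> \<theta>" if "\<theta> \<in> \<Theta>" for \<theta>
    using assms(8)[OF that] by (auto simp: sym_mat_def)
  have "\<exists>u l. eigenbasis m (\<Psi> \<theta>) u l" if "\<theta> \<in> \<Theta>" for \<theta>
    using symmetric_eigenbasis[OF \<Psi>[OF that]] by blast
  then obtain u l where e: "\<And>\<theta>. \<theta> \<in> \<Theta> \<Longrightarrow> eigenbasis m (\<Psi> \<theta>) (u \<theta>) (l \<theta>)" by metis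
  have l: "\<alpha> \<le> l \<theta> k" "l \<theta> k \<le> \<beta>" if "\<theta> \<in> \<Theta>" "k < m" for \<theta> k
    using eigenbasis_loewner[OF e lb] that by auto
  define B where "B \<theta> = offdiag (mat_log (\<Psi> \<theta>))" for \<theta>
  have lc: "mat_log (\<Psi> \<theta>) \<in> carrier_mat m m" if "\<theta> \<in> \<Theta>" for \<theta>
    by (simp add: mat_log_def eigenbasis_mat_fun[OF e[OF that]])
  have B: "B \<theta> \<in> carrier_mat m m" "transpose_mat (B \<theta>) = B \<theta>" "\<And>i. i < m \<Longrightarrow> B \<theta> $$ (i,i) = 0"
    if "\<theta> \<in> \<Theta>" for \<theta>
  proof -
    show "B \<theta> \<in> carrier_mat m m" unfolding B_def by (rule offdiag_carrier[OF lc[OF that]])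
    show "transpose_mat (B \<theta>) = B \<theta>"
      by (rule eq_matI) (auto simp: B_def offdiag_def mat_log_def eigenbasis_mat_fun[OF e[OF that]] mult_ac)
    show "B \<theta> $$ (i,i) = 0" if "i < m" for i
      using that lc[OF \<open>\<theta> \<in> \<Theta>\<close>] by (simp add: B_def offdiag_def)
  qed

  define F2 where "F2 = (SUP \<theta>\<in>\<Theta>. (frob_norm (B \<theta>))\<^sup>2)"
  define S where "S = (SUP \<theta>\<in>\<Theta>. spec_norm (B \<theta>))"
  define C where "C = real m * (real m * (real m * (\<bar>ln \<alpha>\<bar> + \<bar>ln \<beta>\<bar>))\<^sup>2)"
  have FC: "(frob_norm (B \<theta>))\<^sup>2 \<le> C" if "\<theta> \<in> \<Theta>" for \<theta>
    unfolding B_def C_def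
  proof (rule frob_norm_offdiag_mat_log_le[OF e[OF that]])
    fix k assume k: "k < m"
    have "ln \<alpha> \<le> ln (l \<theta> k)" "ln (l \<theta> k) \<le> ln \<beta>" using l[OF that k] \<alpha> by auto
    thus "\<bar>ln (l \<theta> k)\<bar> \<le> \<bar>ln \<alpha>\<bar> + \<bar>ln \<beta>\<bar>" by linarith
  qed
  have F2: "(frob_norm (B \<theta>))\<^sup>2 \<le> F2" if "\<theta> \<in> \<Theta>" for \<theta>
    unfolding F2_def using that FC by (intro cSUP_upper bdd_aboveI2[of _ _ C])
  have "spec_norm (B \<theta>) \<le> sqrt C" if "\<theta> \<in> \<Theta>" for \<theta>
    using spec_norm_le_frob_norm[OF B(1)[OF that] m] real_le_rsqrt[OF FC[OF that]] by linarith
  hence S: "spec_norm (B \<theta>) \<le> S" if "\<theta> \<in> \<Theta>" for \<theta>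
    unfolding S_def using that by (intro cSUP_upper bdd_aboveI2[of _ _ "sqrt C"])
  obtain \<theta>0 where \<theta>0: "\<theta>0 \<in> \<Theta>" using False by blast
  have nn: "0 \<le> F2" "0 \<le> S"
    using F2[OF \<theta>0] S[OF \<theta>0] spec_norm_nonneg[OF B(1)[OF \<theta>0] m] zero_le_power2[of "frob_norm (B \<theta>0)"] by linarith+

  \<comment> \<open>Here \<open>h / L\<^sub>\<Psi>\<close> is \<eta>. Distances are measured after
    multiplication by \<open>L\<^sub>\<Psi>\<close>, which stays meaningful for
    \<open>L\<^sub>\<Psi> = 0\<close>.\<close>
  define h where "h = \<alpha> * \<epsilon> / (5 * real m)"
  have h: "0 < h" using \<alpha> \<epsilon> m by (simp add: h_def)
  define \<gamma> where "\<gamma> = max ((3 * r / (h / L\<^sub>\<Psi>)) ^ CARD('p)) 1"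
  have \<gamma>: "1 \<le> \<gamma>" by (simp add: \<gamma>_def)
  obtain c where "\<Theta> \<subseteq> cball c r" using assms(6) by blast
  then obtain T where T: "finite T" "T \<subseteq> \<Theta>" "real (card T) \<le> \<gamma>"
    "\<And>\<theta>. \<theta> \<in> \<Theta> \<Longrightarrow> \<exists>\<theta>'\<in>T. L\<^sub>\<Psi> * norm (\<theta> - \<theta>') \<le> 4/3 * h"
    using exists_lipschitz_net[of \<Theta> c r L\<^sub>\<Psi> h] False r L h unfolding \<gamma>_def by auto
  define \<Lambda> where "\<Lambda> = ln (2 * \<gamma> / \<delta>)"
  have big: "1 < 2 * \<gamma> / \<delta>" using \<gamma> \<delta> by (simp add: field_simps)
  hence \<Lambda>: "0 < \<Lambda>" by (simp add: \<Lambda>_def)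
  have "32 * (25/4 * inverse \<epsilon> ^ 2 * F2 + 5/2 * inverse \<epsilon> * S) * \<Lambda> \<le> real N"
    using assms(17) by (simp add: F2_def S_def B_def \<Lambda>_def \<gamma>_def h_def)
  then obtain s where s: "0 < s" "16 * s\<^sup>2 * S\<^sup>2 < 1"
    "\<Lambda> \<le> real N * (s * (19/60 * \<epsilon>) - 4 * s\<^sup>2 * F2 / (1 - 16 * s\<^sup>2 * S\<^sup>2))"
    using chernoff_parameter[OF nn \<epsilon> \<Lambda>, of "real N"] N by auto
  let ?p = "pmf_of_set (rademacher_tuples N m)"
  \<comment> \<open>The share 19/60 is what quadrature (3/20) and the two moves to the net (4/15
    each) leave of \<epsilon>.\<close>
  define bad where "bad \<theta> = {ws. 19/60 * \<epsilon> < \<bar>(\<Sum>w\<leftarrow>ws. w \<bullet> (B \<theta> *\<^sub>v w)) / real N\<bar>}" for \<theta>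
  have bad: "measure_pmf.prob ?p (bad \<theta>) \<le> \<delta> / \<gamma>" if "\<theta> \<in> T" for \<theta>
  proof -
    have \<theta>: "\<theta> \<in> \<Theta>" using that T by blast
    have "measure_pmf.prob ?p (bad \<theta>) \<le> 2 * exp (- (real N * (s * (19/60 * \<epsilon>) - 4 * s\<^sup>2 * F2 / (1 - 16 * s\<^sup>2 * S\<^sup>2))))"
      unfolding bad_def
      by (rule rademacher_chaos_tail[OF B[OF \<theta>] s(1) N s(2) spec_norm_nonneg[OF B(1)[OF \<theta>] m] S[OF \<theta>] F2[OF \<theta>]])
    also have "\<dots> \<le> 2 * exp (- \<Lambda>)" using s(3) by simp
    also have "\<dots> = \<delta> / \<gamma>" using big \<gamma> \<delta> by (simp add: \<Lambda>_def exp_minus)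
    finally show ?thesis .
  qed
  have "measure_pmf.prob ?p (\<Union>\<theta>\<in>T. bad \<theta>) \<le> (\<Sum>\<theta>\<in>T. measure_pmf.prob ?p (bad \<theta>))"
    by (rule measure_pmf.finite_measure_subadditive_finite) (use T in auto)
  also have "\<dots> \<le> (\<Sum>\<theta>\<in>T. \<delta> / \<gamma>)" by (intro sum_mono bad)
  also have "\<dots> = real (card T) * (\<delta> / \<gamma>)" by simp
  also have "\<dots> \<le> \<gamma> * (\<delta> / \<gamma>)" using T(3) \<delta> \<gamma> by (intro mult_right_mono) auto
  finally have union: "measure_pmf.prob ?p (\<Union>\<theta>\<in>T. bad \<theta>) \<le> \<delta>" using \<gamma> by simp

  define q where "q = (sqrt (\<beta> / \<alpha>) - 1) / (sqrt (\<beta> / \<alpha>) + 1)"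
  obtain P where P: "degree P < 2 * K"
    "\<And>x. x \<in> {\<alpha>..\<beta>} \<Longrightarrow> \<bar>ln x - poly P x\<bar> \<le> (sqrt (\<beta> / \<alpha>) + 1) / real (2 * K) * q ^ (2 * K)"
    using ln_poly_approx[OF assms(11,12), of "2 * K"] K unfolding q_def by auto
  have good: "\<bar>slq K (\<Psi> \<theta>) ws - ln (det (\<Psi> \<theta>))\<bar> \<le> \<epsilon>"
    if ws: "ws \<in> rademacher_tuples N m" "ws \<notin> (\<Union>\<theta>\<in>T. bad \<theta>)" and \<theta>: "\<theta> \<in> \<Theta>" for ws \<theta>
  proof -
    have len: "length ws = N" and sgn: "\<And>w. w \<in> set ws \<Longrightarrow> w \<in> signs m"
      using ws(1) by (auto simp: rademacher_tuples_signs)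
    obtain \<theta>' where \<theta>': "\<theta>' \<in> T" "\<theta>' \<in> \<Theta>" "L\<^sub>\<Psi> * norm (\<theta> - \<theta>') \<le> 4/3 * h" using T \<theta> by blast
    define M where "M x = (\<Sum>w\<leftarrow>ws. w \<bullet> (mat_log (\<Psi> x) *\<^sub>v w)) / real N" for x
    have 1: "\<bar>slq K (\<Psi> \<theta>) ws - M \<theta>\<bar> \<le> 3/20 * \<epsilon>"
      unfolding slq_def M_def len
    proof (rule mean_diff_le[OF _ len N])
      fix w assume "w \<in> set ws"
      hence w: "w \<in> signs m" by (rule sgn)
      have "\<bar>slq_quad K (\<Psi> \<theta>) w - w \<bullet> (mat_log (\<Psi> \<theta>) *\<^sub>v w)\<bar> \<le>
          (w \<bullet> w) * (2 * ((sqrt (\<beta> / \<alpha>) + 1) / real (2 * K) * q ^ (2 * K)))"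
        using m by (intro slq_quad_error[OF \<Psi>[OF \<theta>] signs_carrier[OF w] _ lb[OF \<theta>] \<alpha> K P])
          (auto simp: signs_scalar_prod[OF w])
      also have "\<dots> \<le> 3/20 * \<epsilon>"
        unfolding signs_scalar_prod[OF w] q_def by (rule lanczos_budget[OF assms(11,12) \<epsilon> m K assms(16)])
      finally show "\<bar>slq_quad K (\<Psi> \<theta>) w - w \<bullet> (mat_log (\<Psi> \<theta>) *\<^sub>v w)\<bar> \<le> 3/20 * \<epsilon>" .
    qed
    have "spec_norm (\<Psi> \<theta> - \<Psi> \<theta>') \<le> 4/3 * h" using lip[OF \<theta> \<theta>'(2)] \<theta>'(3) by linarith
    hence "real m * (spec_norm (\<Psi> \<theta> - \<Psi> \<theta>') / \<alpha>) \<le> real m * (4/3 * h / \<alpha>)"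
      using \<alpha> by (intro mult_left_mono divide_right_mono) auto
    also have "\<dots> = 4/15 * \<epsilon>" using \<alpha> m by (simp add: h_def)
    finally have step: "real m * (spec_norm (\<Psi> \<theta> - \<Psi> \<theta>') / \<alpha>) \<le> 4/15 * \<epsilon>" .
    have 2: "\<bar>M \<theta> - M \<theta>'\<bar> \<le> 4/15 * \<epsilon>"
      unfolding M_def
    proof (rule mean_diff_le[OF _ len N])
      fix w assume "w \<in> set ws"
      hence w: "w \<in> signs m" by (rule sgn)
      have "\<bar>w \<bullet> (mat_log (\<Psi> \<theta>) *\<^sub>v w) - w \<bullet> (mat_log (\<Psi> \<theta>') *\<^sub>v w)\<bar> \<le> spec_norm (\<Psi> \<theta> - \<Psi> \<theta>') * (w \<bullet> w) / \<alpha>"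
        using l \<theta> \<theta>'(2) by (intro log_quadratic_form_lipschitz[OF e[OF \<theta>] e[OF \<theta>'(2)] signs_carrier[OF w] \<alpha>]) auto
      thus "\<bar>w \<bullet> (mat_log (\<Psi> \<theta>) *\<^sub>v w) - w \<bullet> (mat_log (\<Psi> \<theta>') *\<^sub>v w)\<bar> \<le> 4/15 * \<epsilon>"
        using step unfolding signs_scalar_prod[OF w] by (simp add: mult.commute)
    qed
    have ld: "ln (det (\<Psi> \<theta>')) = (\<Sum>a<m. mat_log (\<Psi> \<theta>') $$ (a,a))"
      using less_le_trans[OF \<alpha> l(1)[OF \<theta>'(2)]] by (rule ln_det_eq_trace_mat_log[OF e[OF \<theta>'(2)]])
    \<comment> \<open>Error 0 in \<open>mean_diff_le\<close> lifts an identity for each w to the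
      means: ln det is the trace that splits off from the quadratic form.\<close>
    have "\<bar>M \<theta>' - (\<Sum>w\<leftarrow>ws. w \<bullet> (B \<theta>' *\<^sub>v w) + ln (det (\<Psi> \<theta>'))) / real N\<bar> \<le> 0"
      unfolding M_def
      by (rule mean_diff_le[OF _ len N]) (simp add: signs_quadratic_offdiag[OF lc[OF \<theta>'(2)] sgn] B_def ld)
    moreover have "(\<Sum>w\<leftarrow>ws. w \<bullet> (B \<theta>' *\<^sub>v w) + ln (det (\<Psi> \<theta>'))) / real N =
        (\<Sum>w\<leftarrow>ws. w \<bullet> (B \<theta>' *\<^sub>v w)) / real N + ln (det (\<Psi> \<theta>'))"
      using N by (simp add: sum_list_addf sum_list_triv len add_divide_distrib)
    moreover have "\<bar>(\<Sum>w\<leftarrow>ws. w \<bullet> (B \<theta>' *\<^sub>v w)) / real N\<bar> \<le> 19/60 * \<epsilon>"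
      using ws(2) \<theta>'(1) by (auto simp: bad_def not_less)
    ultimately have 3: "\<bar>M \<theta>' - ln (det (\<Psi> \<theta>'))\<bar> \<le> 19/60 * \<epsilon>" by linarith
    have 4: "\<bar>ln (det (\<Psi> \<theta>)) - ln (det (\<Psi> \<theta>'))\<bar> \<le> 4/15 * \<epsilon>"
      using ln_det_lipschitz[OF e[OF \<theta>] e[OF \<theta>'(2)] \<alpha> l(1)[OF \<theta>] l(1)[OF \<theta>'(2)]] step by linarith
    \<comment> \<open>The error budget is \<open>3/20 + 4/15 + 19/60 + 4/15 = 1\<close>.\<close>
    show ?thesis using 1 2 3 4 by linarith
  qed
  let ?G = "{ws. \<forall>\<theta>\<in>\<Theta>. \<bar>slq K (\<Psi> \<theta>) ws - ln (det (\<Psi> \<theta>))\<bar> \<le> \<epsilon>}"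
  have sp: "set_pmf ?p = rademacher_tuples N m"
    by (rule set_pmf_of_set[OF rademacher_tuples_nonempty finite_rademacher_tuples])
  have "1 - \<delta> \<le> measure_pmf.prob ?p (- (\<Union>\<theta>\<in>T. bad \<theta>))"
    using union measure_pmf.prob_compl[of "\<Union>\<theta>\<in>T. bad \<theta>" ?p] by (simp add: Compl_eq_Diff_UNIV)
  \<comment> \<open>\<open>good\<close> speaks only of tuples of sign vectors, so the event is first
    restricted to the support.\<close>
  also have "\<dots> = measure_pmf.prob ?p (- (\<Union>\<theta>\<in>T. bad \<theta>) \<inter> set_pmf ?p)" by (rule measure_Int_set_pmf[symmetric])
  also have "\<dots> \<le> measure_pmf.prob ?p ?G"
    using good unfolding sp by (intro measure_pmf.finite_measure_mono) auto
  finally show ?thesis .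
qed

end
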